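(* Let $X$, $\psi$, $\{a_j\}$, $\{m_j\}$, $\{b_{jk}\}$ and $\delta_{jk}$ be as in the context, and let $\overline\delta_j^{(2,m_j)}:=\frac1{m_j}\sum_{k=1}^{m_j}\delta_{jk}^2$. Assume that for all $j\in\mathbb N$ and $(k,l)\in\mathbb Z^2$, $b_{jk}-b_{jl}=\gamma_j(k-l)$, where $\{\gamma_j\}$ is a sequence of positive reals with $\lim_{j\to+\infty}a_j/\gamma_j=c\in(0,+\infty)$ and $\lim_{j\to+\infty}m_j^2\big(\gamma_j/a_j-1/c\big)=0$, and assume $\lim_{j\to+\infty}m_ja_j^{-4}=0$. Then, as $j\to+\infty$, the random variables \[ \overline Y_j:=\sqrt{m_j}\Big(\overline\delta_j^{(2,m_j)}-s_0^{-4\alpha}\int_{\mathbb R}|\widehat\psi(\eta)|^2d\eta\Big) \] converge in distribution to a centred Gaussian random variable with variance \[ \mathcal V_1:=4c\pi s_0^{-8\alpha}\int_{-c\pi}^{c\pi}\Big|\sum_{n\in\mathbb Z}|\widehat\psi(\eta+2nc\pi)|^2\Big|^2d\eta . \]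
   Context: Standing setting. $X(t)$, $t\in\mathbb R$, is a measurable mean-square continuous real-valued stationary zero-mean Gaussian process whose spectral density is $f(\lambda)=h(\lambda)/|\lambda^2-s_0^2|^{2\alpha}$, where $s_0>1$, $\alpha\in(0,1/2)$, and $h$ is an even, non-negative, bounded, four times continuously differentiable function with $h^{(i)}(0)=0$ for $i=1,2,3,4$, $h(0)=1$, $h>0$ in some neighbourhood of $\pm s_0$, and $\int_{\mathbb R}h(\lambda)(1+|\lambda|)^{-\varepsilon}d\lambda<\infty$ for every $\varepsilon>0$. $\psi\in L_1(\mathbb R)$ is real-valued with Fourier transform $\widehat\psi(\lambda)=\int_{\mathbb R}e^{-i\lambda t}\psi(t)\,dt$ supported in $[-A,A]$ for some $A>0$ and of bounded variation on $[-A,A]$. $\{a_j\}$ is an unbounded strictly increasing sequence of positive reals, $\{m_j\}$ an unboundedly increasing sequence of positive integers, $\{b_{jk}\}_{(j,k)\in\mathbb N\times\mathbb Z}$ an array of reals. $\delta_{jk}:=a_j^{-1/2}\int_{\mathbb R}\psi\big((t-b_{jk})/a_j\big)X(t)\,dt$. *)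

theory Defs
  imports "HOL-Probability.Probability"
begin

definition fourier_tr :: "(real \<Rightarrow> real) \<Rightarrow> real \<Rightarrow> complex" where
  "fourier_tr \<psi> w = (LINT t|lborel. cis (- (w * t)) * complex_of_real (\<psi> t))"

definition bounded_variation_on :: "(real \<Rightarrow> 'b::real_normed_vector) \<Rightarrow> real \<Rightarrow> real \<Rightarrow> bool" where
  "bounded_variation_on g a b \<longleftrightarrow>
     (\<exists>V. \<forall>(n::nat) (x::nat \<Rightarrow> real).
        x 0 = a \<and> x n = b \<and> (\<forall>i<n. x i \<le> x (Suc i)) \<longrightarrow>
        (\<Sum>i<n. norm (g (x (Suc i)) - g (x i))) \<le> V)"

definition gauss_law :: "real \<Rightarrow> real \<Rightarrow> real measure" where
  "gauss_law \<mu> v = (if v = 0 then return lborel \<mu> else density lborel (normal_density \<mu> (sqrt v)))"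

definition gaussian_rv :: "'a measure \<Rightarrow> ('a \<Rightarrow> real) \<Rightarrow> bool" where
  "gaussian_rv M Y \<longleftrightarrow> Y \<in> borel_measurable M \<and>
     (\<exists>\<mu> v. v \<ge> 0 \<and> distr M lborel Y = gauss_law \<mu> v)"

definition gaussian_process :: "'a measure \<Rightarrow> (real \<Rightarrow> 'a \<Rightarrow> real) \<Rightarrow> bool" where
  "gaussian_process M X \<longleftrightarrow>
     (\<forall>(T::real set) (c::real \<Rightarrow> real). finite T \<longrightarrow> gaussian_rv M (\<lambda>\<omega>. \<Sum>t\<in>T. c t * X t \<omega>))"

definition strictly_stationary :: "'a measure \<Rightarrow> (real \<Rightarrow> 'a \<Rightarrow> real) \<Rightarrow> bool" where
  "strictly_stationary M X \<longleftrightarrow>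
     (\<forall>(T::real set) (\<tau>::real). finite T \<longrightarrow>
        distr M (Pi\<^sub>M T (\<lambda>_. lborel)) (\<lambda>\<omega>. \<lambda>t\<in>T. X t \<omega>) =
        distr M (Pi\<^sub>M T (\<lambda>_. lborel)) (\<lambda>\<omega>. \<lambda>t\<in>T. X (t + \<tau>) \<omega>))"

definition wav_coef :: "(real \<Rightarrow> real) \<Rightarrow> (nat \<Rightarrow> real) \<Rightarrow> (nat \<Rightarrow> int \<Rightarrow> real) \<Rightarrow>
     (real \<Rightarrow> 'a \<Rightarrow> real) \<Rightarrow> nat \<Rightarrow> int \<Rightarrow> 'a \<Rightarrow> real" where
  "wav_coef \<psi> a b X j k \<omega> = a j powr (-1/2) * (LINT t|lborel. \<psi> ((t - b j k) / a j) * X t \<omega>)"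

end

theory Submission
  imports Defs
begin

text \<open>
  The coefficients \<open>\<delta>\<^sub>j\<^sub>k\<close> of one scale are jointly Gaussian with the Toeplitz covariance matrix
  \<open>r\<^sub>j(k - l)\<close>, where \<open>r\<^sub>j(n) = \<integral> q\<^sub>j(x) cos (n x) dx\<close> and
  \<open>q\<^sub>j(x) = (a\<^sub>j / \<gamma>\<^sub>j) f(x / \<gamma>\<^sub>j) |\<psi>^(a\<^sub>j x / \<gamma>\<^sub>j)|\<^sup>2\<close>. In an orthonormal eigenbasis of that matrix the
  characteristic function of the centred quadratic form is a product over the eigenvalues \<open>\<kappa>\<close> of
  characteristic functions of centred chi-square variables, hence it is close to
  \<open>exp (- u\<^sup>2 \<Sum> \<kappa>\<^sup>2 / m\<^sub>j)\<close> as soon as \<open>max \<kappa> = o(\<surd>m\<^sub>j)\<close>. The eigenvalues are in fact bounded, because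
  the \<open>q\<^sub>j\<close> are uniformly bounded with a common bounded support. The mean \<open>\<Sum> \<kappa>\<^sup>2 / m\<^sub>j\<close> is the double integral of
  \<open>q\<^sub>j(x) q\<^sub>j(y)\<close> against the Fejer kernel at \<open>x - y\<close>, which converges to \<open>2 \<pi>\<close> times the squared \<open>L\<^sup>2\<close> norm
  of the periodisation of \<open>lim q\<^sub>j\<close>. Finally \<open>f(l) = f(0) + O(l\<^sup>2)\<close> makes the bias of order
  \<open>a\<^sub>j\<^bsup>-2\<^esup>\<close>, which is negligible against \<open>m\<^sub>j\<^bsup>-1/2\<^esup>\<close>.
\<close>

text \<open>The singularities of \<open>f\<close> at plus and minus \<open>s0\<close> matter only
  for integrability: the density samples \<open>f\<close> at \<open>x / \<gamma> j\<close>, while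
  \<open>fourier_tr \<psi>\<close> has bounded support, so for large \<open>j\<close> only values of
  \<open>f\<close> near 0 enter. Independence and joint densities are avoided throughout. All that
  is used of the coefficients is the law of each finite linear combination, and such a combination
  is one integral of \<open>X\<close> against an integrable function, that is, a limit of finite
  grid sums whose laws are prescribed. The periodisation, and not the limit density itself, appears
  because the Fejer kernel peaks at every multiple of \<open>2 * pi\<close>: frequencies that agree
  modulo the sampling rate are indistinguishable. As \<open>q j\<close> changes with
  \<open>j\<close>, its convergence is needed jointly in the index and the argument. Constants in
  \<open>V1\<close>: for a standard normal \<open>g\<close> the variable \<open>g^2 - 1\<close> has
  variance 2, so the limiting variance is twice the limit of the normalised Frobenius norm. This
  gives \<open>4 * pi\<close> times the squared norm of the periodisation of
  \<open>c * f 0 * |psi^(c x)|^2\<close>, and the substitution \<eta> = c x absorbs one of the two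
  factors \<open>c\<close>.\<close>

lemma integrable_dominated:
  fixes f :: "'a \<Rightarrow> 'b::{banach, second_countable_topology}"
  assumes "integrable M g" "f \<in> borel_measurable M" "\<And>x. norm (f x) \<le> g x"
  shows "integrable M f"
  using assms(3) by (intro Bochner_Integration.integrable_bound[OF assms(1,2)] AE_I2)
    (auto intro: order_trans[OF _ abs_ge_self])

section \<open>Orthogonal diagonalisation of symmetric matrices\<close>

definition bil :: "nat \<Rightarrow> (nat \<Rightarrow> nat \<Rightarrow> real) \<Rightarrow> (nat \<Rightarrow> real) \<Rightarrow> (nat \<Rightarrow> real) \<Rightarrow> real" where
  "bil n R x y = (\<Sum>i<n. \<Sum>j<n. x i * R i j * y j)"

definition orthogonal_rows :: "nat \<Rightarrow> (nat \<Rightarrow> nat \<Rightarrow> real) \<Rightarrow> bool" where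
  "orthogonal_rows n U \<longleftrightarrow> (\<forall>k<n. \<forall>l<n. (\<Sum>i<n. U k i * U l i) = of_bool (k = l))"

definition orthogonal_columns :: "nat \<Rightarrow> (nat \<Rightarrow> nat \<Rightarrow> real) \<Rightarrow> bool" where
  "orthogonal_columns n U \<longleftrightarrow> (\<forall>i<n. \<forall>j<n. (\<Sum>k<n. U k i * U k j) = of_bool (i = j))"

lemma bil_commute:
  assumes "\<And>i j. i < n \<Longrightarrow> j < n \<Longrightarrow> R i j = R j i"
  shows "bil n R x y = bil n R y x"
proof -
  have "bil n R x y = (\<Sum>i<n. \<Sum>j<n. y j * R j i * x i)"
    unfolding bil_def using assms by (intro sum.cong refl) (auto simp: mult_ac)
  also have "\<dots> = bil n R y x"
    unfolding bil_def by (rule sum.swap)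
  finally show ?thesis .
qed

lemma bil_lincomb_left:
  "bil n R (\<lambda>i. c * x i + s * y i) z = c * bil n R x z + s * bil n R y z"
  unfolding bil_def by (simp add: sum_distrib_left sum.distrib algebra_simps)

lemma bil_lincomb_right:
  "bil n R z (\<lambda>i. c * x i + s * y i) = c * bil n R z x + s * bil n R z y"
  unfolding bil_def by (simp add: sum_distrib_left sum.distrib algebra_simps)

lemma bil_diffcomb_left:
  "bil n R (\<lambda>i. c * x i - s * y i) z = c * bil n R x z - s * bil n R y z"
  using bil_lincomb_left[of n R c x "- s" y z] by simp

lemma bil_diffcomb_right:
  "bil n R z (\<lambda>i. c * x i - s * y i) = c * bil n R z x - s * bil n R z y"
  using bil_lincomb_right[of n R z c x "- s" y] by simp

lemma sum_split_two:
  fixes g :: "nat \<Rightarrow> 'b::ab_group_add"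
  assumes "p < n" "q < n" "p \<noteq> q"
  shows "sum g {..<n} = g p + g q + sum g ({..<n} - {p, q})"
proof -
  have "sum g {..<n} = g p + sum g ({..<n} - {p})"
    using assms by (intro sum.remove) auto
  also have "sum g ({..<n} - {p}) = g q + sum g ({..<n} - {p} - {q})"
    using assms by (intro sum.remove) auto
  also have "{..<n} - {p} - {q} = {..<n} - {p, q}" by auto
  finally show ?thesis by (simp add: add.assoc)
qed

text \<open>A Givens rotation in the plane of rows \<open>p\<close> and \<open>q\<close>; both
  updates refer to the original \<open>U\<close>.\<close>

definition rotate_rows :: "nat \<Rightarrow> nat \<Rightarrow> real \<Rightarrow> real \<Rightarrow> (nat \<Rightarrow> nat \<Rightarrow> real) \<Rightarrow> nat \<Rightarrow> nat \<Rightarrow> real" where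
  "rotate_rows p q c s U =
     U(p := (\<lambda>i. c * U p i + s * U q i), q := (\<lambda>i. c * U q i - s * U p i))"

lemma orthogonal_rows_rotate:
  assumes "orthogonal_rows n U" "p < n" "q < n" "p \<noteq> q" "c\<^sup>2 + s\<^sup>2 = 1"
  shows "orthogonal_rows n (rotate_rows p q c s U)"
proof -
  define D where "D x y = (\<Sum>i<n. x i * y i)" for x y :: "nat \<Rightarrow> real"
  have Dl: "D (\<lambda>i. a * x i + b * y i) z = a * D x z + b * D y z" for a b x y z
    unfolding D_def by (simp add: sum_distrib_left sum.distrib algebra_simps)
  have Dr: "D z (\<lambda>i. a * x i + b * y i) = a * D z x + b * D z y" for a b x y z
    unfolding D_def by (simp add: sum_distrib_left sum.distrib algebra_simps)
  have Dl': "D (\<lambda>i. a * x i - b * y i) z = a * D x z - b * D y z" for a b x y z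
    using Dl[of a x "- b" y z] by simp
  have Dr': "D z (\<lambda>i. a * x i - b * y i) = a * D z x - b * D z y" for a b x y z
    using Dr[of z a x "- b" y] by simp
  have DU: "D (U k) (U l) = of_bool (k = l)" if "k < n" "l < n" for k l
    using assms(1) that unfolding orthogonal_rows_def D_def by auto
  have cs: "c * c + s * s = 1" "s * s + c * c = 1" using assms(5) by (auto simp: power2_eq_square)
  have "D (rotate_rows p q c s U k) (rotate_rows p q c s U l) = of_bool (k = l)"
    if kl: "k < n" "l < n" for k l
    using kl assms(2-4) cs unfolding rotate_rows_def
    by (auto simp: Dl Dr Dl' Dr' DU)
  then show ?thesis unfolding orthogonal_rows_def D_def by blast
qed

lemma orthogonal_columns_rotate:
  assumes "orthogonal_columns n U" "p < n" "q < n" "p \<noteq> q" "c\<^sup>2 + s\<^sup>2 = 1"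
  shows "orthogonal_columns n (rotate_rows p q c s U)"
proof -
  have "(\<Sum>k<n. rotate_rows p q c s U k i * rotate_rows p q c s U k j) = (\<Sum>k<n. U k i * U k j)"
    (is "?l = ?r") for i j
  proof -
    have eq: "(c * U p i + s * U q i) * (c * U p j + s * U q j)
        + (c * U q i - s * U p i) * (c * U q j - s * U p j)
      = (c\<^sup>2 + s\<^sup>2) * (U p i * U p j + U q i * U q j)"
      by (simp add: algebra_simps power2_eq_square)
    have "?l = U p i * U p j + U q i * U q j
        + (\<Sum>k\<in>{..<n}-{p,q}. rotate_rows p q c s U k i * rotate_rows p q c s U k j)"
      unfolding sum_split_two[OF assms(2-4)] using assms(4) eq assms(5)
      by (simp add: rotate_rows_def)
    also have "\<dots> = ?r"
      unfolding sum_split_two[OF assms(2-4), of "\<lambda>k. U k i * U k j"]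
      by (intro arg_cong2[where f="(+)"] sum.cong) (auto simp: rotate_rows_def)
    finally show ?thesis .
  qed
  then show ?thesis using assms(1) unfolding orthogonal_columns_def by simp
qed

text \<open>With \<open>x\<close>, \<open>y\<close> the two diagonal entries and \<open>d\<close>
  the off-diagonal one, a rotation fixes \<open>x + y\<close> and can turn the vector
  \<open>(x - y, 2 * d)\<close> onto the first axis. Since
  \<open>2 * (x^2 + y^2) = (x + y)^2 + (x - y)^2\<close>, the sum of squares then grows by
  \<open>2 * d^2\<close>.\<close>

lemma sum_squares_diagonal_rotate:
  assumes sym: "\<And>i j. i < n \<Longrightarrow> j < n \<Longrightarrow> R i j = R j i"
    and pq: "p < n" "q < n" "p \<noteq> q" and nz: "bil n R (U p) (U q) \<noteq> 0"
  shows "\<exists>c s. c\<^sup>2 + s\<^sup>2 = 1 \<and>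
    (\<Sum>k<n. (bil n R (U k) (U k))\<^sup>2) <
    (\<Sum>k<n. (bil n R (rotate_rows p q c s U k) (rotate_rows p q c s U k))\<^sup>2)"
proof -
  define x y d where "x = bil n R (U p) (U p)" and "y = bil n R (U q) (U q)"
    and "d = bil n R (U p) (U q)"
  define \<rho> where "\<rho> = sqrt ((x - y)\<^sup>2 + (2 * d)\<^sup>2)"
  have dpos: "d\<^sup>2 > 0" using nz d_def by simp
  then have \<rho>: "\<rho> > 0" "\<rho>\<^sup>2 = (x - y)\<^sup>2 + (2 * d)\<^sup>2"
    unfolding \<rho>_def by (auto simp: power_mult_distrib add_nonneg_pos)
  have "((x - y) / \<rho>)\<^sup>2 + (2 * d / \<rho>)\<^sup>2 = 1"
    using \<rho>(1) unfolding power_divide add_divide_distrib[symmetric] \<rho>(2)[symmetric] by simp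
  then obtain t where t: "(x - y) / \<rho> = cos t" "2 * d / \<rho> = sin t"
    using sincos_total_2pi by metis
  \<comment> \<open>The half angle, because the diagonal entries of the rotated form are quadratic
    in \<open>c\<close> and \<open>s\<close> and hence involve \<open>cos t\<close> and
    \<open>sin t\<close>.\<close>
  define c s where "c = cos (t/2)" and "s = sin (t/2)"
  have cs: "c\<^sup>2 + s\<^sup>2 = 1" unfolding c_def s_def by simp
  have C: "cos t = c\<^sup>2 - s\<^sup>2" "sin t = 2 * s * c"
    using cos_double[of "t/2"] sin_double[of "t/2"] by (auto simp: c_def s_def)
  define x' where "x' = bil n R (rotate_rows p q c s U p) (rotate_rows p q c s U p)"
  define y' where "y' = bil n R (rotate_rows p q c s U q) (rotate_rows p q c s U q)"
  have sy: "bil n R (U q) (U p) = d" unfolding d_def using sym by (intro bil_commute)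
  have x': "x' = c\<^sup>2 * x + 2 * (s * c) * d + s\<^sup>2 * y"
    unfolding x'_def using pq(3)
    by (simp add: rotate_rows_def bil_lincomb_left bil_lincomb_right sy
        x_def[symmetric] y_def[symmetric] d_def[symmetric] power2_eq_square algebra_simps)
  have y': "y' = s\<^sup>2 * x - 2 * (s * c) * d + c\<^sup>2 * y"
    unfolding y'_def
    by (simp add: rotate_rows_def bil_diffcomb_left bil_diffcomb_right sy
        x_def[symmetric] y_def[symmetric] d_def[symmetric] power2_eq_square algebra_simps)
  have sum: "x' + y' = x + y"
  proof -
    have "x' + y' = (c\<^sup>2 + s\<^sup>2) * (x + y)" unfolding x' y' by (simp add: algebra_simps)
    then show ?thesis using cs by simp
  qed
  have "x' - y' = cos t * (x - y) + sin t * (2 * d)"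
    unfolding x' y' C by (simp add: algebra_simps)
  also have "\<dots> = \<rho>\<^sup>2 / \<rho>" unfolding t[symmetric] \<rho>(2) by (simp add: power2_eq_square add_divide_distrib)
  also have "\<dots> = \<rho>" by (simp add: power2_eq_square)
  finally have diff: "x' - y' = \<rho>" .
  have "2 * (x'\<^sup>2 + y'\<^sup>2) = (x' + y')\<^sup>2 + (x' - y')\<^sup>2" by (simp add: power2_eq_square algebra_simps)
  also have "\<dots> = (x + y)\<^sup>2 + ((x - y)\<^sup>2 + (2 * d)\<^sup>2)" unfolding sum diff \<rho>(2) ..
  also have "\<dots> > 2 * (x\<^sup>2 + y\<^sup>2)" using dpos by (simp add: power2_eq_square algebra_simps)
  finally have gt: "x\<^sup>2 + y\<^sup>2 < x'\<^sup>2 + y'\<^sup>2" by simp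
  have "(\<Sum>k<n. (bil n R (U k) (U k))\<^sup>2) <
    (\<Sum>k<n. (bil n R (rotate_rows p q c s U k) (rotate_rows p q c s U k))\<^sup>2)"
  proof -
    have "(\<Sum>k\<in>{..<n}-{p,q}. (bil n R (rotate_rows p q c s U k) (rotate_rows p q c s U k))\<^sup>2)
       = (\<Sum>k\<in>{..<n}-{p,q}. (bil n R (U k) (U k))\<^sup>2)"
      by (intro sum.cong) (auto simp: rotate_rows_def)
    then show ?thesis
      unfolding sum_split_two[OF pq] x_def[symmetric] y_def[symmetric] x'_def[symmetric] y'_def[symmetric]
      using gt by simp
  qed
  with cs show ?thesis by blast
qed

text \<open>Tychonoff's theorem, for the product topology that function types carry.\<close>

lemma compact_function_box:
  fixes e :: "'i \<Rightarrow> real"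
  shows "compact {x::'i \<Rightarrow> real. \<forall>i. \<bar>x i\<bar> \<le> e i}"
proof -
  have "{x::'i \<Rightarrow> real. \<forall>i. \<bar>x i\<bar> \<le> e i} = PiE UNIV (\<lambda>i. {- e i..e i})"
    by (auto simp: PiE_UNIV_domain abs_le_iff minus_le_iff)
  moreover have "compactin euclidean (PiE UNIV (\<lambda>i. {- e i..e i}))"
    unfolding euclidean_product_topology[symmetric] compactin_PiE by auto
  ultimately show ?thesis by simp
qed

lemma orthogonal_rows_entry_le_1:
  assumes "orthogonal_rows n U" "k < n" "i < n"
  shows "\<bar>U k i\<bar> \<le> 1"
proof -
  have "(U k i)\<^sup>2 \<le> (\<Sum>i<n. (U k i)\<^sup>2)"
    using assms(3) by (intro member_le_sum) auto
  also have "\<dots> = 1" using assms by (auto simp: orthogonal_rows_def power2_eq_square)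
  finally show ?thesis by (simp add: abs_square_le_1)
qed

text \<open>A maximiser of the sum of squared diagonal entries over the compact orthogonal group is
  diagonal, since otherwise a Jacobi rotation would increase that sum.\<close>

lemma orthogonal_diagonalization:
  fixes R :: "nat \<Rightarrow> nat \<Rightarrow> real"
  assumes sym: "\<And>i j. i < n \<Longrightarrow> j < n \<Longrightarrow> R i j = R j i"
  obtains U where "orthogonal_rows n U" "orthogonal_columns n U"
    "\<And>k l. k < n \<Longrightarrow> l < n \<Longrightarrow> k \<noteq> l \<Longrightarrow> bil n R (U k) (U l) = 0"
proof -
  define e :: "nat \<Rightarrow> nat \<Rightarrow> real" where "e k i = of_bool (k < n \<and> i < n)" for k i
  \<comment> \<open>Matrices are functions on all pairs of naturals, and orthogonality says nothing
    about entries outside the \<open>n\<close> by \<open>n\<close> block. The box \<open>e\<close>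
    forces these to be 0; without it the set would not be compact.\<close>
  define K where "K = {U :: nat \<times> nat \<Rightarrow> real. \<forall>z. \<bar>U z\<bar> \<le> e (fst z) (snd z)} \<inter>
    {U. orthogonal_rows n (curry U) \<and> orthogonal_columns n (curry U)}"
  have ent: "continuous_on UNIV (\<lambda>U :: nat \<times> nat \<Rightarrow> real. U z)" for z
    by (rule continuous_on_product_coordinates)
  have "closed {U :: nat \<times> nat \<Rightarrow> real. orthogonal_rows n (curry U) \<and> orthogonal_columns n (curry U)}"
    unfolding orthogonal_rows_def orthogonal_columns_def curry_def
    by (intro closed_Collect_conj closed_Collect_all closed_Collect_imp open_Collect_const
        closed_Collect_eq continuous_intros ent)
  then have K: "compact K"
    unfolding K_def by (intro compact_Int_closed compact_function_box)
  have "(\<lambda>z. of_bool (fst z = snd z \<and> fst z < n)) \<in> K"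
    by (auto simp: K_def orthogonal_rows_def orthogonal_columns_def e_def curry_def
        of_bool_def if_distrib[of "\<lambda>x. x * _"] cong: if_cong conj_cong)
  then have ne: "K \<noteq> {}" by auto
  define F where "F U = (\<Sum>k<n. (bil n R (U k) (U k))\<^sup>2)" for U
  have "continuous_on K (\<lambda>U. F (curry U))"
    unfolding F_def bil_def curry_def
    by (intro continuous_intros continuous_on_subset[OF ent subset_UNIV])
  then obtain W where W: "W \<in> K" "\<And>U. U \<in> K \<Longrightarrow> F (curry U) \<le> F (curry W)"
    using continuous_attains_sup[OF K ne] by metis
  define V where "V = curry W"
  have V: "orthogonal_rows n V" "orthogonal_columns n V"
    using W(1) by (auto simp: K_def V_def)
  have "bil n R (V k) (V l) = 0" if kl: "k < n" "l < n" "k \<noteq> l" for k l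
  proof (rule ccontr)
    assume "bil n R (V k) (V l) \<noteq> 0"
    from sum_squares_diagonal_rotate[OF sym kl this] obtain c s where cs: "c\<^sup>2 + s\<^sup>2 = 1"
      and gt: "F V < F (rotate_rows k l c s V)" unfolding F_def by auto
    define T where "T = rotate_rows k l c s V"
    have T: "orthogonal_rows n T" "orthogonal_columns n T"
      unfolding T_def using orthogonal_rows_rotate[OF V(1) kl cs] orthogonal_columns_rotate[OF V(2) kl cs] by auto
    \<comment> \<open>The rotated matrix can compete with the maximiser only if it lies in
      \<open>K\<close> again, so it must still vanish outside the block.\<close>
    have out: "V x i = 0" if "\<not> (x < n \<and> i < n)" for x i
    proof -
      have "\<bar>W (x, i)\<bar> \<le> e x i" using W(1) unfolding K_def by auto
      then show ?thesis using that by (auto simp: V_def e_def)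
    qed
    have "\<bar>T x i\<bar> \<le> e x i" for x i
    proof (cases "x < n \<and> i < n")
      case True then show ?thesis using orthogonal_rows_entry_le_1[OF T(1)] by (simp add: e_def)
    next
      case False
      then have "T x i = 0" unfolding T_def rotate_rows_def using kl out by auto
      then show ?thesis by (simp add: e_def)
    qed
    then have "case_prod T \<in> K" unfolding K_def using T by (auto simp: case_prod_beta)
    from W(2)[OF this] gt show False by (simp add: T_def V_def)
  qed
  with V that show thesis by blast
qed

lemma parseval_orthogonal_columns:
  assumes "orthogonal_columns n U"
  shows "(\<Sum>k<n. (\<Sum>i<n. U k i * x i)\<^sup>2) = (\<Sum>i<n. (x i)\<^sup>2)"
proof -
  have "(\<Sum>k<n. (\<Sum>i<n. U k i * x i)\<^sup>2) = (\<Sum>k<n. \<Sum>i<n. \<Sum>j<n. (U k i * U k j) * (x i * x j))"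
    by (simp add: power2_eq_square sum_product mult_ac)
  also have "\<dots> = (\<Sum>i<n. \<Sum>k<n. \<Sum>j<n. (U k i * U k j) * (x i * x j))"
    by (rule sum.swap)
  also have "\<dots> = (\<Sum>i<n. \<Sum>j<n. \<Sum>k<n. (U k i * U k j) * (x i * x j))"
    by (intro sum.cong refl sum.swap)
  also have "\<dots> = (\<Sum>i<n. \<Sum>j<n. of_bool (i = j) * (x i * x j))"
    using assms by (intro sum.cong refl) (auto simp: orthogonal_columns_def sum_distrib_right[symmetric])
  also have "\<dots> = (\<Sum>i<n. (x i)\<^sup>2)"
    by (intro sum.cong refl) (simp add: of_bool_def if_distrib[of "\<lambda>x. x * _"] power2_eq_square cong: if_cong)
  finally show ?thesis .
qed

text \<open>Invariance of the Frobenius norm. Adding the vanishing off-diagonal terms yields all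
  squared entries of the transformed matrix, and Parseval then removes one factor \<open>U\<close>
  at a time.\<close>

lemma sum_squares_diagonalized:
  assumes sym: "\<And>i j. i < n \<Longrightarrow> j < n \<Longrightarrow> R i j = R j i"
    and U: "orthogonal_columns n U"
    and diag: "\<And>k l. k < n \<Longrightarrow> l < n \<Longrightarrow> k \<noteq> l \<Longrightarrow> bil n R (U k) (U l) = 0"
  shows "(\<Sum>k<n. (bil n R (U k) (U k))\<^sup>2) = (\<Sum>i<n. \<Sum>j<n. (R i j)\<^sup>2)"
proof -
  have "(\<Sum>k<n. (bil n R (U k) (U k))\<^sup>2) = (\<Sum>k<n. \<Sum>l<n. (bil n R (U l) (U k))\<^sup>2)"
  proof (intro sum.cong refl)
    fix k assume k: "k \<in> {..<n}"
    have "(\<Sum>l<n. (bil n R (U l) (U k))\<^sup>2) = (\<Sum>l<n. if k = l then (bil n R (U l) (U k))\<^sup>2 else 0)"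
      using diag k by (intro sum.cong) auto
    then show "(bil n R (U k) (U k))\<^sup>2 = (\<Sum>l<n. (bil n R (U l) (U k))\<^sup>2)" using k by simp
  qed
  also have "\<dots> = (\<Sum>k<n. \<Sum>l<n. (\<Sum>i<n. U l i * (\<Sum>j<n. R i j * U k j))\<^sup>2)"
    by (simp add: bil_def sum_distrib_left mult_ac)
  also have "\<dots> = (\<Sum>k<n. \<Sum>i<n. (\<Sum>j<n. R i j * U k j)\<^sup>2)"
    by (simp only: parseval_orthogonal_columns[OF U])
  also have "\<dots> = (\<Sum>i<n. \<Sum>k<n. (\<Sum>j<n. U k j * R i j)\<^sup>2)"
    by (subst sum.swap) (simp add: mult.commute)
  also have "\<dots> = (\<Sum>i<n. \<Sum>j<n. (R i j)\<^sup>2)"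
    by (simp only: parseval_orthogonal_columns[OF U])
  finally show ?thesis .
qed

section \<open>A central limit theorem for Gaussian quadratic forms\<close>

text \<open>Covers the point mass \<open>v = 0\<close> and the density case by one formula, so that
  later computations never split on the variance.\<close>

lemma gauss_law_eq_distr:
  assumes "v \<ge> 0"
  shows "gauss_law \<mu> v = distr std_normal_distribution borel (\<lambda>x. \<mu> + sqrt v * x)"
proof -
  interpret N: real_distribution std_normal_distribution by (rule real_dist_normal_dist)
  show ?thesis
  proof (cases "v = 0")
    case True
    have "return lborel \<mu> = return borel \<mu>" by (simp add: return_def)
    moreover have "distr std_normal_distribution borel (\<lambda>x. \<mu>) = return borel \<mu>"
      by (rule N.distr_const) simp
    ultimately show ?thesis using True by (simp add: gauss_law_def)
  next
    case False
    have "distributed std_normal_distribution lborel (\<lambda>x. x) std_normal_density"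
      by (auto simp: distributed_def intro!: measure_eqI simp: emeasure_distr)
    from N.normal_density_affine[OF this, of "sqrt v" \<mu>]
    have "distributed std_normal_distribution lborel (\<lambda>x. \<mu> + sqrt v * x) (normal_density \<mu> (sqrt v))"
      using assms False by simp
    then have "distr std_normal_distribution lborel (\<lambda>x. \<mu> + sqrt v * x) = density lborel (normal_density \<mu> (sqrt v))"
      by (simp add: distributed_def)
    moreover have "distr std_normal_distribution lborel (\<lambda>x. \<mu> + sqrt v * x) =
        distr std_normal_distribution borel (\<lambda>x. \<mu> + sqrt v * x)"
      by (intro distr_cong) auto
    ultimately show ?thesis using False by (simp add: gauss_law_def)
  qed
qed

lemmas gauss_law_0_eq_distr = gauss_law_eq_distr[where \<mu> = 0, simplified]

lemma real_distribution_gauss_law_0: "v \<ge> 0 \<Longrightarrow> real_distribution (gauss_law 0 v)"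
proof -
  assume "v \<ge> 0"
  interpret N: real_distribution std_normal_distribution by (rule real_dist_normal_dist)
  show ?thesis unfolding gauss_law_0_eq_distr[OF \<open>v \<ge> 0\<close>] by (rule N.real_distribution_distr) simp
qed

lemma char_gauss_law_0:
  assumes "v \<ge> 0"
  shows "char (gauss_law 0 v) t = complex_of_real (exp (- (v * t\<^sup>2) / 2))"
proof -
  have "char (gauss_law 0 v) t = char std_normal_distribution (t * sqrt v)"
    unfolding gauss_law_0_eq_distr[OF assms] char_def by (simp add: integral_distr mult_ac)
  also have "\<dots> = complex_of_real (exp (- (v * t\<^sup>2) / 2))"
    using assms by (simp add: char_std_normal_distribution power_mult_distrib mult.commute)
  finally show ?thesis .
qed

text \<open>The real shift \<open>x = Re z + y\<close> completes the square in the real part only.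
  What remains is a constant times the characteristic function at \<open>Im z\<close>, so no contour
  has to be moved.\<close>

lemma std_normal_exp:
  fixes z :: complex
  shows "integrable std_normal_distribution (\<lambda>x. exp (z * complex_of_real x))"
    and "(LINT x|std_normal_distribution. exp (z * complex_of_real x)) = exp (z\<^sup>2 / 2)"
proof -
  interpret N: real_distribution std_normal_distribution by (rule real_dist_normal_dist)
  define f where "f x = std_normal_density x *\<^sub>R exp (z * complex_of_real x)" for x
  define K where "K = exp (complex_of_real ((Re z)\<^sup>2 / 2) + \<i> * complex_of_real (Re z * Im z))"
  have shift: "f (Re z + 1 * y) = K * (std_normal_density y *\<^sub>R iexp (Im z * y))" for y
  proof -
    have "complex_of_real (std_normal_density (Re z + y)) =
       complex_of_real (1 / sqrt (2 * pi)) * exp (complex_of_real (- (Re z + y)\<^sup>2 / 2))"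
      by (simp add: std_normal_density_def of_real_exp)
    then have "f (Re z + 1 * y) = complex_of_real (1 / sqrt (2 * pi)) *
        exp (complex_of_real (- (Re z + y)\<^sup>2 / 2) + z * complex_of_real (Re z + y))"
      unfolding exp_add by (simp add: f_def scaleR_conv_of_real)
    also have "complex_of_real (- (Re z + y)\<^sup>2 / 2) + z * complex_of_real (Re z + y) =
       complex_of_real ((Re z)\<^sup>2 / 2) + \<i> * complex_of_real (Re z * Im z) +
         (complex_of_real (- y\<^sup>2 / 2) + \<i> * complex_of_real (Im z * y))"
      by (auto simp: complex_eq_iff power2_eq_square field_simps)
    also have "complex_of_real (1 / sqrt (2 * pi)) * exp \<dots> =
       K * (std_normal_density y *\<^sub>R iexp (Im z * y))"
      by (simp only: exp_add K_def) (simp add: std_normal_density_def scaleR_conv_of_real of_real_exp)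
    finally show ?thesis .
  qed
  have int: "integrable lborel (\<lambda>y. std_normal_density y *\<^sub>R iexp (Im z * y))"
  proof -
    have "integrable std_normal_distribution (\<lambda>y. iexp (Im z * y))"
      by (intro N.integrable_const_bound[where B=1]) auto
    then show ?thesis by (subst (asm) integrable_density) auto
  qed
  have "integrable lborel (\<lambda>y. f (Re z + 1 * y))" unfolding shift by (rule integrable_mult_right) (rule int)
  then have fint: "integrable lborel f" by (subst (asm) lborel_integrable_real_affine_iff) auto
  then show "integrable std_normal_distribution (\<lambda>x. exp (z * complex_of_real x))"
    by (subst integrable_density) (auto simp: f_def[abs_def])
  have "(LINT x|std_normal_distribution. exp (z * complex_of_real x)) = integral\<^sup>L lborel f"
    by (subst integral_density) (auto simp: f_def[abs_def])
  also have "\<dots> = (LINT y|lborel. f (Re z + 1 * y))"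
    by (subst lborel_integral_real_affine[of 1 _ "Re z"]) auto
  also have "\<dots> = K * (LINT y|lborel. std_normal_density y *\<^sub>R iexp (Im z * y))"
    unfolding shift by (rule integral_mult_right_zero)
  also have "(LINT y|lborel. std_normal_density y *\<^sub>R iexp (Im z * y)) = char std_normal_distribution (Im z)"
    unfolding char_def by (subst integral_density) auto
  also have "\<dots> = exp (complex_of_real (- (Im z)\<^sup>2 / 2))"
    by (simp add: char_std_normal_distribution of_real_exp)
  also have "K * \<dots> = exp (z\<^sup>2 / 2)"
    unfolding K_def exp_add[symmetric]
    by (intro arg_cong[where f=exp]) (auto simp: complex_eq_iff power2_eq_square field_simps)
  finally show "(LINT x|std_normal_distribution. exp (z * complex_of_real x)) = exp (z\<^sup>2 / 2)" .
qed

lemma std_normal_exp_real: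
  shows "integrable std_normal_distribution (\<lambda>x. exp (r * x))"
    and "(LINT x|std_normal_distribution. exp (r * x)) = exp (r\<^sup>2 / 2)"
proof -
  have eq: "exp (complex_of_real r * complex_of_real x) = complex_of_real (exp (r * x))" for x
    by (simp add: of_real_exp)
  show I: "integrable std_normal_distribution (\<lambda>x. exp (r * x))"
    using std_normal_exp(1)[of "complex_of_real r"]
    unfolding eq complex_of_real_integrable_eq .
  have "complex_of_real (LINT x|std_normal_distribution. exp (r * x)) = complex_of_real (exp (r\<^sup>2/2))"
    using std_normal_exp(2)[of "complex_of_real r"] unfolding eq integral_complex_of_real
    by (simp add: of_real_exp)
  then show "(LINT x|std_normal_distribution. exp (r * x)) = exp (r\<^sup>2 / 2)"
    using of_real_eq_iff by blast
qed

text \<open>The integrand against Lebesgue measure is a multiple of the centred normal density of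
  variance \<open>1 / (1 - p)\<close>.\<close>

lemma integrable_std_normal_exp_square:
  assumes "p < 1"
  shows "integrable std_normal_distribution (\<lambda>x. exp (p * x\<^sup>2 / 2))"
proof -
  have "std_normal_density x * exp (p * x\<^sup>2 / 2) =
      (1 / sqrt (1 - p)) * normal_density 0 (1 / sqrt (1 - p)) x" for x
    using assms by (simp add: normal_density_def exp_add[symmetric] power_divide real_sqrt_divide field_simps)
  then have "integrable lborel (\<lambda>x. std_normal_density x * exp (p * x\<^sup>2 / 2))"
    using assms by simp
  then show ?thesis by (subst integrable_density) auto
qed

text \<open>The Hubbard--Stratonovich identity: \<open>exp (\<zeta>\<^sup>2 z\<^sup>2 / 2)\<close> is the expectation of \<open>exp (\<zeta> g z)\<close> for a
  standard normal \<open>g\<close>. With \<open>\<zeta>\<^sup>2 = 2 \<i> u\<close> it linearises the quadratic form, so that only the laws of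
  linear combinations of the \<open>Z k\<close> enter and no joint density is needed. The bound on \<open>u\<close> is what
  makes Fubini applicable.\<close>

lemma (in prob_space) char_sum_squares_gaussian:
  fixes Z :: "nat \<Rightarrow> 'a \<Rightarrow> real"
  assumes meas[measurable]: "\<And>k. Z k \<in> borel_measurable M"
    and law: "\<And>d. distr M borel (\<lambda>\<omega>. \<Sum>k<n. d k * Z k \<omega>) = gauss_law 0 (\<Sum>k<n. (d k)\<^sup>2 * \<kappa> k)"
    and \<kappa>: "\<And>k. k < n \<Longrightarrow> 0 \<le> \<kappa> k" and u: "\<And>k. k < n \<Longrightarrow> \<bar>u\<bar> * \<kappa> k < 1"
  shows "(LINT \<omega>|M. iexp (u * (\<Sum>k<n. (Z k \<omega>)\<^sup>2)))
    = (\<Prod>k<n. (LINT x|std_normal_distribution. iexp (u * \<kappa> k * x\<^sup>2)))"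
proof -
  interpret N: real_distribution std_normal_distribution by (rule real_dist_normal_dist)
  interpret PN: product_sigma_finite "\<lambda>_::nat. std_normal_distribution" by standard
  define G where "G = Pi\<^sub>M {..<n} (\<lambda>_::nat. std_normal_distribution)"
  interpret G: prob_space G unfolding G_def by (intro prob_space_PiM) (rule N.prob_space_axioms)
  interpret GM: pair_sigma_finite G M by standard
  \<comment> \<open>A square root of \<open>2 * \<i> * u\<close>. Its real part
    \<open>sqrt \<bar>u\<bar>\<close> governs the absolute integrability below.\<close>
  define \<zeta> where "\<zeta> = Complex (sqrt \<bar>u\<bar>) (sgn u * sqrt \<bar>u\<bar>)"
  have \<zeta>2: "\<zeta>\<^sup>2 / 2 = \<i> * complex_of_real u"
    by (auto simp: \<zeta>_def complex_eq_iff power2_eq_square abs_if sgn_if)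
  have Re\<zeta>: "Re \<zeta> = sqrt \<bar>u\<bar>" by (simp add: \<zeta>_def)
  define F where "F g \<omega> = exp (\<zeta> * complex_of_real (\<Sum>k<n. g k * Z k \<omega>))" for g \<omega>
  have [measurable]: "(\<lambda>p. fst p k) \<in> borel_measurable (G \<Otimes>\<^sub>M M)" if "k < n" for k
  proof -
    have "(\<lambda>g. g k) \<in> measurable G std_normal_distribution"
      unfolding G_def using that by (intro measurable_component_singleton) auto
    then have "(\<lambda>g. g k) \<in> borel_measurable G" by (simp cong: measurable_cong_sets)
    then show ?thesis by (rule measurable_compose[OF measurable_fst])
  qed
  have Fm: "case_prod F \<in> borel_measurable (G \<Otimes>\<^sub>M M)"
    unfolding F_def case_prod_beta by measurable
  have lawM: "(\<lambda>\<omega>. \<Sum>k<n. g k * Z k \<omega>) \<in> borel_measurable M" for g by measurable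
  define S where "S g = (\<Sum>k<n. (g k)\<^sup>2 * \<kappa> k)" for g :: "nat \<Rightarrow> real"
  have S0: "S g \<ge> 0" for g unfolding S_def using \<kappa> by (intro sum_nonneg) auto
  \<comment> \<open>For fixed \<open>g\<close> only the law of one linear combination of the
    \<open>Z k\<close> is involved, and it is that of \<open>sqrt (S g)\<close> times a standard
    normal variable.\<close>
  have tr_int: "integrable M (\<lambda>\<omega>. \<Phi> (\<Sum>k<n. g k * Z k \<omega>)) \<longleftrightarrow>
      integrable std_normal_distribution (\<lambda>x. \<Phi> (sqrt (S g) * x))"
    if [measurable]: "\<Phi> \<in> borel_measurable borel" for g and \<Phi> :: "real \<Rightarrow> 'c::{banach, second_countable_topology}"
  proof -
    have "integrable M (\<lambda>\<omega>. \<Phi> (\<Sum>k<n. g k * Z k \<omega>)) \<longleftrightarrow> integrable (gauss_law 0 (S g)) \<Phi>"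
      unfolding S_def law[symmetric] by (subst integrable_distr_eq) auto
    also have "\<dots> \<longleftrightarrow> integrable std_normal_distribution (\<lambda>x. \<Phi> (sqrt (S g) * x))"
      unfolding gauss_law_0_eq_distr[OF S0] by (subst integrable_distr_eq) auto
    finally show ?thesis .
  qed
  have tr: "(LINT \<omega>|M. \<Phi> (\<Sum>k<n. g k * Z k \<omega>)) = (LINT x|std_normal_distribution. \<Phi> (sqrt (S g) * x))"
    if [measurable]: "\<Phi> \<in> borel_measurable borel" for g and \<Phi> :: "real \<Rightarrow> 'c::{banach, second_countable_topology}"
  proof -
    have "(LINT \<omega>|M. \<Phi> (\<Sum>k<n. g k * Z k \<omega>)) = integral\<^sup>L (gauss_law 0 (S g)) \<Phi>"
      unfolding S_def law[symmetric] by (subst integral_distr) auto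
    also have "\<dots> = (LINT x|std_normal_distribution. \<Phi> (sqrt (S g) * x))"
      unfolding gauss_law_0_eq_distr[OF S0] by (subst integral_distr) auto
    finally show ?thesis .
  qed
  have inner_int: "integrable M (F g)" for g
    unfolding F_def using std_normal_exp(1)[of "\<zeta> * sqrt (S g)"]
    by (subst tr_int[of "\<lambda>y. exp (\<zeta> * complex_of_real y)"]) (auto simp: mult_ac)
  have inner: "(LINT \<omega>|M. F g \<omega>) = (\<Prod>k<n. iexp (u * \<kappa> k * (g k)\<^sup>2))" for g
  proof -
    have "(LINT \<omega>|M. F g \<omega>) = (LINT x|std_normal_distribution. exp (\<zeta> * sqrt (S g) * complex_of_real x))"
      unfolding F_def by (subst tr[of "\<lambda>y. exp (\<zeta> * complex_of_real y)"]) (auto simp: mult_ac)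
    also have "\<dots> = exp (\<zeta>\<^sup>2 / 2 * complex_of_real (S g))"
      using S0[of g] by (simp add: std_normal_exp(2) power_mult_distrib flip: of_real_power)
    also have "\<dots> = exp (\<Sum>k<n. \<i> * (u * \<kappa> k * (g k)\<^sup>2))"
      unfolding \<zeta>2 S_def by (simp add: sum_distrib_left mult_ac)
    also have "\<dots> = (\<Prod>k<n. iexp (u * \<kappa> k * (g k)\<^sup>2))" by (simp add: exp_sum)
    finally show ?thesis .
  qed
  \<comment> \<open>The Fubini condition factorises into integrals of the type of
    \<open>integrable_std_normal_exp_square\<close> with
    \<open>p = \<bar>u\<bar> * \<kappa> k\<close>, which is where the bound on \<open>u\<close> is
    spent.\<close>
  have inner_norm: "(LINT \<omega>|M. norm (F g \<omega>)) = (\<Prod>k<n. exp (\<bar>u\<bar> * \<kappa> k * (g k)\<^sup>2 / 2))" for g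
  proof -
    have "(LINT \<omega>|M. norm (F g \<omega>)) = (LINT \<omega>|M. exp (sqrt \<bar>u\<bar> * (\<Sum>k<n. g k * Z k \<omega>)))"
      unfolding F_def by (simp add: norm_exp_eq_Re Re\<zeta>)
    also have "\<dots> = (LINT x|std_normal_distribution. exp (sqrt \<bar>u\<bar> * sqrt (S g) * x))"
      by (subst tr[of "\<lambda>y. exp (sqrt \<bar>u\<bar> * y)"]) (auto simp: mult_ac)
    also have "\<dots> = exp (\<bar>u\<bar> * S g / 2)"
      using S0[of g] by (simp add: std_normal_exp_real(2) power_mult_distrib)
    also have "\<dots> = exp (\<Sum>k<n. \<bar>u\<bar> * \<kappa> k * (g k)\<^sup>2 / 2)"
      unfolding S_def by (simp add: sum_distrib_left sum_divide_distrib mult_ac)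
    also have "\<dots> = (\<Prod>k<n. exp (\<bar>u\<bar> * \<kappa> k * (g k)\<^sup>2 / 2))" by (simp add: exp_sum)
    finally show ?thesis .
  qed
  have "integrable G (\<lambda>g. LINT \<omega>|M. norm (F g \<omega>))"
    unfolding inner_norm G_def using u
    by (intro PN.product_integrable_prod integrable_std_normal_exp_square) auto
  then have int: "integrable (G \<Otimes>\<^sub>M M) (case_prod F)"
    by (intro GM.Fubini_integrable Fm) (auto simp: inner_int)
  \<comment> \<open>Integrating over the auxiliary normals first restores the quadratic form;
    integrating over \<open>M\<close> first gives a function of \<open>g\<close> that splits into a
    product over \<open>k\<close>.\<close>
  have "(LINT g|G. F g \<omega>) = iexp (u * (\<Sum>k<n. (Z k \<omega>)\<^sup>2))" for \<omega>
  proof -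
    have "(LINT g|G. F g \<omega>) = (LINT g|G. (\<Prod>k<n. exp ((\<zeta> * Z k \<omega>) * complex_of_real (g k))))"
      unfolding F_def by (simp add: exp_sum[symmetric] sum_distrib_left mult_ac)
    also have "\<dots> = (\<Prod>k<n. (LINT x|std_normal_distribution. exp ((\<zeta> * Z k \<omega>) * complex_of_real x)))"
      unfolding G_def by (intro PN.product_integral_prod std_normal_exp) auto
    also have "\<dots> = (\<Prod>k<n. exp (\<zeta>\<^sup>2 / 2 * (Z k \<omega>)\<^sup>2))"
      by (simp add: std_normal_exp(2) power_mult_distrib)
    also have "\<dots> = exp (\<Sum>k<n. \<i> * u * (Z k \<omega>)\<^sup>2)" unfolding \<zeta>2 by (simp add: exp_sum)
    also have "(\<Sum>k<n. \<i> * u * complex_of_real ((Z k \<omega>)\<^sup>2)) = \<i> * (u * (\<Sum>k<n. (Z k \<omega>)\<^sup>2))"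
      by (simp add: sum_distrib_left mult_ac)
    finally show ?thesis .
  qed
  then have "(LINT \<omega>|M. iexp (u * (\<Sum>k<n. (Z k \<omega>)\<^sup>2))) = (LINT \<omega>|M. LINT g|G. F g \<omega>)"
    by simp
  also have "\<dots> = (LINT g|G. LINT \<omega>|M. F g \<omega>)"
    by (rule GM.Fubini_integral[OF int])
  also have "\<dots> = (\<Prod>k<n. (LINT x|std_normal_distribution. iexp (u * \<kappa> k * x\<^sup>2)))"
    unfolding inner G_def
    by (intro PN.product_integral_prod N.integrable_const_bound[where B=1]) auto
  finally show ?thesis .
qed

section \<open>Centred chi-square variables and the passage to the normal limit\<close>

text \<open>The third absolute moment of a centred chi-square variable with one degree of freedom;
  it enters as the constant of a third-order remainder.\<close>

definition chi_cube :: real where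
  "chi_cube = (LINT x|std_normal_distribution. \<bar>x\<^sup>2 - 1\<bar>^3)"

text \<open>The variable \<open>g^2 - 1\<close> has mean 0 and variance 2, so its characteristic
  function is \<open>1 - x^2\<close> up to \<open>chi_cube / 6 * |x|^3\<close>. The summand 1 in the
  constant pays for replacing \<open>1 - x^2\<close> by \<open>exp (- x^2)\<close>: they differ by
  at most \<open>x^4\<close>, which is below \<open>|x|^3\<close> for \<open>|x|\<close> at most
  1.\<close>

lemma char_centred_chi_square_approx:
  assumes "\<bar>x\<bar> \<le> 1"
  shows "cmod ((LINT g|std_normal_distribution. iexp (x * (g\<^sup>2 - 1))) - complex_of_real (exp (- x\<^sup>2)))
    \<le> (chi_cube / 6 + 1) * \<bar>x\<bar>^3"
proof -
  interpret N: real_distribution std_normal_distribution by (rule real_dist_normal_dist)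
  have i2: "integrable std_normal_distribution (\<lambda>x. x\<^sup>2)" "integrable std_normal_distribution (\<lambda>x. x^4)"
    "integrable std_normal_distribution (\<lambda>x. x^6)"
    by (rule integrable_std_normal_distribution_moment)+
  have m2: "(LINT x|std_normal_distribution. x\<^sup>2) = 1" "(LINT x|std_normal_distribution. x^4) = 3"
    using std_normal_distribution_even_moments[of 1] std_normal_distribution_even_moments[of 2]
    by (auto simp: fact_numeral)
  define Q where "Q x = x\<^sup>2 - 1" for x :: real
  have Q2: "(Q x)\<^sup>2 = x^4 - 2 * x\<^sup>2 + 1" for x
    unfolding Q_def by (simp add: power2_eq_square power4_eq_xxxx algebra_simps)
  have "integrable std_normal_distribution (\<lambda>x. x^6 + 3 * x^4 + 3 * x\<^sup>2 + 1)"
    using i2 by (intro Bochner_Integration.integrable_add) auto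
  then have Q3: "integrable std_normal_distribution (\<lambda>x. \<bar>Q x\<bar>^3)"
  proof (rule integrable_dominated)
    fix x :: real
    have "\<bar>Q x\<bar>^3 \<le> (x\<^sup>2 + 1)^3"
      unfolding Q_def by (intro power_mono) (auto simp: abs_if)
    also have "\<dots> = x^6 + 3 * x^4 + 3 * x\<^sup>2 + 1" by (simp add: algebra_simps eval_nat_numeral)
    finally show "norm (\<bar>Q x\<bar>^3) \<le> x^6 + 3 * x^4 + 3 * x\<^sup>2 + 1" by simp
  qed (simp add: Q_def)
  have Qi: "integrable std_normal_distribution Q" "integrable std_normal_distribution (\<lambda>x. (Q x)\<^sup>2)"
    using i2 unfolding Q2 by (auto simp: Q_def[abs_def])
  have Qe: "N.expectation Q = 0" using i2 m2 N.prob_space by (simp add: Q_def[abs_def])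
  have "N.expectation (\<lambda>x. (Q x)\<^sup>2) = 2"
    unfolding Q2 using i2 m2 N.prob_space by simp
  then have Qv: "N.variance Q = 2" unfolding Qe by simp
  have "cmod (char (distr std_normal_distribution borel Q) x - (1 - x\<^sup>2 * 2 / 2)) \<le>
     (x\<^sup>2 / 6) * N.expectation (\<lambda>g. min (6 * (Q g)\<^sup>2) (\<bar>x\<bar> * \<bar>Q g\<bar>^3))"
    using Qi Qe Qv by (intro N.char_approx3') (auto simp: Q_def[abs_def])
  also have "\<dots> \<le> (x\<^sup>2 / 6) * N.expectation (\<lambda>g. \<bar>x\<bar> * \<bar>Q g\<bar>^3)"
    using Q3 Qi by (intro mult_left_mono integral_mono integrable_min) auto
  also have "\<dots> = chi_cube / 6 * \<bar>x\<bar>^3"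
    by (simp add: chi_cube_def Q_def power3_eq_cube power2_eq_square)
  also have "char (distr std_normal_distribution borel Q) x = (LINT g|std_normal_distribution. iexp (x * (g\<^sup>2 - 1)))"
    unfolding char_def by (subst integral_distr) (auto simp: Q_def[abs_def])
  finally have 1: "cmod ((LINT g|std_normal_distribution. iexp (x * (g\<^sup>2 - 1))) - (1 - x\<^sup>2)) \<le> chi_cube / 6 * \<bar>x\<bar>^3"
    by simp
  have x2: "x\<^sup>2 \<le> 1" using assms by (simp add: abs_square_le_1)
  have "exp (- x\<^sup>2) \<le> 1 - x\<^sup>2 + (x\<^sup>2)\<^sup>2"
  proof -
    have "exp (- x\<^sup>2) \<le> 1 / (1 + x\<^sup>2)" using exp_ge_add_one_self[of "x\<^sup>2"]
      by (simp add: exp_minus divide_simps add_pos_nonneg)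
    also have "\<dots> \<le> 1 - x\<^sup>2 + (x\<^sup>2)\<^sup>2"
    proof -
      have "(1 - x\<^sup>2 + (x\<^sup>2)\<^sup>2) * (1 + x\<^sup>2) = 1 + (x\<^sup>2)^3" by (simp add: algebra_simps eval_nat_numeral)
      also have "\<dots> \<ge> 1" by simp
      finally show ?thesis by (simp add: divide_simps add_pos_nonneg add_nonneg_eq_0_iff)
    qed
    finally show ?thesis .
  qed
  moreover have "exp (- x\<^sup>2) \<ge> 1 - x\<^sup>2" using exp_ge_add_one_self[of "- x\<^sup>2"] by simp
  moreover have "(x\<^sup>2)\<^sup>2 \<le> \<bar>x\<bar>^3"
    using assms mult_left_mono[of "\<bar>x\<bar>" 1 "\<bar>x\<bar>^3"] by (simp add: eval_nat_numeral abs_if split: if_splits)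
  ultimately have "\<bar>(1 - x\<^sup>2) - exp (- x\<^sup>2)\<bar> \<le> \<bar>x\<bar>^3" by linarith
  moreover have "complex_of_real (1 - x\<^sup>2) - complex_of_real (exp (- x\<^sup>2)) = complex_of_real ((1 - x\<^sup>2) - exp (- x\<^sup>2))" by simp
  ultimately have 2: "cmod (complex_of_real (1 - x\<^sup>2) - complex_of_real (exp (- x\<^sup>2))) \<le> \<bar>x\<bar>^3"
    by (metis norm_of_real)
  have "cmod ((LINT g|std_normal_distribution. iexp (x * (g\<^sup>2 - 1))) - complex_of_real (exp (- x\<^sup>2))) \<le>
    cmod ((LINT g|std_normal_distribution. iexp (x * (g\<^sup>2 - 1))) - (1 - x\<^sup>2)) +
    cmod (complex_of_real (1 - x\<^sup>2) - complex_of_real (exp (- x\<^sup>2)))"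
    by (rule order_trans[OF _ norm_triangle_ineq]) simp
  with 1 2 show ?thesis by (simp add: algebra_simps)
qed

lemma trace_diagonalized:
  assumes U: "orthogonal_columns n U"
  shows "(\<Sum>k<n. bil n R (U k) (U k)) = (\<Sum>i<n. R i i)"
proof -
  have "(\<Sum>k<n. bil n R (U k) (U k)) = (\<Sum>i<n. \<Sum>k<n. \<Sum>j<n. (U k i * U k j) * R i j)"
    unfolding bil_def by (subst sum.swap) (simp add: mult_ac)
  also have "\<dots> = (\<Sum>i<n. \<Sum>j<n. \<Sum>k<n. (U k i * U k j) * R i j)"
    by (intro sum.cong refl sum.swap)
  also have "\<dots> = (\<Sum>i<n. \<Sum>j<n. of_bool (i = j) * R i j)"
    using assms by (intro sum.cong refl) (auto simp: orthogonal_columns_def sum_distrib_right[symmetric])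
  also have "\<dots> = (\<Sum>i<n. R i i)"
    by (intro sum.cong refl) (simp add: of_bool_def if_distrib[of "\<lambda>x. x * _"] cong: if_cong)
  finally show ?thesis .
qed

lemma bil_sum:
  "bil n R (\<lambda>i. \<Sum>k\<in>A. d k * U k i) (\<lambda>i. \<Sum>k\<in>A. d k * U k i) =
    (\<Sum>k\<in>A. \<Sum>l\<in>A. d k * d l * bil n R (U k) (U l))"
proof -
  have "bil n R (\<lambda>i. \<Sum>k\<in>A. d k * U k i) (\<lambda>i. \<Sum>k\<in>A. d k * U k i) =
    (\<Sum>i<n. \<Sum>j<n. \<Sum>k\<in>A. \<Sum>l\<in>A. d k * d l * (U k i * R i j * U l j))"
    unfolding bil_def
  proof (intro sum.cong refl)
    fix i j
    have "(\<Sum>k\<in>A. d k * U k i) * R i j * (\<Sum>k\<in>A. d k * U k j) =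
      R i j * ((\<Sum>k\<in>A. d k * U k i) * (\<Sum>k\<in>A. d k * U k j))" by (simp add: mult_ac)
    also have "\<dots> = (\<Sum>k\<in>A. \<Sum>l\<in>A. d k * d l * (U k i * R i j * U l j))"
      by (subst sum_product) (simp add: sum_distrib_left mult_ac)
    finally show "(\<Sum>k\<in>A. d k * U k i) * R i j * (\<Sum>k\<in>A. d k * U k j) =
      (\<Sum>k\<in>A. \<Sum>l\<in>A. d k * d l * (U k i * R i j * U l j))" .
  qed
  also have "\<dots> = (\<Sum>i<n. \<Sum>k\<in>A. \<Sum>j<n. \<Sum>l\<in>A. d k * d l * (U k i * R i j * U l j))"
    by (intro sum.cong refl sum.swap)
  also have "\<dots> = (\<Sum>i<n. \<Sum>k\<in>A. \<Sum>l\<in>A. \<Sum>j<n. d k * d l * (U k i * R i j * U l j))"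
    by (intro sum.cong refl sum.swap)
  also have "\<dots> = (\<Sum>k\<in>A. \<Sum>i<n. \<Sum>l\<in>A. \<Sum>j<n. d k * d l * (U k i * R i j * U l j))"
    by (rule sum.swap)
  also have "\<dots> = (\<Sum>k\<in>A. \<Sum>l\<in>A. \<Sum>i<n. \<Sum>j<n. d k * d l * (U k i * R i j * U l j))"
    by (intro sum.cong refl sum.swap)
  finally show ?thesis unfolding bil_def by (simp add: sum_distrib_left)
qed

text \<open>In an eigenbasis the sum of squares is unchanged, the trace is the sum of the \<kappa>
  and the Frobenius norm is the sum of their squares. The errors \<open>|u * \<kappa>|^3\<close> add
  up to at most \<open>|u| * K\<close> times \<open>u^2\<close> times the Frobenius norm, so
  smallness of the largest eigenvalue against \<open>1 / |u|\<close> suffices.\<close>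

lemma (in prob_space) char_gaussian_quadratic_form_approx:
  fixes D :: "nat \<Rightarrow> 'a \<Rightarrow> real" and R :: "nat \<Rightarrow> nat \<Rightarrow> real"
  assumes meas[measurable]: "\<And>k. D k \<in> borel_measurable M"
    and law: "\<And>d. distr M borel (\<lambda>\<omega>. \<Sum>k<n. d k * D k \<omega>) = gauss_law 0 (bil n R d d)"
    and sym: "\<And>i j. i < n \<Longrightarrow> j < n \<Longrightarrow> R i j = R j i"
    and pos: "\<And>d. 0 \<le> bil n R d d"
    and bnd: "\<And>d. bil n R d d \<le> K * (\<Sum>k<n. (d k)\<^sup>2)"
    and K: "\<bar>u\<bar> * K < 1"
  shows "cmod ((LINT \<omega>|M. iexp (u * ((\<Sum>k<n. (D k \<omega>)\<^sup>2) - (\<Sum>k<n. R k k)))) -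
     complex_of_real (exp (- (u\<^sup>2 * (\<Sum>i<n. \<Sum>j<n. (R i j)\<^sup>2)))))
    \<le> (chi_cube / 6 + 1) * (\<bar>u\<bar> * K) * (u\<^sup>2 * (\<Sum>i<n. \<Sum>j<n. (R i j)\<^sup>2))"
proof -
  interpret N: real_distribution std_normal_distribution by (rule real_dist_normal_dist)
  obtain U where U: "orthogonal_rows n U" "orthogonal_columns n U"
    and diag: "\<And>k l. k < n \<Longrightarrow> l < n \<Longrightarrow> k \<noteq> l \<Longrightarrow> bil n R (U k) (U l) = 0"
    by (rule orthogonal_diagonalization[of n R, OF sym]) blast+
  define \<kappa> where "\<kappa> k = bil n R (U k) (U k)" for k
  define Z where "Z k \<omega> = (\<Sum>i<n. U k i * D i \<omega>)" for k \<omega>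
  have [measurable]: "Z k \<in> borel_measurable M" for k unfolding Z_def by measurable
  have \<kappa>0: "0 \<le> \<kappa> k" for k unfolding \<kappa>_def by (rule pos)
  \<comment> \<open>The rows of \<open>U\<close> are unit vectors, so \<open>K\<close> bounds their
    Rayleigh quotients.\<close>
  have \<kappa>K: "\<kappa> k \<le> K" if "k < n" for k
    using bnd[of "U k"] U(1) that by (simp add: orthogonal_rows_def \<kappa>_def power2_eq_square)
  have u\<kappa>: "\<bar>u\<bar> * \<kappa> k \<le> \<bar>u\<bar> * K" if "k < n" for k using \<kappa>K[OF that] by (intro mult_left_mono) auto
  have lawZ: "distr M borel (\<lambda>\<omega>. \<Sum>k<n. d k * Z k \<omega>) = gauss_law 0 (\<Sum>k<n. (d k)\<^sup>2 * \<kappa> k)" for d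
  proof -
    have "(\<Sum>k<n. d k * Z k \<omega>) = (\<Sum>i<n. (\<Sum>k<n. d k * U k i) * D i \<omega>)" for \<omega>
      unfolding Z_def sum_distrib_left sum_distrib_right by (subst sum.swap) (simp add: mult_ac)
    then have "distr M borel (\<lambda>\<omega>. \<Sum>k<n. d k * Z k \<omega>) =
       gauss_law 0 (bil n R (\<lambda>i. \<Sum>k<n. d k * U k i) (\<lambda>i. \<Sum>k<n. d k * U k i))"
      using law[of "\<lambda>i. \<Sum>k<n. d k * U k i"] by simp
    also have "bil n R (\<lambda>i. \<Sum>k<n. d k * U k i) (\<lambda>i. \<Sum>k<n. d k * U k i) = (\<Sum>k<n. (d k)\<^sup>2 * \<kappa> k)"
      unfolding bil_sum
    proof (intro sum.cong refl)
      fix k assume k: "k \<in> {..<n}"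
      have "(\<Sum>l<n. d k * d l * bil n R (U k) (U l)) = (\<Sum>l<n. if l = k then d k * d l * bil n R (U k) (U l) else 0)"
        using diag k by (intro sum.cong) auto
      then show "(\<Sum>l<n. d k * d l * bil n R (U k) (U l)) = (d k)\<^sup>2 * \<kappa> k"
        using k by (simp add: \<kappa>_def power2_eq_square)
    qed
    finally show ?thesis .
  qed
  have sq: "(\<Sum>k<n. (D k \<omega>)\<^sup>2) = (\<Sum>k<n. (Z k \<omega>)\<^sup>2)" for \<omega>
    unfolding Z_def parseval_orthogonal_columns[OF U(2)] ..
  have tr: "(\<Sum>k<n. R k k) = (\<Sum>k<n. \<kappa> k)"
    unfolding \<kappa>_def trace_diagonalized[OF U(2)] ..
  have fr: "(\<Sum>i<n. \<Sum>j<n. (R i j)\<^sup>2) = (\<Sum>k<n. (\<kappa> k)\<^sup>2)"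
    unfolding \<kappa>_def by (rule sum_squares_diagonalized[OF sym U(2) diag, symmetric])
  define \<phi> where "\<phi> x = (LINT g|std_normal_distribution. iexp (x * (g\<^sup>2 - 1)))" for x
  have \<phi>1: "cmod (\<phi> x) \<le> 1" for x
  proof -
    have "cmod (\<phi> x) \<le> (LINT g|std_normal_distribution. cmod (iexp (x * (g\<^sup>2 - 1))))"
      unfolding \<phi>_def by (rule integral_norm_bound)
    then show ?thesis using N.prob_space by simp
  qed
  have \<phi>: "(LINT x|std_normal_distribution. iexp (u * \<kappa> k * x\<^sup>2)) = iexp (u * \<kappa> k) * \<phi> (u * \<kappa> k)" for k
  proof -
    have "iexp (u * \<kappa> k * x\<^sup>2) = iexp (u * \<kappa> k) * iexp (u * \<kappa> k * (x\<^sup>2 - 1))" for x :: real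
      by (simp add: exp_add[symmetric] algebra_simps)
    then show ?thesis unfolding \<phi>_def by (simp only: integral_mult_right_zero)
  qed
  have "(LINT \<omega>|M. iexp (u * ((\<Sum>k<n. (D k \<omega>)\<^sup>2) - (\<Sum>k<n. R k k)))) =
     (LINT \<omega>|M. iexp (- (u * (\<Sum>k<n. \<kappa> k))) * iexp (u * (\<Sum>k<n. (Z k \<omega>)\<^sup>2)))"
    unfolding sq tr by (intro Bochner_Integration.integral_cong refl)
      (simp add: exp_add[symmetric] algebra_simps)
  also have "\<dots> = iexp (- (u * (\<Sum>k<n. \<kappa> k))) * (LINT \<omega>|M. iexp (u * (\<Sum>k<n. (Z k \<omega>)\<^sup>2)))"
    by (rule integral_mult_right_zero)
  also have "(LINT \<omega>|M. iexp (u * (\<Sum>k<n. (Z k \<omega>)\<^sup>2))) = (\<Prod>k<n. iexp (u * \<kappa> k) * \<phi> (u * \<kappa> k))"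
    using u\<kappa> K unfolding \<phi>[symmetric]
    by (intro char_sum_squares_gaussian lawZ \<kappa>0) (auto intro: le_less_trans)
  also have "\<dots> = iexp (u * (\<Sum>k<n. \<kappa> k)) * (\<Prod>k<n. \<phi> (u * \<kappa> k))"
    by (simp add: prod.distrib exp_sum[symmetric] sum_distrib_left)
  also have "iexp (- (u * (\<Sum>k<n. \<kappa> k))) * \<dots> = (\<Prod>k<n. \<phi> (u * \<kappa> k))"
    by (simp add: mult.assoc[symmetric] exp_add[symmetric])
  finally have E: "(LINT \<omega>|M. iexp (u * ((\<Sum>k<n. (D k \<omega>)\<^sup>2) - (\<Sum>k<n. R k k)))) = (\<Prod>k<n. \<phi> (u * \<kappa> k))" .
  have X: "complex_of_real (exp (- (u\<^sup>2 * (\<Sum>i<n. \<Sum>j<n. (R i j)\<^sup>2)))) =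
     (\<Prod>k<n. complex_of_real (exp (- (u * \<kappa> k)\<^sup>2)))"
    unfolding fr of_real_prod[symmetric] exp_sum[OF finite_lessThan, symmetric]
    by (simp add: sum_distrib_left sum_negf power_mult_distrib)
  \<comment> \<open>All factors lie in the closed unit disc, so the difference of the products is at
    most the sum of the differences.\<close>
  have "cmod ((\<Prod>k<n. \<phi> (u * \<kappa> k)) - (\<Prod>k<n. complex_of_real (exp (- (u * \<kappa> k)\<^sup>2)))) \<le>
      (\<Sum>k<n. cmod (\<phi> (u * \<kappa> k) - complex_of_real (exp (- (u * \<kappa> k)\<^sup>2))))"
    by (intro norm_prod_diff \<phi>1) auto
  also have "\<dots> \<le> (\<Sum>k<n. (chi_cube / 6 + 1) * (\<bar>u\<bar> * K) * (u\<^sup>2 * (\<kappa> k)\<^sup>2))"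
  proof (intro sum_mono)
    fix k assume "k \<in> {..<n}"
    then have k: "k < n" by simp
    have a: "\<bar>u * \<kappa> k\<bar> \<le> \<bar>u\<bar> * K" using u\<kappa>[OF k] \<kappa>0 by (simp add: abs_mult)
    have c0: "0 \<le> chi_cube" unfolding chi_cube_def by (intro Bochner_Integration.integral_nonneg) auto
    have "cmod (\<phi> (u * \<kappa> k) - complex_of_real (exp (- (u * \<kappa> k)\<^sup>2))) \<le> (chi_cube / 6 + 1) * \<bar>u * \<kappa> k\<bar>^3"
      unfolding \<phi>_def using a K by (intro char_centred_chi_square_approx) simp
    \<comment> \<open>Only one of the three factors is estimated by the maximum; the other two are
      kept so that the sum reproduces the Frobenius norm.\<close>
    also have "\<bar>u * \<kappa> k\<bar>^3 = \<bar>u * \<kappa> k\<bar> * (u\<^sup>2 * (\<kappa> k)\<^sup>2)"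
      by (simp add: power3_eq_cube power_mult_distrib[symmetric] power2_eq_square)
    also have "(chi_cube / 6 + 1) * \<dots> \<le> (chi_cube / 6 + 1) * ((\<bar>u\<bar> * K) * (u\<^sup>2 * (\<kappa> k)\<^sup>2))"
      using c0 by (intro mult_left_mono mult_right_mono a) auto
    finally show "cmod (\<phi> (u * \<kappa> k) - complex_of_real (exp (- (u * \<kappa> k)\<^sup>2))) \<le>
      (chi_cube / 6 + 1) * (\<bar>u\<bar> * K) * (u\<^sup>2 * (\<kappa> k)\<^sup>2)" by (simp add: mult.assoc)
  qed
  also have "\<dots> = (chi_cube / 6 + 1) * (\<bar>u\<bar> * K) * (u\<^sup>2 * (\<Sum>k<n. (\<kappa> k)\<^sup>2))"
    by (simp add: sum_distrib_left)
  finally show ?thesis unfolding E X fr[symmetric] .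
qed

text \<open>With \<open>u = t / sqrt m\<close> and \<open>K\<close> fixed, the error of the
  preceding approximation is of order \<open>1 / sqrt m\<close>, and Levy continuity applies. The
  Frobenius hypothesis has limit \<open>V / 2\<close> because each centred chi-square variable has
  variance 2.\<close>

theorem (in prob_space) gaussian_quadratic_form_clt:
  fixes D :: "nat \<Rightarrow> nat \<Rightarrow> 'a \<Rightarrow> real" and R :: "nat \<Rightarrow> nat \<Rightarrow> nat \<Rightarrow> real" and m :: "nat \<Rightarrow> nat"
  assumes meas[measurable]: "\<And>j k. D j k \<in> borel_measurable M"
    and law: "\<And>j d. distr M borel (\<lambda>\<omega>. \<Sum>k<m j. d k * D j k \<omega>) = gauss_law 0 (bil (m j) (R j) d d)"
    and sym: "\<And>j i k. R j i k = R j k i"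
    and pos: "\<And>j d. 0 \<le> bil (m j) (R j) d d"
    and bnd: "eventually (\<lambda>j. \<forall>d. bil (m j) (R j) d d \<le> K * (\<Sum>k<m j. (d k)\<^sup>2)) sequentially"
    and m: "filterlim m at_top sequentially"
    and frob: "(\<lambda>j. (1 / real (m j)) * (\<Sum>i<m j. \<Sum>k<m j. (R j i k)\<^sup>2)) \<longlonglongrightarrow> V / 2"
    and bias: "(\<lambda>j. sqrt (real (m j)) * ((1 / real (m j)) * (\<Sum>k<m j. R j k k) - \<mu>)) \<longlonglongrightarrow> 0"
  shows "weak_conv_m (\<lambda>j. distr M borel (\<lambda>\<omega>. sqrt (real (m j)) * ((1 / real (m j)) * (\<Sum>k<m j. (D j k \<omega>)\<^sup>2) - \<mu>)))
     (gauss_law 0 V)"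
proof -
  have V2: "0 \<le> V / 2"
    by (rule LIMSEQ_le_const[OF frob]) (auto intro!: exI[of _ 0] divide_nonneg_nonneg sum_nonneg)
  then have V: "0 \<le> V" by simp
  define Y where "Y j \<omega> = sqrt (real (m j)) * ((1 / real (m j)) * (\<Sum>k<m j. (D j k \<omega>)\<^sup>2) - \<mu>)" for j \<omega>
  have [measurable]: "Y j \<in> borel_measurable M" for j unfolding Y_def by measurable
  define F where "F j = (1 / real (m j)) * (\<Sum>i<m j. \<Sum>k<m j. (R j i k)\<^sup>2)" for j
  define \<beta> where "\<beta> j = sqrt (real (m j)) * ((1 / real (m j)) * (\<Sum>k<m j. R j k k) - \<mu>)" for j
  have mr: "filterlim (\<lambda>j. sqrt (real (m j))) at_top sequentially"
    by (intro filterlim_compose[OF sqrt_at_top] filterlim_compose[OF filterlim_real_sequentially m])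
  have "(\<lambda>j. char (distr M borel (Y j)) t) \<longlonglongrightarrow> char (gauss_law 0 V) t" for t
  proof -
    define u where "u j = t / sqrt (real (m j))" for j
    define C where "C j = (LINT \<omega>|M. iexp (u j * ((\<Sum>k<m j. (D j k \<omega>)\<^sup>2) - (\<Sum>k<m j. R j k k))))" for j
    have mpos: "eventually (\<lambda>j. m j > 0) sequentially"
      using m eventually_gt_at_top[of "0::nat"] unfolding filterlim_iff by blast
    have u0: "u \<longlonglongrightarrow> 0" unfolding u_def
      using mr by (intro tendsto_divide_0[OF tendsto_const] filterlim_at_top_imp_at_infinity)
    have uK0: "(\<lambda>j. \<bar>u j\<bar> * K) \<longlonglongrightarrow> 0"
      using tendsto_mult[OF tendsto_rabs[OF u0] tendsto_const[of K]] by simp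
    then have small: "eventually (\<lambda>j. \<bar>u j\<bar> * K < 1) sequentially"
      by (rule order_tendstoD) simp
    have C1: "eventually (\<lambda>j. cmod (C j - complex_of_real (exp (- (t\<^sup>2 * F j)))) \<le>
        (chi_cube / 6 + 1) * (\<bar>u j\<bar> * K) * (t\<^sup>2 * F j)) sequentially"
      using mpos small bnd
    proof eventually_elim
      case (elim j)
      have "(u j)\<^sup>2 * (\<Sum>i<m j. \<Sum>k<m j. (R j i k)\<^sup>2) = t\<^sup>2 * F j"
        using elim(1) by (simp add: u_def F_def power_divide)
      then show ?case
        using char_gaussian_quadratic_form_approx[OF meas law sym pos spec[OF elim(3)] elim(2)] unfolding C_def by simp
    qed
    have C2: "(\<lambda>j. (chi_cube / 6 + 1) * (\<bar>u j\<bar> * K) * (t\<^sup>2 * F j)) \<longlonglongrightarrow> (chi_cube / 6 + 1) * 0 * (t\<^sup>2 * (V / 2))"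
      unfolding F_def by (intro tendsto_intros uK0 frob)
    have "(\<lambda>j. C j - complex_of_real (exp (- (t\<^sup>2 * F j)))) \<longlonglongrightarrow> 0"
      by (rule Lim_null_comparison[OF C1]) (rule C2[simplified])
    moreover have "(\<lambda>j. complex_of_real (exp (- (t\<^sup>2 * F j)))) \<longlonglongrightarrow> complex_of_real (exp (- (t\<^sup>2 * (V / 2))))"
      unfolding F_def by (intro tendsto_intros frob)
    ultimately have C: "C \<longlonglongrightarrow> complex_of_real (exp (- (t\<^sup>2 * (V / 2))))"
      using Lim_transform by blast
    \<comment> \<open>The deviation of the trace from \<mu> is deterministic, so it enters the
      characteristic function only as a phase that tends to 1.\<close>
    have T1: "(\<lambda>j. iexp (t * \<beta> j) * C j) \<longlonglongrightarrow> iexp (t * 0) * complex_of_real (exp (- (t\<^sup>2 * (V / 2))))"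
      using bias unfolding \<beta>_def[symmetric] by (intro tendsto_intros C)
    have T2: "eventually (\<lambda>j. iexp (t * \<beta> j) * C j = char (distr M borel (Y j)) t) sequentially"
      using mpos
    proof eventually_elim
      case (elim j)
      have sm: "sqrt (real (m j)) * (1 / real (m j) * x - y) = x / sqrt (real (m j)) - sqrt (real (m j)) * y" for x y
      proof -
        have "sqrt (real (m j)) * (1 / real (m j) * x) = x / sqrt (real (m j))"
          using elim by (simp add: divide_simps)
        then show ?thesis by (simp add: right_diff_distrib)
      qed
      have eq: "t * Y j \<omega> = t * \<beta> j + u j * ((\<Sum>k<m j. (D j k \<omega>)\<^sup>2) - (\<Sum>k<m j. R j k k))" for \<omega>
        unfolding Y_def \<beta>_def u_def sm by (simp add: algebra_simps diff_divide_distrib)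
      have ie: "iexp (x + y) = iexp x * iexp y" for x y :: real by (simp add: exp_add distrib_left)
      have "char (distr M borel (Y j)) t = (LINT \<omega>|M. iexp (t * Y j \<omega>))"
        unfolding char_def by (subst integral_distr) auto
      also have "\<dots> = (LINT \<omega>|M. iexp (t * \<beta> j) * iexp (u j * ((\<Sum>k<m j. (D j k \<omega>)\<^sup>2) - (\<Sum>k<m j. R j k k))))"
        unfolding eq ie ..
      also have "\<dots> = iexp (t * \<beta> j) * C j" unfolding C_def by (rule integral_mult_right_zero)
      finally show ?case ..
    qed
    have "(\<lambda>j. char (distr M borel (Y j)) t) \<longlonglongrightarrow> iexp (t * 0) * complex_of_real (exp (- (t\<^sup>2 * (V / 2))))"
      by (rule Lim_transform_eventually[OF T1 T2])
    then show ?thesis by (simp add: char_gauss_law_0[OF V] mult.commute)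
  qed
  then show ?thesis
    unfolding Y_def[symmetric]
    by (intro levy_continuity real_distribution_gauss_law_0 V) (simp add: real_distribution_distr)
qed

section \<open>Integrals of a Gaussian process\<close>

lemma cis_measurable[measurable]: "cis \<in> borel_measurable borel"
  unfolding cis_conv_exp[abs_def] by measurable


lemma norm_iexp_diff_le: "cmod (iexp x - iexp y) \<le> \<bar>x - y\<bar>"
proof -
  have "iexp x - iexp y = iexp y * (iexp (x - y) - 1)"
    by (simp add: algebra_simps exp_add[symmetric])
  then have "cmod (iexp x - iexp y) = cmod (iexp (x - y) - 1)"
    by (simp add: norm_mult)
  also have "\<dots> \<le> \<bar>x - y\<bar>" using iexp_approx1[of "x - y" 0] by simp
  finally show ?thesis .
qed

lemma (in prob_space) expectation_abs_le_sqrt: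
  fixes Z :: "'a \<Rightarrow> real"
  assumes [measurable]: "Z \<in> borel_measurable M" and "integrable M (\<lambda>\<omega>. (Z \<omega>)\<^sup>2)"
  shows "integrable M Z" "(LINT \<omega>|M. \<bar>Z \<omega>\<bar>) \<le> sqrt (LINT \<omega>|M. (Z \<omega>)\<^sup>2)"
proof -
  show I: "integrable M Z" using assms by (rule square_integrable_imp_integrable)
  have "0 \<le> variance (\<lambda>\<omega>. \<bar>Z \<omega>\<bar>)" by (rule variance_positive)
  also have "\<dots> = (LINT \<omega>|M. (Z \<omega>)\<^sup>2) - (LINT \<omega>|M. \<bar>Z \<omega>\<bar>)\<^sup>2"
    using I assms by (subst variance_eq) auto
  finally show "(LINT \<omega>|M. \<bar>Z \<omega>\<bar>) \<le> sqrt (LINT \<omega>|M. (Z \<omega>)\<^sup>2)" by (intro real_le_rsqrt) simp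
qed

lemma (in prob_space) gaussian_rv_mean_0:
  assumes "gaussian_rv M Z" "(LINT \<omega>|M. Z \<omega>) = 0"
  shows "integrable M (\<lambda>\<omega>. (Z \<omega>)\<^sup>2)" "distr M borel Z = gauss_law 0 (LINT \<omega>|M. (Z \<omega>)\<^sup>2)"
proof -
  interpret N: real_distribution std_normal_distribution by (rule real_dist_normal_dist)
  from assms(1) obtain \<mu> v where [measurable]: "Z \<in> borel_measurable M" and v: "v \<ge> 0"
    and law: "distr M lborel Z = gauss_law \<mu> v" unfolding gaussian_rv_def by auto
  have "distr M borel Z = distr M lborel Z" by (intro distr_cong) auto
  then have law: "distr M borel Z = distr std_normal_distribution borel (\<lambda>x. \<mu> + sqrt v * x)"
    unfolding law gauss_law_eq_distr[OF v] .
  have i: "integrable std_normal_distribution (\<lambda>x. x)" "integrable std_normal_distribution (\<lambda>x. x\<^sup>2)"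
    using integrable_std_normal_distribution_moment[of 1] integrable_std_normal_distribution_moment[of 2] by auto
  have m: "(LINT x|std_normal_distribution. x) = 0" "(LINT x|std_normal_distribution. x\<^sup>2) = 1"
    using integral_std_normal_distribution_moment_odd[of 1] std_normal_distribution_even_moments[of 1] by auto
  have "(LINT \<omega>|M. Z \<omega>) = integral\<^sup>L (distr M borel Z) (\<lambda>x. x)" by (subst integral_distr) auto
  also have "\<dots> = (LINT x|std_normal_distribution. \<mu> + sqrt v * x)" unfolding law by (subst integral_distr) auto
  also have "\<dots> = \<mu>" using i m N.prob_space by simp
  finally have \<mu>: "\<mu> = 0" using assms(2) by simp
  have sq: "(sqrt v * x)\<^sup>2 = v * x\<^sup>2" for x using v by (simp add: power_mult_distrib)
  have "integrable (distr M borel Z) (\<lambda>x. x\<^sup>2)"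
    unfolding law by (subst integrable_distr_eq) (simp_all add: \<mu> sq i)
  then show "integrable M (\<lambda>\<omega>. (Z \<omega>)\<^sup>2)" by (subst (asm) integrable_distr_eq) auto
  have "(LINT \<omega>|M. (Z \<omega>)\<^sup>2) = integral\<^sup>L (distr M borel Z) (\<lambda>x. x\<^sup>2)" by (subst integral_distr) auto
  also have "\<dots> = (LINT x|std_normal_distribution. v * x\<^sup>2)"
    unfolding law by (subst integral_distr) (simp_all add: \<mu> sq)
  also have "\<dots> = v" using m by simp
  finally show "distr M borel Z = gauss_law 0 (LINT \<omega>|M. (Z \<omega>)\<^sup>2)"
    using law gauss_law_0_eq_distr[OF v] \<mu> by simp
qed

section \<open>Discretisation of the time axis\<close>

definition grid_floor :: "nat \<Rightarrow> real \<Rightarrow> real" where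
  "grid_floor n t = real_of_int \<lfloor>real (Suc n) * t\<rfloor> / real (Suc n)"

text \<open>Keeps the grid indices up to \<open>(n + 1)^2\<close> in absolute value, a window of
  half-width about \<open>n + 1\<close> at mesh \<open>1 / (n + 1)\<close>: finitely many points for
  each \<open>n\<close>, yet the windows exhaust the line.\<close>

definition grid_cutoff :: "nat \<Rightarrow> real \<Rightarrow> real" where
  "grid_cutoff n t = of_bool (\<bar>real_of_int \<lfloor>real (Suc n) * t\<rfloor>\<bar> \<le> real (Suc n * Suc n))"

lemma grid_floor_measurable[measurable]: "grid_floor n \<in> borel_measurable borel"
  unfolding grid_floor_def by measurable

lemma grid_cutoff_measurable[measurable]: "grid_cutoff n \<in> borel_measurable borel"
  unfolding grid_cutoff_def by measurable

lemma grid_cutoff_cases: "grid_cutoff n t = 0 \<or> grid_cutoff n t = 1"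
  unfolding grid_cutoff_def by auto

lemma grid_floor_tendsto: "(\<lambda>n. grid_floor n t) \<longlonglongrightarrow> t"
proof -
  have "\<bar>grid_floor n t - t\<bar> \<le> 1 / real (Suc n)" for n
  proof -
    have "\<bar>real_of_int \<lfloor>real (Suc n) * t\<rfloor> - real (Suc n) * t\<bar> \<le> 1" by linarith
    moreover have "grid_floor n t - t = (real_of_int \<lfloor>real (Suc n) * t\<rfloor> - real (Suc n) * t) / real (Suc n)"
      unfolding grid_floor_def by (simp add: field_simps)
    ultimately show ?thesis by (simp add: divide_right_mono abs_divide del: of_nat_Suc)
  qed
  then have "(\<lambda>n. grid_floor n t - t) \<longlonglongrightarrow> 0"
    by (intro Lim_null_comparison[OF _ lim_1_over_n[THEN LIMSEQ_Suc]]) auto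
  then show ?thesis by (simp add: LIM_zero_iff)
qed

lemma grid_cutoff_eventually: "eventually (\<lambda>n. grid_cutoff n t = 1) sequentially"
proof -
  obtain N :: nat where N: "\<bar>t\<bar> + 1 \<le> real N" using real_arch_simple by blast
  have "grid_cutoff n t = 1" if "n \<ge> N" for n
  proof -
    have "\<bar>real (Suc n) * t\<bar> + 1 \<le> real (Suc n) * (\<bar>t\<bar> + 1)" by (simp only: abs_mult distrib_left abs_of_nat) simp
    also have "\<dots> \<le> real (Suc n) * real (Suc n)" using N that by (intro mult_left_mono) auto
    finally have "\<bar>real_of_int \<lfloor>real (Suc n) * t\<rfloor>\<bar> \<le> real (Suc n * Suc n)"
      unfolding of_nat_mult by linarith
    then show ?thesis by (simp add: grid_cutoff_def)
  qed
  then show ?thesis by (auto simp: eventually_sequentially)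
qed

definition grid_index :: "nat \<Rightarrow> int set" where
  "grid_index n = {- int (Suc n * Suc n)..int (Suc n * Suc n)}"

text \<open>Cell averages instead of point values of \<open>g\<close>, because \<open>g\<close> is
  merely integrable.\<close>

definition grid_weight :: "(real \<Rightarrow> real) \<Rightarrow> nat \<Rightarrow> int \<Rightarrow> real" where
  "grid_weight g n k = (LINT t|lborel. of_bool (\<lfloor>real (Suc n) * t\<rfloor> = k) * g t)"

text \<open>The target type is left general because the same weights serve twice: with
  \<open>F\<close> a sample path of the process and with \<open>F\<close> the complex exponential
  that determines the variance.\<close>

lemma grid_sum_eq_integral:
  fixes F :: "real \<Rightarrow> 'b::{banach, second_countable_topology}"
  assumes g: "integrable lborel g"
  shows "(\<Sum>k\<in>grid_index n. grid_weight g n k *\<^sub>R F (real_of_int k / real (Suc n))) =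
    (LINT t|lborel. (grid_cutoff n t * g t) *\<^sub>R F (grid_floor n t))"
proof -
  have [measurable]: "g \<in> borel_measurable borel" using g by auto
  have i: "integrable lborel (\<lambda>t. of_bool (\<lfloor>real (Suc n) * t\<rfloor> = k) * g t)" for k
    by (rule Bochner_Integration.integrable_bound[OF g]) auto
  have "(\<Sum>k\<in>grid_index n. grid_weight g n k *\<^sub>R F (real_of_int k / real (Suc n))) =
     (LINT t|lborel. (\<Sum>k\<in>grid_index n. (of_bool (\<lfloor>real (Suc n) * t\<rfloor> = k) * g t) *\<^sub>R F (real_of_int k / real (Suc n))))"
    unfolding grid_weight_def using i
    by (subst Bochner_Integration.integral_sum) auto
  also have "\<dots> = (LINT t|lborel. (grid_cutoff n t * g t) *\<^sub>R F (grid_floor n t))"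
  proof (intro Bochner_Integration.integral_cong refl)
    fix t
    have "(\<Sum>k\<in>grid_index n. (of_bool (\<lfloor>real (Suc n) * t\<rfloor> = k) * g t) *\<^sub>R F (real_of_int k / real (Suc n)))
      = (\<Sum>k\<in>grid_index n. if k = \<lfloor>real (Suc n) * t\<rfloor> then g t *\<^sub>R F (real_of_int k / real (Suc n)) else 0)"
      by (intro sum.cong) auto
    also have "\<dots> = (grid_cutoff n t * g t) *\<^sub>R F (grid_floor n t)"
    proof -
      have "\<lfloor>real (Suc n) * t\<rfloor> \<in> grid_index n \<longleftrightarrow> \<bar>real_of_int \<lfloor>real (Suc n) * t\<rfloor>\<bar> \<le> real (Suc n * Suc n)"
        unfolding grid_index_def atLeastAtMost_iff by linarith
      then show ?thesis
        by (subst sum.delta) (auto simp: grid_index_def grid_cutoff_def grid_floor_def simp del: of_nat_Suc of_nat_mult)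
    qed
    finally show "(\<Sum>k\<in>grid_index n. (of_bool (\<lfloor>real (Suc n) * t\<rfloor> = k) * g t) *\<^sub>R F (real_of_int k / real (Suc n)))
      = (grid_cutoff n t * g t) *\<^sub>R F (grid_floor n t)" .
  qed
  finally show ?thesis .
qed

section \<open>Laws of linear functionals of the process\<close>

locale gaussian_spectral_process = prob_space M for M :: "'a measure" +
  fixes X :: "real \<Rightarrow> 'a \<Rightarrow> real" and f :: "real \<Rightarrow> real"
  assumes X_meas: "(\<lambda>(t, \<omega>). X t \<omega>) \<in> borel_measurable (lborel \<Otimes>\<^sub>M M)"
    and X_gauss: "gaussian_process M X"
    and X_mean: "\<And>t. (\<integral>\<omega>. X t \<omega> \<partial>M) = 0"
    and X_ms_cont: "\<And>t. ((\<lambda>s. \<integral>\<omega>. (X s \<omega> - X t \<omega>)\<^sup>2 \<partial>M) \<longlongrightarrow> 0) (at t)"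
    and X_spec: "\<And>s t. complex_of_real (\<integral>\<omega>. X s \<omega> * X t \<omega> \<partial>M) =
                   (LINT l|lborel. cis (l * (t - s)) * complex_of_real (f l))"
    and f_int: "integrable lborel f" and f_nonneg: "\<And>l. f l \<ge> 0"
begin

lemma X_lincomb_gaussian: "finite T \<Longrightarrow> gaussian_rv M (\<lambda>\<omega>. \<Sum>t\<in>T. c t * X t \<omega>)"
  using X_gauss unfolding gaussian_process_def by blast

lemma X_gaussian: "gaussian_rv M (X t)"
  using X_lincomb_gaussian[of "{t}" "\<lambda>_. 1"] by simp

lemma X_borel[measurable]: "X t \<in> borel_measurable M"
  using X_gaussian unfolding gaussian_rv_def by blast

lemma X_square_integrable: "integrable M (\<lambda>\<omega>. (X t \<omega>)\<^sup>2)"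
  by (rule gaussian_rv_mean_0[OF X_gaussian X_mean])

lemma X_integrable: "integrable M (X t)"
  by (rule expectation_abs_le_sqrt(1)[OF X_borel X_square_integrable])

lemma X_prod_integrable: "integrable M (\<lambda>\<omega>. X s \<omega> * X t \<omega>)"
proof (rule integrable_dominated)
  show "integrable M (\<lambda>\<omega>. (X s \<omega>)\<^sup>2 + (X t \<omega>)\<^sup>2)" by (simp add: X_square_integrable)
  fix \<omega>
  have "2 * (\<bar>X s \<omega>\<bar> * \<bar>X t \<omega>\<bar>) \<le> (X s \<omega>)\<^sup>2 + (X t \<omega>)\<^sup>2"
    using sum_squares_bound[of "\<bar>X s \<omega>\<bar>" "\<bar>X t \<omega>\<bar>"] by simp
  moreover have "0 \<le> \<bar>X s \<omega>\<bar> * \<bar>X t \<omega>\<bar>" by simp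
  ultimately show "norm (X s \<omega> * X t \<omega>) \<le> (X s \<omega>)\<^sup>2 + (X t \<omega>)\<^sup>2"
    unfolding real_norm_def abs_mult by linarith
qed simp

lemma X_square_expectation: "(LINT \<omega>|M. (X t \<omega>)\<^sup>2) = integral\<^sup>L lborel f"
proof -
  have "complex_of_real (LINT \<omega>|M. (X t \<omega>)\<^sup>2) = complex_of_real (integral\<^sup>L lborel f)"
    using X_spec[of t t] by (simp add: power2_eq_square)
  then show ?thesis using of_real_eq_iff by blast
qed

lemma spectral_cis_integrable: "integrable lborel (\<lambda>l. cis (l * x) * complex_of_real (f l))"
proof (rule Bochner_Integration.integrable_bound[OF f_int])
  have [measurable]: "f \<in> borel_measurable borel" using f_int by auto
  show "(\<lambda>l. cis (l * x) * complex_of_real (f l)) \<in> borel_measurable lborel"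
    unfolding cis_conv_exp by measurable
qed (auto simp: norm_mult)

lemma X_lincomb_variance:
  assumes "finite T"
  shows "(LINT \<omega>|M. (\<Sum>t\<in>T. c t * X t \<omega>)\<^sup>2) =
    (LINT l|lborel. f l * (cmod (\<Sum>t\<in>T. c t *\<^sub>R cis (- (l * t))))\<^sup>2)"
proof -
  have eq: "complex_of_real (f l * (cmod (\<Sum>t\<in>T. c t *\<^sub>R cis (- (l * t))))\<^sup>2) =
    (\<Sum>s\<in>T. \<Sum>t\<in>T. complex_of_real (c s * c t) * (cis (l * (t - s)) * complex_of_real (f l)))" for l
  proof -
    have "complex_of_real ((cmod (\<Sum>t\<in>T. c t *\<^sub>R cis (- (l * t))))\<^sup>2) =
      (\<Sum>s\<in>T. c s *\<^sub>R cis (- (l * s))) * cnj (\<Sum>t\<in>T. c t *\<^sub>R cis (- (l * t)))"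
      by (rule complex_norm_square)
    also have "\<dots> = (\<Sum>s\<in>T. \<Sum>t\<in>T. complex_of_real (c s * c t) * cis (l * (t - s)))"
      unfolding cnj_sum sum_product
      by (intro sum.cong refl) (simp add: scaleR_conv_of_real cis_cnj cis_mult algebra_simps)
    finally show ?thesis by (simp add: sum_distrib_left mult_ac)
  qed
  have "complex_of_real (LINT \<omega>|M. (\<Sum>t\<in>T. c t * X t \<omega>)\<^sup>2) =
     complex_of_real (LINT \<omega>|M. (\<Sum>s\<in>T. \<Sum>t\<in>T. (c s * c t) * (X s \<omega> * X t \<omega>)))"
    by (simp add: power2_eq_square sum_product mult_ac)
  also have "\<dots> = (\<Sum>s\<in>T. \<Sum>t\<in>T. complex_of_real (c s * c t) * complex_of_real (LINT \<omega>|M. X s \<omega> * X t \<omega>))"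
    using X_prod_integrable by (simp add: Bochner_Integration.integral_sum)
  also have "\<dots> = (\<Sum>s\<in>T. \<Sum>t\<in>T. complex_of_real (c s * c t) * (LINT l|lborel. cis (l * (t - s)) * complex_of_real (f l)))"
    unfolding X_spec ..
  also have "\<dots> = (LINT l|lborel. (\<Sum>s\<in>T. \<Sum>t\<in>T. complex_of_real (c s * c t) * (cis (l * (t - s)) * complex_of_real (f l))))"
    using spectral_cis_integrable
    by (subst Bochner_Integration.integral_sum, simp, subst Bochner_Integration.integral_sum) auto
  also have "\<dots> = complex_of_real (LINT l|lborel. f l * (cmod (\<Sum>t\<in>T. c t *\<^sub>R cis (- (l * t))))\<^sup>2)"
    unfolding eq[symmetric] by (rule integral_complex_of_real)
  finally show ?thesis using of_real_eq_iff by blast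
qed

lemma X_lincomb_law:
  assumes "finite T"
  shows "distr M borel (\<lambda>\<omega>. \<Sum>t\<in>T. c t * X t \<omega>) =
    gauss_law 0 (LINT l|lborel. f l * (cmod (\<Sum>t\<in>T. c t *\<^sub>R cis (- (l * t))))\<^sup>2)"
  unfolding X_lincomb_variance[OF assms, symmetric]
proof (rule gaussian_rv_mean_0(2)[OF X_lincomb_gaussian[OF assms]])
  show "(LINT \<omega>|M. (\<Sum>t\<in>T. c t * X t \<omega>)) = 0"
    by (subst Bochner_Integration.integral_sum) (simp_all add: X_integrable X_mean)
qed

end

context gaussian_spectral_process
begin

lemma X_abs_expectation_le: "(LINT \<omega>|M. \<bar>X t \<omega>\<bar>) \<le> sqrt (integral\<^sup>L lborel f)"
  using expectation_abs_le_sqrt(2)[OF X_borel X_square_integrable] unfolding X_square_expectation .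

lemma X_shift_measurable:
  assumes [measurable]: "\<tau> \<in> borel_measurable borel"
  shows "(\<lambda>p. X (\<tau> (fst p)) (snd p)) \<in> borel_measurable (lborel \<Otimes>\<^sub>M M)"
proof -
  have "(\<lambda>p. (\<tau> (fst p), snd p)) \<in> measurable (lborel \<Otimes>\<^sub>M M) (lborel \<Otimes>\<^sub>M M)" by measurable
  from measurable_compose[OF this X_meas] show ?thesis by (simp add: case_prod_beta)
qed

text \<open>The second moment of \<open>X t\<close> is the integral of \<open>f\<close> for every
  \<open>t\<close>, so the first absolute moment is bounded uniformly in \<open>t\<close> and
  integrability of \<open>g\<close> alone suffices.\<close>

lemma weighted_X_integrable:
  assumes g: "integrable lborel g" and [measurable]: "\<tau> \<in> borel_measurable borel"
  shows "integrable (lborel \<Otimes>\<^sub>M M) (\<lambda>p. g (fst p) * X (\<tau> (fst p)) (snd p))"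
proof -
  interpret P: pair_sigma_finite lborel M by standard
  note X_shift_measurable[OF assms(2), measurable]
  have gm[measurable]: "g \<in> borel_measurable borel" using g by auto
  show ?thesis
  proof (rule P.Fubini_integrable)
    show "(\<lambda>p. g (fst p) * X (\<tau> (fst p)) (snd p)) \<in> borel_measurable (lborel \<Otimes>\<^sub>M M)" by measurable
    show "AE t in lborel. integrable M (\<lambda>\<omega>. g (fst (t, \<omega>)) * X (\<tau> (fst (t, \<omega>))) (snd (t, \<omega>)))"
      by (simp add: X_integrable)
    have "integrable lborel (\<lambda>t. LINT \<omega>|M. norm (g t * X (\<tau> t) \<omega>))"
    proof (rule integrable_dominated)
      show "integrable lborel (\<lambda>t. \<bar>g t\<bar> * sqrt (integral\<^sup>L lborel f))" using g by simp
      show "(\<lambda>t. LINT \<omega>|M. norm (g t * X (\<tau> t) \<omega>)) \<in> borel_measurable lborel"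
        by (intro borel_measurable_lebesgue_integral) (simp add: case_prod_beta)
      show "norm (LINT \<omega>|M. norm (g t * X (\<tau> t) \<omega>)) \<le> \<bar>g t\<bar> * sqrt (integral\<^sup>L lborel f)" for t
        by (simp add: abs_mult mult_left_mono X_abs_expectation_le)
    qed
    then show "integrable lborel (\<lambda>t. LINT \<omega>|M. norm (g (fst (t, \<omega>)) * X (\<tau> (fst (t, \<omega>))) (snd (t, \<omega>))))"
      by simp
  qed
qed

lemma integral_X_measurable:
  assumes [measurable]: "g \<in> borel_measurable borel"
  shows "(\<lambda>\<omega>. LINT t|lborel. g t * X t \<omega>) \<in> borel_measurable M"
proof -
  have "(\<lambda>p. X (snd p) (fst p)) \<in> borel_measurable (M \<Otimes>\<^sub>M lborel)"
    using measurable_compose[OF measurable_pair_swap' X_meas] by (simp add: case_prod_beta)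
  then show ?thesis
    by (intro lborel.borel_measurable_lebesgue_integral) (simp add: case_prod_beta)
qed

lemma AE_integrable_weighted_X:
  assumes g: "integrable lborel g" and [measurable]: "\<tau> \<in> borel_measurable borel"
  shows "AE \<omega> in M. integrable lborel (\<lambda>t. g t * X (\<tau> t) \<omega>)"
proof -
  interpret P: pair_sigma_finite lborel M by standard
  interpret Q: pair_sigma_finite M lborel by standard
  have "integrable (M \<Otimes>\<^sub>M lborel) (\<lambda>(\<omega>, t). g (fst (t, \<omega>)) * X (\<tau> (fst (t, \<omega>))) (snd (t, \<omega>)))"
    by (rule P.integrable_product_swap[OF weighted_X_integrable[OF assms]])
  from Q.AE_integrable_fst'[OF this] show ?thesis by simp
qed

lemma integral_X_approx:
  assumes g: "integrable lborel g" and [measurable]: "\<tau> \<in> borel_measurable borel"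
    and g': "integrable lborel g'"
  shows "integrable M (\<lambda>\<omega>. (LINT t|lborel. g t * X t \<omega>) - (LINT t|lborel. g' t * X (\<tau> t) \<omega>))"
    and "(LINT \<omega>|M. \<bar>(LINT t|lborel. g t * X t \<omega>) - (LINT t|lborel. g' t * X (\<tau> t) \<omega>)\<bar>)
      \<le> (LINT t|lborel. LINT \<omega>|M. \<bar>g t * X t \<omega> - g' t * X (\<tau> t) \<omega>\<bar>)"
proof -
  interpret P: pair_sigma_finite lborel M by standard
  interpret Q: pair_sigma_finite M lborel by standard
  define F1 where "F1 p = g (fst p) * X (fst p) (snd p)" for p
  define F2 where "F2 p = g' (fst p) * X (\<tau> (fst p)) (snd p)" for p
  have i1: "integrable (lborel \<Otimes>\<^sub>M M) F1" unfolding F1_def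
    using weighted_X_integrable[OF g, of "\<lambda>x. x"] by simp
  have i2: "integrable (lborel \<Otimes>\<^sub>M M) F2" unfolding F2_def
    using weighted_X_integrable[OF g' assms(2)] .
  have sw1: "integrable (M \<Otimes>\<^sub>M lborel) (\<lambda>(\<omega>, t). F1 (t, \<omega>))" by (rule P.integrable_product_swap[OF i1])
  have sw2: "integrable (M \<Otimes>\<^sub>M lborel) (\<lambda>(\<omega>, t). F2 (t, \<omega>))" by (rule P.integrable_product_swap[OF i2])
  have A1: "AE \<omega> in M. integrable lborel (\<lambda>t. g t * X t \<omega>)"
    using AE_integrable_weighted_X[OF g, of "\<lambda>x. x"] by simp
  have A2: "AE \<omega> in M. integrable lborel (\<lambda>t. g' t * X (\<tau> t) \<omega>)"
    by (rule AE_integrable_weighted_X[OF g' assms(2)])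
  have I1: "integrable M (\<lambda>\<omega>. LINT t|lborel. g t * X t \<omega>)"
    using Q.integrable_fst'[OF sw1] by (simp add: F1_def)
  have I2: "integrable M (\<lambda>\<omega>. LINT t|lborel. g' t * X (\<tau> t) \<omega>)"
    using Q.integrable_fst'[OF sw2] by (simp add: F2_def)
  show I: "integrable M (\<lambda>\<omega>. (LINT t|lborel. g t * X t \<omega>) - (LINT t|lborel. g' t * X (\<tau> t) \<omega>))"
    using I1 I2 by simp
  have iD: "integrable (lborel \<Otimes>\<^sub>M M) (\<lambda>p. \<bar>F1 p - F2 p\<bar>)" using i1 i2 by simp
  then have iD': "integrable (lborel \<Otimes>\<^sub>M M) (case_prod (\<lambda>t \<omega>. \<bar>F1 (t, \<omega>) - F2 (t, \<omega>)\<bar>))"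
    by (simp add: case_prod_unfold)
  have swD: "integrable (M \<Otimes>\<^sub>M lborel) (\<lambda>(\<omega>, t). \<bar>F1 (t, \<omega>) - F2 (t, \<omega>)\<bar>)"
    by (rule P.integrable_product_swap[OF iD])
  have ID: "integrable M (\<lambda>\<omega>. LINT t|lborel. \<bar>F1 (t, \<omega>) - F2 (t, \<omega>)\<bar>)"
    using Q.integrable_fst'[OF swD] by simp
  have "(LINT \<omega>|M. \<bar>(LINT t|lborel. g t * X t \<omega>) - (LINT t|lborel. g' t * X (\<tau> t) \<omega>)\<bar>) \<le>
    (LINT \<omega>|M. LINT t|lborel. \<bar>F1 (t, \<omega>) - F2 (t, \<omega>)\<bar>)"
  proof (rule integral_mono_AE)
    show "integrable M (\<lambda>\<omega>. \<bar>(LINT t|lborel. g t * X t \<omega>) - (LINT t|lborel. g' t * X (\<tau> t) \<omega>)\<bar>)"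
      using I by (rule integrable_abs)
    show "AE \<omega> in M. \<bar>(LINT t|lborel. g t * X t \<omega>) - (LINT t|lborel. g' t * X (\<tau> t) \<omega>)\<bar>
        \<le> (LINT t|lborel. \<bar>F1 (t, \<omega>) - F2 (t, \<omega>)\<bar>)"
      \<comment> \<open>Two path integrals may be merged into the integral of the difference only
        where both exist, hence almost surely and not everywhere.\<close>
      using A1 A2
    proof eventually_elim
      case (elim \<omega>)
      have "(LINT t|lborel. g t * X t \<omega>) - (LINT t|lborel. g' t * X (\<tau> t) \<omega>) =
        (LINT t|lborel. F1 (t, \<omega>) - F2 (t, \<omega>))"
        using elim by (simp add: F1_def F2_def)
      also have "\<bar>\<dots>\<bar> \<le> (LINT t|lborel. \<bar>F1 (t, \<omega>) - F2 (t, \<omega>)\<bar>)"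
        by (rule integral_abs_bound)
      finally show ?case .
    qed
  qed (rule ID)
  also have "\<dots> = (LINT t|lborel. LINT \<omega>|M. \<bar>F1 (t, \<omega>) - F2 (t, \<omega>)\<bar>)"
    by (rule P.Fubini_integral[OF iD'])
  finally show "(LINT \<omega>|M. \<bar>(LINT t|lborel. g t * X t \<omega>) - (LINT t|lborel. g' t * X (\<tau> t) \<omega>)\<bar>)
      \<le> (LINT t|lborel. LINT \<omega>|M. \<bar>g t * X t \<omega> - g' t * X (\<tau> t) \<omega>\<bar>)"
    by (simp add: F1_def F2_def)
qed

lemma X_ms_cont_sequentially:
  assumes "s \<longlonglongrightarrow> t"
  shows "(\<lambda>n. LINT \<omega>|M. \<bar>X t \<omega> - X (s n) \<omega>\<bar>) \<longlonglongrightarrow> 0"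
proof -
  define e where "e r = (LINT \<omega>|M. (X r \<omega> - X t \<omega>)\<^sup>2)" for r
  have "(e \<longlongrightarrow> e t) (at t)" using X_ms_cont[of t] by (simp add: e_def[abs_def])
  \<comment> \<open>The assumption concerns the punctured neighbourhood of \<open>t\<close>. Since
    the value at \<open>t\<close> itself is 0 it extends to \<open>nhds t\<close>, which is required
    because a grid point may coincide with \<open>t\<close>.\<close>
  then have "(e \<longlongrightarrow> e t) (nhds t)" unfolding tendsto_at_iff_tendsto_nhds .
  from filterlim_compose[OF this assms] have "(\<lambda>n. e (s n)) \<longlonglongrightarrow> 0" by (simp add: e_def)
  from tendsto_real_sqrt[OF this] have lim: "(\<lambda>n. sqrt (e (s n))) \<longlonglongrightarrow> 0" by simp
  have "(LINT \<omega>|M. \<bar>X t \<omega> - X (s n) \<omega>\<bar>) \<le> sqrt (e (s n))" for n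
  proof -
    have "integrable M (\<lambda>\<omega>. (X (s n) \<omega> - X t \<omega>)\<^sup>2)"
      unfolding power2_diff using X_square_integrable X_prod_integrable[of "s n" t] by (simp add: mult.assoc)
    then have "(LINT \<omega>|M. \<bar>X (s n) \<omega> - X t \<omega>\<bar>) \<le> sqrt (e (s n))"
      unfolding e_def by (intro expectation_abs_le_sqrt(2)) auto
    then show ?thesis by (simp add: abs_minus_commute)
  qed
  then show ?thesis
    by (intro Lim_null_comparison[OF _ lim]) (auto intro!: Bochner_Integration.integral_nonneg)
qed

text \<open>Dominated convergence in \<open>t\<close>: mean-square continuity gives the pointwise
  limit, and the uniform first-moment bound gives the dominating function
  \<open>2 * S * \<bar>g t\<bar>\<close>.\<close>

lemma grid_approx_error_tendsto:
  assumes g: "integrable lborel g"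
  shows "(\<lambda>n. LINT t|lborel. LINT \<omega>|M. \<bar>g t * X t \<omega> - (grid_cutoff n t * g t) * X (grid_floor n t) \<omega>\<bar>) \<longlonglongrightarrow> 0"
proof -
  define S where "S = sqrt (integral\<^sup>L lborel f)"
  have gm[measurable]: "g \<in> borel_measurable borel" using g by auto
  define e where "e n t = (LINT \<omega>|M. \<bar>g t * X t \<omega> - (grid_cutoff n t * g t) * X (grid_floor n t) \<omega>\<bar>)" for n t
  have "(\<lambda>n. LINT t|lborel. e n t) \<longlonglongrightarrow> integral\<^sup>L lborel (\<lambda>t::real. 0::real)"
  proof (rule integral_dominated_convergence[where w="\<lambda>t. 2 * S * \<bar>g t\<bar>"])
    show "integrable lborel (\<lambda>t. 2 * S * \<bar>g t\<bar>)" using g by simp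
    note X_shift_measurable[OF grid_floor_measurable, measurable]
    have X1[measurable]: "(\<lambda>p. X (fst p) (snd p)) \<in> borel_measurable (lborel \<Otimes>\<^sub>M M)"
      using X_shift_measurable[of "\<lambda>x. x"] by simp
    show "e n \<in> borel_measurable lborel" for n
      unfolding e_def
      by (intro borel_measurable_lebesgue_integral) (simp add: case_prod_beta)
    show "AE t in lborel. norm (e n t) \<le> 2 * S * \<bar>g t\<bar>" for n
    proof (rule AE_I2)
      fix t
      have "e n t \<le> (LINT \<omega>|M. \<bar>g t\<bar> * \<bar>X t \<omega>\<bar> + \<bar>g t\<bar> * \<bar>X (grid_floor n t) \<omega>\<bar>)"
        unfolding e_def
      proof (rule integral_mono)
        fix \<omega>
        show "\<bar>g t * X t \<omega> - (grid_cutoff n t * g t) * X (grid_floor n t) \<omega>\<bar> \<le>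
          \<bar>g t\<bar> * \<bar>X t \<omega>\<bar> + \<bar>g t\<bar> * \<bar>X (grid_floor n t) \<omega>\<bar>"
          using grid_cutoff_cases[of n t] abs_triangle_ineq4[of "g t * X t \<omega>" "g t * X (grid_floor n t) \<omega>"]
          by (auto simp: abs_mult)
      qed (auto simp: X_integrable)
      also have "\<dots> = \<bar>g t\<bar> * (LINT \<omega>|M. \<bar>X t \<omega>\<bar>) + \<bar>g t\<bar> * (LINT \<omega>|M. \<bar>X (grid_floor n t) \<omega>\<bar>)"
        by (subst Bochner_Integration.integral_add) (simp_all add: X_integrable)
      also have "\<dots> \<le> \<bar>g t\<bar> * S + \<bar>g t\<bar> * S"
        unfolding S_def by (intro add_mono mult_left_mono X_abs_expectation_le) auto
      finally show "norm (e n t) \<le> 2 * S * \<bar>g t\<bar>" by (simp add: e_def)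
    qed
    show "AE t in lborel. (\<lambda>n. e n t) \<longlonglongrightarrow> 0"
    proof (rule AE_I2)
      fix t
      have "(\<lambda>n. \<bar>g t\<bar> * (LINT \<omega>|M. \<bar>X t \<omega> - X (grid_floor n t) \<omega>\<bar>)) \<longlonglongrightarrow> \<bar>g t\<bar> * 0"
        by (intro tendsto_mult_left X_ms_cont_sequentially grid_floor_tendsto)
      then have L: "(\<lambda>n. \<bar>g t\<bar> * (LINT \<omega>|M. \<bar>X t \<omega> - X (grid_floor n t) \<omega>\<bar>)) \<longlonglongrightarrow> 0" by simp
      have "eventually (\<lambda>n. \<bar>g t\<bar> * (LINT \<omega>|M. \<bar>X t \<omega> - X (grid_floor n t) \<omega>\<bar>) = e n t) sequentially"
        using grid_cutoff_eventually[of t]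
      proof eventually_elim
        case (elim n)
        have "\<bar>g t * X t \<omega> - (grid_cutoff n t * g t) * X (grid_floor n t) \<omega>\<bar> =
          \<bar>g t\<bar> * \<bar>X t \<omega> - X (grid_floor n t) \<omega>\<bar>" for \<omega>
          using elim by (simp add: abs_mult[symmetric] right_diff_distrib)
        then show ?case unfolding e_def by simp
      qed
      from Lim_transform_eventually[OF L this] show "(\<lambda>n. e n t) \<longlonglongrightarrow> 0" .
    qed
  qed auto
  then show ?thesis by (simp add: e_def)
qed

lemma grid_sum_law:
  assumes g: "integrable lborel g"
  shows "distr M borel (\<lambda>\<omega>. LINT t|lborel. (grid_cutoff n t * g t) * X (grid_floor n t) \<omega>) =
    gauss_law 0 (LINT l|lborel. f l *
      (cmod (LINT t|lborel. (grid_cutoff n t * g t) *\<^sub>R cis (- (l * grid_floor n t))))\<^sup>2)"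
proof -
  define \<theta> where "\<theta> k = real_of_int k / real (Suc n)" for k
  \<comment> \<open>Linear combinations of the process are indexed by times, not by grid numbers, so
    the coefficient function recovers the grid number from the time.\<close>
  define c where "c s = grid_weight g n \<lfloor>s * real (Suc n)\<rfloor>" for s
  have c: "c (\<theta> k) = grid_weight g n k" for k
    unfolding c_def \<theta>_def by (simp del: of_nat_Suc)
  have inj: "inj_on \<theta> (grid_index n)" unfolding \<theta>_def by (intro inj_onI) (simp del: of_nat_Suc)
  have fin: "finite (\<theta> ` grid_index n)" by (simp add: grid_index_def)
  have sum: "(\<Sum>t\<in>\<theta> ` grid_index n. c t *\<^sub>R F t) =
      (LINT t|lborel. (grid_cutoff n t * g t) *\<^sub>R F (grid_floor n t))"
    for F :: "real \<Rightarrow> 'c::{banach, second_countable_topology}"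
    unfolding sum.reindex[OF inj] comp_def c by (unfold \<theta>_def) (rule grid_sum_eq_integral[OF g])
  show ?thesis
    using X_lincomb_law[OF fin, of c] sum[of "\<lambda>t. X t _"] sum[of "\<lambda>t. cis (- (_ * t))"] by simp
qed

text \<open>Two dominated convergences: in \<open>t\<close>, with bound
  \<open>\<bar>g t\<bar>\<close>, for the transform at fixed \<open>l\<close>; then in
  \<open>l\<close>, with bound \<open>G^2 * f l\<close>, since all transforms are at most the L1
  norm \<open>G\<close> of \<open>g\<close>.\<close>

lemma grid_variance_tendsto:
  assumes g: "integrable lborel g"
  shows "(\<lambda>n. LINT l|lborel. f l *
      (cmod (LINT t|lborel. (grid_cutoff n t * g t) *\<^sub>R cis (- (l * grid_floor n t))))\<^sup>2) \<longlonglongrightarrow>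
    (LINT l|lborel. f l * (cmod (fourier_tr g l))\<^sup>2)"
proof -
  have gm[measurable]: "g \<in> borel_measurable borel" using g by auto
  have fm[measurable]: "f \<in> borel_measurable borel" using f_int by auto
  define \<Gamma> where "\<Gamma> n l = (LINT t|lborel. (grid_cutoff n t * g t) *\<^sub>R cis (- (l * grid_floor n t)))" for n l
  have bd: "cmod ((grid_cutoff n t * g t) *\<^sub>R cis (- (l * grid_floor n t))) \<le> \<bar>g t\<bar>" for n t l
    using grid_cutoff_cases[of n t] by auto
  have \<Gamma>l: "(\<lambda>n. \<Gamma> n l) \<longlonglongrightarrow> fourier_tr g l" for l
    unfolding \<Gamma>_def fourier_tr_def
  proof (rule integral_dominated_convergence[where w="\<lambda>t. \<bar>g t\<bar>"])
    show "AE t in lborel. (\<lambda>n. (grid_cutoff n t * g t) *\<^sub>R cis (- (l * grid_floor n t))) \<longlonglongrightarrow>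
        cis (- (l * t)) * complex_of_real (g t)"
    proof (rule AE_I2)
      fix t
      have "(\<lambda>n. g t *\<^sub>R cis (- (l * grid_floor n t))) \<longlonglongrightarrow> g t *\<^sub>R cis (- (l * t))"
        unfolding cis_conv_exp by (intro tendsto_intros grid_floor_tendsto)
      moreover have "eventually (\<lambda>n. g t *\<^sub>R cis (- (l * grid_floor n t)) =
          (grid_cutoff n t * g t) *\<^sub>R cis (- (l * grid_floor n t))) sequentially"
        using grid_cutoff_eventually[of t] by eventually_elim simp
      ultimately have "(\<lambda>n. (grid_cutoff n t * g t) *\<^sub>R cis (- (l * grid_floor n t))) \<longlonglongrightarrow> g t *\<^sub>R cis (- (l * t))"
        by (rule Lim_transform_eventually)
      then show "(\<lambda>n. (grid_cutoff n t * g t) *\<^sub>R cis (- (l * grid_floor n t))) \<longlonglongrightarrow>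
        cis (- (l * t)) * complex_of_real (g t)" by (simp add: scaleR_conv_of_real mult.commute)
    qed
    show "AE t in lborel. cmod ((grid_cutoff n t * g t) *\<^sub>R cis (- (l * grid_floor n t))) \<le> \<bar>g t\<bar>" for n
      using bd by simp
  qed (use g in \<open>auto\<close>)
  have \<Gamma>m: "\<Gamma> n \<in> borel_measurable lborel" for n
    unfolding \<Gamma>_def by (intro lborel.borel_measurable_lebesgue_integral) (simp add: case_prod_beta)
  have "(\<lambda>l. fourier_tr g l) \<in> borel_measurable lborel"
    unfolding fourier_tr_def by (intro lborel.borel_measurable_lebesgue_integral) (simp add: case_prod_beta)
  then have Fm: "(\<lambda>l. f l * (cmod (fourier_tr g l))\<^sup>2) \<in> borel_measurable lborel" by simp
  define G where "G = (LINT t|lborel. \<bar>g t\<bar>)"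
  have \<Gamma>b: "cmod (\<Gamma> n l) \<le> G" for n l
  proof -
    have "cmod (\<Gamma> n l) \<le> (LINT t|lborel. cmod ((grid_cutoff n t * g t) *\<^sub>R cis (- (l * grid_floor n t))))"
      unfolding \<Gamma>_def by (rule integral_norm_bound)
    also have "\<dots> \<le> G" unfolding G_def using g bd
      by (intro integral_mono Bochner_Integration.integrable_bound[OF g]) auto
    finally show ?thesis .
  qed
  have "(\<lambda>n. LINT l|lborel. f l * (cmod (\<Gamma> n l))\<^sup>2) \<longlonglongrightarrow> (LINT l|lborel. f l * (cmod (fourier_tr g l))\<^sup>2)"
  proof (rule integral_dominated_convergence[where w="\<lambda>l. G\<^sup>2 * f l"])
    show "AE l in lborel. (\<lambda>n. f l * (cmod (\<Gamma> n l))\<^sup>2) \<longlonglongrightarrow> f l * (cmod (fourier_tr g l))\<^sup>2"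
      by (intro AE_I2 tendsto_intros \<Gamma>l)
    show "AE l in lborel. norm (f l * (cmod (\<Gamma> n l))\<^sup>2) \<le> G\<^sup>2 * f l" for n
    proof (rule AE_I2)
      fix l
      have "f l * (cmod (\<Gamma> n l))\<^sup>2 \<le> f l * G\<^sup>2"
        by (intro mult_left_mono power_mono \<Gamma>b f_nonneg) auto
      then show "norm (f l * (cmod (\<Gamma> n l))\<^sup>2) \<le> G\<^sup>2 * f l"
        using f_nonneg[of l] by (simp add: mult.commute)
    qed
    show "(\<lambda>l. f l * (cmod (\<Gamma> n l))\<^sup>2) \<in> borel_measurable lborel" for n
      using \<Gamma>m[of n] by simp
  qed (use f_int Fm in auto)
  then show ?thesis by (simp add: \<Gamma>_def)
qed

text \<open>The grid sums are centred Gaussian with known variance. They converge in L1 and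
  \<open>iexp\<close> is Lipschitz, so their characteristic functions converge to that of the
  integral, while convergence of the variances identifies the limit as Gaussian.\<close>

theorem integral_X_law:
  assumes g: "integrable lborel g"
  shows "distr M borel (\<lambda>\<omega>. LINT t|lborel. g t * X t \<omega>) =
    gauss_law 0 (LINT l|lborel. f l * (cmod (fourier_tr g l))\<^sup>2)"
proof -
  have gm[measurable]: "g \<in> borel_measurable borel" using g by auto
  define W where "W \<omega> = (LINT t|lborel. g t * X t \<omega>)" for \<omega>
  define Wn where "Wn n \<omega> = (LINT t|lborel. (grid_cutoff n t * g t) * X (grid_floor n t) \<omega>)" for n \<omega>
  have cg: "integrable lborel (\<lambda>t. grid_cutoff n t * g t)" for n
  proof (rule integrable_dominated)
    show "norm (grid_cutoff n t * g t) \<le> \<bar>g t\<bar>" for t using grid_cutoff_cases[of n t] by auto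
  qed (use g in auto)
  define v where "v = (LINT l|lborel. f l * (cmod (fourier_tr g l))\<^sup>2)"
  define vn where "vn n = (LINT l|lborel. f l *
      (cmod (LINT t|lborel. (grid_cutoff n t * g t) *\<^sub>R cis (- (l * grid_floor n t))))\<^sup>2)" for n
  have v0: "v \<ge> 0" unfolding v_def using f_nonneg by (intro Bochner_Integration.integral_nonneg) auto
  have vn0: "vn n \<ge> 0" for n unfolding vn_def using f_nonneg by (intro Bochner_Integration.integral_nonneg) auto
  have Wm[measurable]: "W \<in> borel_measurable M" unfolding W_def by (rule integral_X_measurable) simp
  have ap2: "integrable M (\<lambda>\<omega>. W \<omega> - Wn n \<omega>)" for n
    unfolding W_def Wn_def by (rule integral_X_approx(1)[OF g grid_floor_measurable cg])
  have ap3: "(LINT \<omega>|M. \<bar>W \<omega> - Wn n \<omega>\<bar>) \<le>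
      (LINT t|lborel. LINT \<omega>|M. \<bar>g t * X t \<omega> - (grid_cutoff n t * g t) * X (grid_floor n t) \<omega>\<bar>)" for n
    unfolding W_def Wn_def by (rule integral_X_approx(2)[OF g grid_floor_measurable cg])
  have Wnm[measurable]: "Wn n \<in> borel_measurable M" for n
  proof -
    have "(\<lambda>\<omega>. W \<omega> - (W \<omega> - Wn n \<omega>)) \<in> borel_measurable M"
      by (rule borel_measurable_diff[OF Wm borel_measurable_integrable[OF ap2]])
    then show ?thesis by simp
  qed
  have err: "(\<lambda>n. LINT \<omega>|M. \<bar>W \<omega> - Wn n \<omega>\<bar>) \<longlonglongrightarrow> 0"
    by (rule Lim_null_comparison[OF _ grid_approx_error_tendsto[OF g]]) (simp add: ap3)
  have "char (distr M borel W) t = char (gauss_law 0 v) t" for t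
  proof -
    have B: "cmod (char (distr M borel (Wn n)) t - char (distr M borel W) t) \<le> \<bar>t\<bar> * (LINT \<omega>|M. \<bar>W \<omega> - Wn n \<omega>\<bar>)" for n
    proof -
      have ii: "integrable M (\<lambda>\<omega>. iexp (t * W \<omega>))" "integrable M (\<lambda>\<omega>. iexp (t * Wn n \<omega>))"
        by (intro integrable_const_bound[where B=1]; simp)+
      have "char (distr M borel (Wn n)) t - char (distr M borel W) t = (LINT \<omega>|M. iexp (t * Wn n \<omega>) - iexp (t * W \<omega>))"
        unfolding char_def using ii by (simp add: integral_distr)
      also have "cmod \<dots> \<le> (LINT \<omega>|M. cmod (iexp (t * Wn n \<omega>) - iexp (t * W \<omega>)))"
        by (rule integral_norm_bound)
      also have "\<dots> \<le> (LINT \<omega>|M. \<bar>t\<bar> * \<bar>W \<omega> - Wn n \<omega>\<bar>)"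
      proof (rule integral_mono)
        show "integrable M (\<lambda>\<omega>. cmod (iexp (t * Wn n \<omega>) - iexp (t * W \<omega>)))"
          by (intro integrable_norm Bochner_Integration.integrable_diff ii)
        show "integrable M (\<lambda>\<omega>. \<bar>t\<bar> * \<bar>W \<omega> - Wn n \<omega>\<bar>)" using ap2 by simp
        fix \<omega>
        have "\<bar>t * Wn n \<omega> - t * W \<omega>\<bar> = \<bar>t\<bar> * \<bar>W \<omega> - Wn n \<omega>\<bar>"
          by (simp add: abs_mult[symmetric] right_diff_distrib[symmetric] abs_minus_commute)
             (simp add: abs_mult abs_minus_commute)
        then show "cmod (iexp (t * Wn n \<omega>) - iexp (t * W \<omega>)) \<le> \<bar>t\<bar> * \<bar>W \<omega> - Wn n \<omega>\<bar>"
          using norm_iexp_diff_le[of "t * Wn n \<omega>" "t * W \<omega>"] by simp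
      qed
      finally show ?thesis by simp
    qed
    have "(\<lambda>n. char (distr M borel (Wn n)) t - char (distr M borel W) t) \<longlonglongrightarrow> 0"
      by (rule Lim_null_comparison[OF _ tendsto_mult_right_zero[OF err, of "\<bar>t\<bar>"]])
         (rule always_eventually, rule allI, rule B)
    then have 1: "(\<lambda>n. char (distr M borel (Wn n)) t) \<longlonglongrightarrow> char (distr M borel W) t"
      by (simp add: LIM_zero_iff)
    have "char (distr M borel (Wn n)) t = complex_of_real (exp (- (vn n * t\<^sup>2) / 2))" for n
      unfolding Wn_def grid_sum_law[OF g] vn_def[symmetric] by (rule char_gauss_law_0[OF vn0])
    moreover have "(\<lambda>n. complex_of_real (exp (- (vn n * t\<^sup>2) / 2))) \<longlonglongrightarrow> complex_of_real (exp (- (v * t\<^sup>2) / 2))"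
      unfolding vn_def v_def by (intro tendsto_intros grid_variance_tendsto g) simp
    ultimately have 2: "(\<lambda>n. char (distr M borel (Wn n)) t) \<longlonglongrightarrow> char (gauss_law 0 v) t"
      by (simp add: char_gauss_law_0[OF v0])
    show ?thesis by (rule LIMSEQ_unique[OF 1 2])
  qed
  then have "distr M borel W = gauss_law 0 v"
    by (intro Levy_uniqueness real_distribution_distr real_distribution_gauss_law_0 v0 ext) simp_all
  then show ?thesis unfolding W_def[abs_def] v_def .
qed

end

section \<open>Fejer kernels and Toeplitz matrices\<close>

text \<open>The squared modulus of the trigonometric polynomial with coefficients \<open>d\<close>,
  in the real form that matches a symmetric Toeplitz form.\<close>

definition trig_square :: "nat \<Rightarrow> (nat \<Rightarrow> real) \<Rightarrow> real \<Rightarrow> real" where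
  "trig_square n d x = (\<Sum>k<n. \<Sum>l<n. d k * d l * cos ((real k - real l) * x))"

lemma trig_square_eq_norm:
  "trig_square n d x = (cmod (\<Sum>k<n. d k *\<^sub>R cis (real k * x)))\<^sup>2"
proof -
  have "complex_of_real ((cmod (\<Sum>k<n. d k *\<^sub>R cis (real k * x)))\<^sup>2) =
      (\<Sum>k<n. d k *\<^sub>R cis (real k * x)) * cnj (\<Sum>l<n. d l *\<^sub>R cis (real l * x))"
    by (rule complex_norm_square)
  also have "\<dots> = (\<Sum>k<n. \<Sum>l<n. (d k * d l) *\<^sub>R cis ((real k - real l) * x))"
    unfolding cnj_sum sum_product
    by (intro sum.cong refl) (simp add: scaleR_conv_of_real cis_cnj cis_mult algebra_simps)
  finally have "(cmod (\<Sum>k<n. d k *\<^sub>R cis (real k * x)))\<^sup>2 =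
      Re (\<Sum>k<n. \<Sum>l<n. (d k * d l) *\<^sub>R cis ((real k - real l) * x))"
    by (metis Re_complex_of_real)
  then show ?thesis by (simp add: trig_square_def)
qed

lemma trig_square_nonneg: "0 \<le> trig_square n d x"
  unfolding trig_square_eq_norm by simp

lemma trig_square_measurable[measurable]: "trig_square n d \<in> borel_measurable borel"
  unfolding trig_square_def by measurable

lemma trig_square_periodic: "trig_square n d (x + 2 * pi * real_of_int i) = trig_square n d x"
proof -
  have "cos ((real k - real l) * (x + 2 * pi * real_of_int i)) = cos ((real k - real l) * x)" for k l
  proof -
    have "(real k - real l) * (x + 2 * pi * real_of_int i) =
      (real k - real l) * x + 2 * pi * real_of_int ((int k - int l) * i)"
      by (simp add: algebra_simps)
    then show ?thesis
      using cos_int_2pin[of "(int k - int l) * i"] sin_int_2pin[of "(int k - int l) * i"]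
      by (simp only: cos_add)
  qed
  then show ?thesis unfolding trig_square_def by simp
qed

text \<open>Over \<open>N\<close> full periods instead of one, because the support of the densities
  may be longer than a period.\<close>

lemma integral_cos_period:
  fixes i :: int
  assumes "N > 0"
  shows "integrable lborel (\<lambda>x. cos (real_of_int i * x) * indicator {- (real N * pi)..real N * pi} x)"
    and "(LINT x|lborel. cos (real_of_int i * x) * indicator {- (real N * pi)..real N * pi} x) =
      (if i = 0 then 2 * real N * pi else 0)"
proof -
  have le: "- (real N * pi) \<le> real N * pi" by simp
  have *: "has_bochner_integral lborel (\<lambda>x. cos (real_of_int i * x) * indicator {- (real N * pi)..real N * pi} x)
      (if i = 0 then 2 * real N * pi else 0)"
  proof (cases "i = 0")
    case True
    have "has_bochner_integral lborel (\<lambda>x. 1 * indicator {- (real N * pi)..real N * pi} x)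
       (real N * pi - - (real N * pi))"
      by (rule has_bochner_integral_FTC_Icc_real[OF le, where F="\<lambda>x. x"]) (auto intro!: derivative_eq_intros)
    then show ?thesis using True by (simp add: mult_ac)
  next
    case False
    have s: "sin (real_of_int i * (real N * pi)) = 0"
      using sin_int_times_real[of "i * int N"] sin_zero_iff_int2 by (auto simp: mult.assoc intro!: exI[of _ "i * int N"])
    have "has_bochner_integral lborel (\<lambda>x. cos (real_of_int i * x) * indicator {- (real N * pi)..real N * pi} x)
       (sin (real_of_int i * (real N * pi)) / real_of_int i - sin (real_of_int i * (- (real N * pi))) / real_of_int i)"
      using False by (intro has_bochner_integral_FTC_Icc_real[OF le, where F="\<lambda>x. sin (real_of_int i * x) / real_of_int i"])
        (auto intro!: derivative_eq_intros continuous_intros)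
    then show ?thesis using False s by simp
  qed
  then show "integrable lborel (\<lambda>x. cos (real_of_int i * x) * indicator {- (real N * pi)..real N * pi} x)"
    "(LINT x|lborel. cos (real_of_int i * x) * indicator {- (real N * pi)..real N * pi} x) =
      (if i = 0 then 2 * real N * pi else 0)"
    by (auto simp: has_bochner_integral_iff)
qed

lemma integral_trig_square:
  assumes "N > 0"
  shows "integrable lborel (\<lambda>x. trig_square n d x * indicator {- (real N * pi)..real N * pi} x)"
    and "(LINT x|lborel. trig_square n d x * indicator {- (real N * pi)..real N * pi} x) =
      2 * real N * pi * (\<Sum>k<n. (d k)\<^sup>2)"
proof -
  let ?I = "\<lambda>x. indicator {- (real N * pi)..real N * pi} x :: real"
  have ci: "integrable lborel (\<lambda>x. cos ((real k - real l) * x) * ?I x)"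
    and cv: "(LINT x|lborel. cos ((real k - real l) * x) * ?I x) = (if k = l then 2 * real N * pi else 0)" for k l
    using integral_cos_period[OF assms, of "int k - int l"] by auto
  have eq: "trig_square n d x * ?I x = (\<Sum>k<n. \<Sum>l<n. (d k * d l) * (cos ((real k - real l) * x) * ?I x))" for x
    unfolding trig_square_def by (simp add: sum_distrib_right mult.assoc)
  show "integrable lborel (\<lambda>x. trig_square n d x * ?I x)"
    unfolding eq by (intro Bochner_Integration.integrable_sum integrable_mult_right ci)
  have "(LINT x|lborel. trig_square n d x * ?I x) =
     (\<Sum>k<n. \<Sum>l<n. (d k * d l) * (LINT x|lborel. cos ((real k - real l) * x) * ?I x))"
    unfolding eq using ci
    by (subst Bochner_Integration.integral_sum, simp, subst Bochner_Integration.integral_sum) auto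
  also have "\<dots> = (\<Sum>k<n. \<Sum>l<n. if k = l then d k * d l * (2 * real N * pi) else 0)"
    unfolding cv by (intro sum.cong refl) auto
  also have "\<dots> = 2 * real N * pi * (\<Sum>k<n. (d k)\<^sup>2)"
    by (simp add: sum_distrib_left power2_eq_square mult_ac)
  finally show "(LINT x|lborel. trig_square n d x * ?I x) = 2 * real N * pi * (\<Sum>k<n. (d k)\<^sup>2)" .
qed

text \<open>Normalised to have integral \<open>2 * pi\<close>, and not 1, over a period.\<close>

definition fejer :: "nat \<Rightarrow> real \<Rightarrow> real" where
  "fejer m u = (1 / real m) * trig_square m (\<lambda>_. 1) u"

lemma fejer_measurable[measurable]: "fejer m \<in> borel_measurable borel"
  unfolding fejer_def by measurable

lemma fejer_nonneg: "0 \<le> fejer m u"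
  unfolding fejer_def by (simp add: trig_square_nonneg)

lemma fejer_periodic: "fejer m (u + 2 * pi * real_of_int i) = fejer m u"
  unfolding fejer_def trig_square_periodic ..

lemma integral_fejer:
  assumes "N > 0" "m > 0"
  shows "integrable lborel (\<lambda>x. fejer m x * indicator {- (real N * pi)..real N * pi} x)"
    and "(LINT x|lborel. fejer m x * indicator {- (real N * pi)..real N * pi} x) = 2 * real N * pi"
  using integral_trig_square[OF assms(1), of m "\<lambda>_. 1"] assms(2)
  by (auto simp: fejer_def mult.assoc)

text \<open>The geometric sum times \<open>1 - cis u\<close> has modulus at most 2, and
  \<open>|1 - cis u|^2 = 2 * (1 - cos u)\<close>; the constant is the quotient of 4 and
  \<open>2 * (1 - cos \<delta>)\<close>.\<close>

lemma fejer_le: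
  assumes "0 < \<delta>" "\<delta> \<le> \<bar>u\<bar>" "\<bar>u\<bar> \<le> pi"
  shows "fejer m u \<le> (2 / (1 - cos \<delta>)) / real m"
proof -
  have cd: "cos \<bar>u\<bar> \<le> cos \<delta>" using assms by (intro cos_monotone_0_pi_le) auto
  have c1: "cos \<delta> < 1" using cos_monotone_0_pi[of 0 \<delta>] assms by auto
  define S where "S = (\<Sum>k<m. (1::real) *\<^sub>R cis (real k * u))"
  have "S * (1 - cis u) = 1 - cis u ^ m"
  proof -
    have "S = (\<Sum>k<m. cis u ^ k)" unfolding S_def by (simp add: Complex.DeMoivre)
    then show ?thesis by (simp add: one_diff_power_eq mult.commute)
  qed
  then have "(cmod S)\<^sup>2 * (cmod (1 - cis u))\<^sup>2 = (cmod (1 - cis u ^ m))\<^sup>2"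
    by (metis norm_mult power_mult_distrib)
  also have "\<dots> \<le> 2\<^sup>2"
  proof (intro power_mono)
    have "cmod (1 - cis u ^ m) \<le> cmod 1 + cmod (cis u ^ m)" by (rule norm_triangle_ineq4)
    then show "cmod (1 - cis u ^ m) \<le> 2" by (simp add: norm_power)
  qed simp
  finally have 1: "(cmod S)\<^sup>2 * (cmod (1 - cis u))\<^sup>2 \<le> 4" by simp
  have "(cmod (1 - cis u))\<^sup>2 = (1 - cos u)\<^sup>2 + (sin u)\<^sup>2" by (simp add: cmod_power2)
  also have "\<dots> = 2 * (1 - cos u)"
    using sin_cos_squared_add[of u] by (simp add: power2_eq_square algebra_simps)
  finally have 2: "(cmod (1 - cis u))\<^sup>2 = 2 * (1 - cos \<bar>u\<bar>)" by simp
  have "(cmod S)\<^sup>2 * (2 * (1 - cos \<delta>)) \<le> (cmod S)\<^sup>2 * (2 * (1 - cos \<bar>u\<bar>))"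
    using cd by (intro mult_left_mono) auto
  with 1 2 have "(cmod S)\<^sup>2 \<le> 4 / (2 * (1 - cos \<delta>))" using c1 by (simp add: pos_le_divide_eq)
  also have "\<dots> = 2 / (1 - cos \<delta>)" using c1 by (simp add: field_simps)
  finally have "(cmod S)\<^sup>2 \<le> 2 / (1 - cos \<delta>)" .
  then have "(cmod S)\<^sup>2 / real m \<le> (2 / (1 - cos \<delta>)) / real m" by (rule divide_right_mono) simp
  then show ?thesis unfolding fejer_def trig_square_eq_norm S_def[symmetric] by simp
qed

text \<open>The function in front of the kernel varies with \<open>j\<close> as well, so pointwise
  convergence would not do: near the peak it has to be close to \<open>P\<close> for all small
  \<open>u\<close> and all large \<open>j\<close> at once. This is what the limit along the product
  filter expresses.\<close>

lemma fejer_approximate_identity: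
  fixes p :: "nat \<Rightarrow> real \<Rightarrow> real"
  assumes m: "filterlim m at_top sequentially"
    and meas[measurable]: "\<And>j. p j \<in> borel_measurable borel"
    and bd: "\<And>j u. \<bar>p j u\<bar> \<le> C"
    and lim: "((\<lambda>(j, u). p j u) \<longlongrightarrow> P) (sequentially \<times>\<^sub>F nhds 0)"
  shows "(\<lambda>j. LINT u|lborel. p j u * fejer (m j) u * indicator {-pi..pi} u) \<longlonglongrightarrow> 2 * pi * P"
proof -
  let ?I = "indicator {-pi..pi} :: real \<Rightarrow> real"
  have fj: "integrable lborel (\<lambda>u. fejer n u * ?I u)" "(LINT u|lborel. fejer n u * ?I u) = 2 * pi" if "n > 0" for n
    using integral_fejer[of 1 n] that by auto
  have Ii: "integrable lborel (\<lambda>u. K * ?I u)" "(LINT u|lborel. K * ?I u) = K * (2 * pi)" for K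
    by auto
  have "\<exists>J. \<forall>j\<ge>J. norm ((LINT u|lborel. p j u * fejer (m j) u * ?I u) - 2 * pi * P) < e" if "e > 0" for e
  proof -
    \<comment> \<open>The kernel has mass \<open>2 * pi\<close>, so the part near 0 contributes at
      most \<open>e / 2\<close>; the part away from 0 is of order \<open>1 / m j\<close>.\<close>
    define \<epsilon> where "\<epsilon> = e / (4 * pi)"
    have \<epsilon>: "\<epsilon> > 0" using that by (simp add: \<epsilon>_def)
    have "eventually (\<lambda>x. dist (case x of (j, u) \<Rightarrow> p j u) P < \<epsilon>) (sequentially \<times>\<^sub>F nhds 0)"
      using lim \<epsilon> by (rule tendstoD)
    then obtain Pf Pg where Pf: "eventually Pf sequentially" and Pg: "eventually Pg (nhds (0::real))"
      and PQ: "\<And>j u. Pf j \<Longrightarrow> Pg u \<Longrightarrow> dist (p j u) P < \<epsilon>"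
      unfolding eventually_prod_filter by auto
    from Pg obtain \<delta>' where \<delta>': "\<delta>' > 0" "\<And>u. dist u 0 < \<delta>' \<Longrightarrow> Pg u"
      unfolding eventually_nhds_metric by auto
    define \<delta> where "\<delta> = min \<delta>' pi"
    have \<delta>: "\<delta> > 0" "\<delta> \<le> pi" using \<delta>' by (auto simp: \<delta>_def)
    define K where "K = (C + \<bar>P\<bar>) * (2 / (1 - cos \<delta>))"
    have "(\<lambda>j. K / real (m j) * (2 * pi)) \<longlonglongrightarrow> 0 * (2 * pi)"
      by (intro tendsto_mult tendsto_const tendsto_divide_0[OF tendsto_const] filterlim_at_top_imp_at_infinity
          filterlim_compose[OF filterlim_real_sequentially m])
    then have "eventually (\<lambda>j. K / real (m j) * (2 * pi) < e / 2) sequentially"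
      using that by (intro order_tendstoD) auto
    moreover have "eventually (\<lambda>j. m j > 0) sequentially"
      using m eventually_gt_at_top[of "0::nat"] unfolding filterlim_iff by blast
    ultimately have "eventually (\<lambda>j. norm ((LINT u|lborel. p j u * fejer (m j) u * ?I u) - 2 * pi * P) < e) sequentially"
      using Pf
    proof eventually_elim
      case (elim j)
      have i1: "integrable lborel (\<lambda>u. p j u * fejer (m j) u * ?I u)"
      proof (rule integrable_dominated)
        show "integrable lborel (\<lambda>u. C * (fejer (m j) u * ?I u))" using fj[OF elim(2)] by simp
        fix u
        have "\<bar>p j u\<bar> * (fejer (m j) u * ?I u) \<le> C * (fejer (m j) u * ?I u)"
          using bd[of j u] fejer_nonneg[of "m j" u] by (intro mult_right_mono) auto
        then show "norm (p j u * fejer (m j) u * ?I u) \<le> C * (fejer (m j) u * ?I u)"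
          using fejer_nonneg[of "m j" u] by (simp add: abs_mult)
      qed simp
      have "(LINT u|lborel. p j u * fejer (m j) u * ?I u) - 2 * pi * P =
        (LINT u|lborel. p j u * fejer (m j) u * ?I u) - (LINT u|lborel. P * (fejer (m j) u * ?I u))"
        using fj[OF elim(2)] by simp
      also have "\<dots> = (LINT u|lborel. (p j u - P) * (fejer (m j) u * ?I u))"
        using i1 fj[OF elim(2)] by (subst Bochner_Integration.integral_diff[symmetric]) (auto simp: algebra_simps)
      finally have "norm ((LINT u|lborel. p j u * fejer (m j) u * ?I u) - 2 * pi * P) \<le>
          (LINT u|lborel. \<bar>(p j u - P) * (fejer (m j) u * ?I u)\<bar>)"
        using integral_abs_bound by simp
      also have "\<dots> \<le> (LINT u|lborel. \<epsilon> * (fejer (m j) u * ?I u) + K / real (m j) * ?I u)"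
      proof (rule integral_mono)
        have "integrable lborel (\<lambda>u. p j u * fejer (m j) u * ?I u - P * (fejer (m j) u * ?I u))"
          using i1 fj[OF elim(2)] by simp
        then show "integrable lborel (\<lambda>u. \<bar>(p j u - P) * (fejer (m j) u * ?I u)\<bar>)"
          by (intro integrable_abs) (simp add: algebra_simps)
        show "integrable lborel (\<lambda>u. \<epsilon> * (fejer (m j) u * ?I u) + K / real (m j) * ?I u)"
          using fj[OF elim(2)] Ii(1) by (intro Bochner_Integration.integrable_add integrable_mult_right) auto
        fix u :: real
        show "\<bar>(p j u - P) * (fejer (m j) u * ?I u)\<bar> \<le> \<epsilon> * (fejer (m j) u * ?I u) + K / real (m j) * ?I u"
        proof (cases "\<bar>u\<bar> \<le> pi")
          case False then show ?thesis by (auto simp: indicator_def)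
        next
          case True
          then have I1: "?I u = 1" by (auto simp: indicator_def)
          have F0: "0 \<le> fejer (m j) u" by (rule fejer_nonneg)
          have CP: "\<bar>p j u - P\<bar> \<le> C + \<bar>P\<bar>" using bd[of j u] by linarith
          show ?thesis
          proof (cases "\<bar>u\<bar> < \<delta>")
            case True
            then have "\<bar>p j u - P\<bar> \<le> \<epsilon>" using PQ[OF elim(3) \<delta>'(2), of u] by (simp add: dist_real_def \<delta>_def)
            then have "\<bar>p j u - P\<bar> * fejer (m j) u \<le> \<epsilon> * fejer (m j) u" using F0 by (rule mult_right_mono)
            moreover have "0 \<le> K / real (m j)"
              using CP by (auto simp: K_def intro!: divide_nonneg_nonneg mult_nonneg_nonneg)
            ultimately show ?thesis using F0 by (simp add: I1 abs_mult)
          next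
            case False
            have "\<bar>p j u - P\<bar> * fejer (m j) u \<le> (C + \<bar>P\<bar>) * ((2 / (1 - cos \<delta>)) / real (m j))"
              using False True \<delta> CP F0 by (intro mult_mono fejer_le) auto
            moreover have "0 \<le> \<epsilon> * fejer (m j) u" using \<epsilon> F0 by simp
            ultimately show ?thesis using F0 by (simp add: I1 abs_mult K_def)
          qed
        qed
      qed
      also have "\<dots> = \<epsilon> * (2 * pi) + K / real (m j) * (2 * pi)"
        using fj[OF elim(2)] Ii by (subst Bochner_Integration.integral_add) auto
      also have "\<epsilon> * (2 * pi) = e / 2" by (simp add: \<epsilon>_def)
      finally show ?case using elim(1) by simp
    qed
    then show ?thesis unfolding eventually_sequentially .
  qed
  then show ?thesis unfolding LIMSEQ_iff by blast
qed

section \<open>Folding the line onto one period\<close>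

lemma integrable_times_bounded:
  fixes q w :: "real \<Rightarrow> real"
  assumes q: "integrable lborel q" and [measurable]: "w \<in> borel_measurable borel" and "\<And>x. \<bar>w x\<bar> \<le> K"
  shows "integrable lborel (\<lambda>x. q x * w x)"
proof (rule integrable_dominated)
  show "norm (q x * w x) \<le> \<bar>q x\<bar> * K" for x using assms(3) by (simp add: abs_mult mult_left_mono)
qed (use q in auto)

lemma bounded_support_integrable:
  fixes q :: "real \<Rightarrow> real"
  assumes "q \<in> borel_measurable borel" and bd: "\<And>x. \<bar>q x\<bar> \<le> C"
    and supp: "\<And>x. B < \<bar>x\<bar> \<Longrightarrow> q x = 0"
  shows "integrable lborel q"
proof (rule integrable_dominated)
  show "norm (q x) \<le> C * indicator {-B..B} x" for x
    using bd[of x] supp[of x] by (cases "\<bar>x\<bar> \<le> B") (auto simp: indicator_def)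
  show "integrable lborel (\<lambda>x. C * indicator {-B..B} x)"
    by (intro integrable_mult_right integrable_real_indicator) (auto simp: emeasure_lborel_Icc_eq)
qed (use assms in simp)

lemma integral_split_periods:
  fixes \<phi> :: "real \<Rightarrow> real"
  assumes \<phi>: "integrable lborel \<phi>" and supp: "\<And>u. (2 * real L + 1) * pi \<le> \<bar>u\<bar> \<Longrightarrow> \<phi> u = 0"
  shows "integral\<^sup>L lborel \<phi> =
    (\<Sum>n\<in>{- int L..int L}. LINT u|lborel. \<phi> (u + 2 * pi * real_of_int n) * indicator {-pi..pi} u)"
proof -
  have m[measurable]: "\<phi> \<in> borel_measurable borel" using \<phi> by auto
  \<comment> \<open>The number of the half-open period containing \<open>u\<close>. Half-open
    intervals partition the line; the closed interval in the claim differs from them by an endpoint,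
    a null set.\<close>
  define i where "i u = \<lfloor>(u + pi) / (2 * pi)\<rfloor>" for u :: real
  have [measurable]: "i \<in> measurable borel (count_space UNIV)" unfolding i_def by measurable
  have dec: "\<phi> u = (\<Sum>n\<in>{- int L..int L}. of_bool (i u = n) * \<phi> u)" for u
  proof (cases "i u \<in> {- int L..int L}")
    case True
    have "(\<Sum>n\<in>{- int L..int L}. of_bool (i u = n) * \<phi> u) = (\<Sum>n\<in>{- int L..int L}. if n = i u then \<phi> u else 0)"
      by (intro sum.cong) auto
    then show ?thesis using True by simp
  next
    case False
    have "(2 * real L + 1) * pi \<le> \<bar>u\<bar>"
    proof (cases "i u > int L")
      case True
      then have "real L + 1 \<le> (u + pi) / (2 * pi)" unfolding i_def by linarith
      then have "(real L + 1) * (2 * pi) \<le> u + pi" by (simp add: pos_le_divide_eq)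
      then show ?thesis by (simp add: algebra_simps)
    next
      case F: False
      with False have "i u < - int L" by auto
      then have "(u + pi) / (2 * pi) < - real L" unfolding i_def by linarith
      then have "u + pi < - real L * (2 * pi)" by (simp add: pos_divide_less_eq)
      then show ?thesis by (simp add: algebra_simps)
    qed
    then show ?thesis using supp by simp
  qed
  have ii: "integrable lborel (\<lambda>u. of_bool (i u = n) * \<phi> u)" for n
    by (rule Bochner_Integration.integrable_bound[OF \<phi>]) auto
  have "integral\<^sup>L lborel \<phi> = (LINT u|lborel. (\<Sum>n\<in>{- int L..int L}. of_bool (i u = n) * \<phi> u))"
    by (rule Bochner_Integration.integral_cong[OF refl dec])
  also have "\<dots> = (\<Sum>n\<in>{- int L..int L}. LINT u|lborel. of_bool (i u = n) * \<phi> u)"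
    using ii by (rule Bochner_Integration.integral_sum)
  also have "\<dots> = (\<Sum>n\<in>{- int L..int L}. LINT u|lborel. \<phi> (u + 2 * pi * real_of_int n) * indicator {-pi..pi} u)"
  proof (intro sum.cong refl)
    fix n :: int
    have iu: "i (2 * pi * real_of_int n + u) = n \<longleftrightarrow> u \<in> {-pi..<pi}" for u
    proof -
      have "(2 * pi * real_of_int n + u + pi) / (2 * pi) = (u + pi) / (2 * pi) + real_of_int n"
        by (simp add: field_simps)
      then have "i (2 * pi * real_of_int n + u) = n \<longleftrightarrow> \<lfloor>(u + pi) / (2 * pi)\<rfloor> = 0"
        unfolding i_def by simp
      also have "\<dots> \<longleftrightarrow> u \<in> {-pi..<pi}"
        unfolding floor_eq_iff by (auto simp: pos_le_divide_eq pos_divide_less_eq)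
      finally show ?thesis .
    qed
    have "(LINT u|lborel. of_bool (i u = n) * \<phi> u) =
      (LINT u|lborel. of_bool (i (2 * pi * real_of_int n + 1 * u) = n) * \<phi> (2 * pi * real_of_int n + 1 * u))"
      by (subst lborel_integral_real_affine[of 1 _ "2 * pi * real_of_int n"]) auto
    also have "\<dots> = (LINT u|lborel. \<phi> (u + 2 * pi * real_of_int n) * indicator {-pi..pi} u)"
    proof (rule integral_cong_AE)
      show "AE u in lborel. of_bool (i (2 * pi * real_of_int n + 1 * u) = n) * \<phi> (2 * pi * real_of_int n + 1 * u) =
          \<phi> (u + 2 * pi * real_of_int n) * indicator {-pi..pi} u"
        using AE_lborel_singleton[of pi]
      proof eventually_elim
        case (elim u)
        then show ?case using iu[of u] by (auto simp: indicator_def add.commute)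
      qed
    qed auto
    finally show "(LINT u|lborel. of_bool (i u = n) * \<phi> u) =
      (LINT u|lborel. \<phi> (u + 2 * pi * real_of_int n) * indicator {-pi..pi} u)" .
  qed
  finally show ?thesis .
qed

definition periodization :: "(real \<Rightarrow> real) \<Rightarrow> real \<Rightarrow> real" where
  "periodization q y = (\<Sum>\<^sub>\<infinity>n::int. q (y + 2 * pi * real_of_int n))"

lemma periodization_periodic: "periodization q (y + 2 * pi * real_of_int k) = periodization q y"
proof -
  have "bij (\<lambda>n::int. n + k)" by (rule bij_plus_right)
  then have "(\<Sum>\<^sub>\<infinity>n::int. q (y + 2 * pi * real_of_int (n + k))) = (\<Sum>\<^sub>\<infinity>n::int. q (y + 2 * pi * real_of_int n))"
    by (rule infsum_reindex_bij_betw)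
  then show ?thesis unfolding periodization_def by (simp add: algebra_simps)
qed

lemma periodization_finite:
  assumes supp: "\<And>x. B < \<bar>x\<bar> \<Longrightarrow> q x = 0" and y: "\<bar>y\<bar> + B < 2 * pi * (real L + 1)"
  shows "periodization q y = (\<Sum>n\<in>{- int L..int L}. q (y + 2 * pi * real_of_int n))"
proof -
  have "q (y + 2 * pi * real_of_int n) = 0" if "n \<notin> {- int L..int L}" for n
  proof -
    have "real L + 1 \<le> \<bar>real_of_int n\<bar>" using that by auto
    then have "2 * pi * (real L + 1) \<le> \<bar>2 * pi * real_of_int n\<bar>" by (simp add: abs_mult)
    then show ?thesis using y by (intro supp) linarith
  qed
  then have "periodization q y = infsum (\<lambda>n. q (y + 2 * pi * real_of_int n)) {- int L..int L}"
    unfolding periodization_def by (intro infsum_cong_neutral) auto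
  then show ?thesis by simp
qed

text \<open>Folding \<open>q * periodization q\<close> onto one period leaves the second factor
  unchanged, being periodic, while the translates of the first add up to the periodisation
  itself.\<close>

lemma integral_times_periodization:
  assumes [measurable]: "q \<in> borel_measurable borel" and bd: "\<And>x. \<bar>q x\<bar> \<le> C"
    and supp: "\<And>x. B < \<bar>x\<bar> \<Longrightarrow> q x = 0" and B: "0 < B"
  shows "integrable lborel (\<lambda>y. q y * periodization q y)"
    and "(LINT y|lborel. q y * periodization q y) = (LINT y|lborel. (periodization q y)\<^sup>2 * indicator {-pi..pi} y)"
proof -
  \<comment> \<open>Large enough for the finite form of the periodisation to hold both on the
    support of \<open>q\<close> and on the fundamental period.\<close>
  obtain L :: nat where L: "B / pi + 1 \<le> real L" using real_arch_simple by blast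
  have L': "B + pi \<le> real L * pi" using L by (simp add: field_simps)
  have fin: "periodization q y = (\<Sum>n\<in>{- int L..int L}. q (y + 2 * pi * real_of_int n))"
    if "\<bar>y\<bar> \<le> max B pi" for y
  proof (rule periodization_finite[OF supp])
    have "B < real L * pi" "pi \<le> real L * pi" using L' B pi_gt_zero by linarith+
    moreover have "2 * pi * (real L + 1) = 2 * (real L * pi) + 2 * pi" by (simp add: algebra_simps)
    ultimately show "\<bar>y\<bar> + B < 2 * pi * (real L + 1)" using that pi_gt_zero by linarith
  qed
  have eq: "q y * periodization q y = (\<Sum>n\<in>{- int L..int L}. q y * q (y + 2 * pi * real_of_int n))" for y
  proof (cases "\<bar>y\<bar> \<le> B")
    case True then show ?thesis by (subst fin) (auto simp: sum_distrib_left)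
  next
    case False then show ?thesis using supp by simp
  qed
  have qi: "integrable lborel q" by (rule bounded_support_integrable[OF assms(1-3)])
  have qqi: "integrable lborel (\<lambda>y. q y * q (y + t))" for t
    by (rule integrable_times_bounded[OF qi, of _ C]) (auto intro: bd)
  show int: "integrable lborel (\<lambda>y. q y * periodization q y)"
    unfolding eq by (intro Bochner_Integration.integrable_sum qqi)
  have "(LINT y|lborel. q y * periodization q y) =
    (\<Sum>n\<in>{- int L..int L}. LINT u|lborel. q (u + 2 * pi * real_of_int n) * periodization q (u + 2 * pi * real_of_int n)
       * indicator {-pi..pi} u)"
  proof (rule integral_split_periods[OF int])
    fix u assume "(2 * real L + 1) * pi \<le> \<bar>u\<bar>"
    moreover have "(2 * real L + 1) * pi = 2 * (real L * pi) + pi" by (simp add: algebra_simps)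
    ultimately have "B < \<bar>u\<bar>" using L' B pi_gt_zero by linarith
    then show "q u * periodization q u = 0" using supp by simp
  qed
  also have "\<dots> = (\<Sum>n\<in>{- int L..int L}. LINT u|lborel. (q (u + 2 * pi * real_of_int n) * periodization q u)
       * indicator {-pi..pi} u)" unfolding periodization_periodic ..
  also have "\<dots> = (LINT u|lborel. (\<Sum>n\<in>{- int L..int L}. (q (u + 2 * pi * real_of_int n) * periodization q u)
       * indicator {-pi..pi} u))"
  proof (rule Bochner_Integration.integral_sum[symmetric])
    fix n :: int
    have "integrable lborel (\<lambda>u. q (2 * pi * real_of_int n + 1 * u) * periodization q (2 * pi * real_of_int n + 1 * u))"
      by (rule lborel_integrable_real_affine[OF int]) simp
    then have "integrable lborel (\<lambda>u. q (u + 2 * pi * real_of_int n) * periodization q (u + 2 * pi * real_of_int n))"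
      by (simp add: add.commute)
    then have "integrable lborel (\<lambda>u. q (u + 2 * pi * real_of_int n) * periodization q u)"
      unfolding periodization_periodic .
    then show "integrable lborel (\<lambda>u. q (u + 2 * pi * real_of_int n) * periodization q u * indicator {-pi..pi} u)"
      by (rule integrable_times_bounded[of _ _ 1]) (auto simp: indicator_def)
  qed
  also have "\<dots> = (LINT y|lborel. (periodization q y)\<^sup>2 * indicator {-pi..pi} y)"
  proof (intro Bochner_Integration.integral_cong refl)
    fix u :: real
    show "(\<Sum>n\<in>{- int L..int L}. (q (u + 2 * pi * real_of_int n) * periodization q u) * indicator {-pi..pi} u) =
      (periodization q u)\<^sup>2 * indicator {-pi..pi} u"
    proof (cases "\<bar>u\<bar> \<le> pi")
      case True
      then have "periodization q u = (\<Sum>n\<in>{- int L..int L}. q (u + 2 * pi * real_of_int n))" by (intro fin) auto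
      then show ?thesis by (simp add: sum_distrib_right[symmetric] power2_eq_square)
    next
      case False then show ?thesis by (auto simp: indicator_def)
    qed
  qed
  finally show "(LINT y|lborel. q y * periodization q y) = (LINT y|lborel. (periodization q y)\<^sup>2 * indicator {-pi..pi} y)" .
qed

section \<open>Toeplitz matrices of cosine coefficients\<close>

definition cos_coeff :: "(real \<Rightarrow> real) \<Rightarrow> real \<Rightarrow> real" where
  "cos_coeff q t = (LINT x|lborel. q x * cos (t * x))"

lemma cos_coeff_shift_even:
  assumes q: "integrable lborel q" and even: "\<And>x. q (- x) = q x"
  shows "(LINT x|lborel. q x * cos (t * (x - y))) = cos (t * y) * cos_coeff q t"
proof -
  have "(LINT x|lborel. q x * sin (t * x)) = (LINT x|lborel. q (0 + (-1) * x) * sin (t * (0 + (-1) * x)))"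
    by (subst lborel_integral_real_affine[of "-1" _ 0]) auto
  also have "\<dots> = - (LINT x|lborel. q x * sin (t * x))" using even by simp
  finally have s0: "(LINT x|lborel. q x * sin (t * x)) = 0" by simp
  have ic: "integrable lborel (\<lambda>x. q x * cos (t * x))" by (rule integrable_times_bounded[OF q, of _ 1]) auto
  have isn: "integrable lborel (\<lambda>x. q x * sin (t * x))" by (rule integrable_times_bounded[OF q, of _ 1]) auto
  have "(LINT x|lborel. q x * cos (t * (x - y))) =
     (LINT x|lborel. cos (t * y) * (q x * cos (t * x)) + sin (t * y) * (q x * sin (t * x)))"
    by (intro Bochner_Integration.integral_cong refl) (simp add: right_diff_distrib cos_diff algebra_simps)
  also have "\<dots> = cos (t * y) * cos_coeff q t + sin (t * y) * (LINT x|lborel. q x * sin (t * x))"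
    unfolding cos_coeff_def using ic isn by (subst Bochner_Integration.integral_add) auto
  finally show ?thesis using s0 by simp
qed

lemma fejer_convolution_eq:
  assumes q: "integrable lborel q" and even: "\<And>x. q (- x) = q x"
  shows "(LINT u|lborel. q (y + u) * fejer m u) =
    (1 / real m) * (\<Sum>k<m. \<Sum>l<m. cos ((real k - real l) * y) * cos_coeff q (real k - real l))"
proof -
  have ic: "integrable lborel (\<lambda>x. q x * cos (t * (x - y)))" for t
    by (rule integrable_times_bounded[OF q, of _ 1]) auto
  have "(LINT u|lborel. q (y + u) * fejer m u) = (LINT x|lborel. q x * fejer m (x - y))"
    by (subst lborel_integral_real_affine[of 1 "\<lambda>x. q x * fejer m (x - y)" y]) auto
  also have "\<dots> = (LINT x|lborel. (1 / real m) * (\<Sum>k<m. \<Sum>l<m. q x * cos ((real k - real l) * (x - y))))"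
    unfolding fejer_def trig_square_def
    by (intro Bochner_Integration.integral_cong refl) (simp add: sum_distrib_left)
  also have "\<dots> = (1 / real m) * (LINT x|lborel. (\<Sum>k<m. \<Sum>l<m. q x * cos ((real k - real l) * (x - y))))"
    by (rule integral_mult_right_zero)
  also have "(LINT x|lborel. (\<Sum>k<m. \<Sum>l<m. q x * cos ((real k - real l) * (x - y)))) =
      (\<Sum>k<m. \<Sum>l<m. LINT x|lborel. q x * cos ((real k - real l) * (x - y)))"
    using ic by (subst Bochner_Integration.integral_sum, simp, subst Bochner_Integration.integral_sum) auto
  also have "\<dots> = (\<Sum>k<m. \<Sum>l<m. cos ((real k - real l) * y) * cos_coeff q (real k - real l))"
    unfolding cos_coeff_shift_even[OF q even] ..
  finally show ?thesis .
qed

text \<open>Of the two equal factors in each squared entry one is written as an integral over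
  \<open>y\<close>; the other is already contained in the convolution with the kernel, where
  evenness of \<open>q\<close> has removed the sine terms.\<close>

lemma toeplitz_frobenius_eq:
  assumes q: "integrable lborel q" and even: "\<And>x. q (- x) = q x"
  shows "(1 / real m) * (\<Sum>k<m. \<Sum>l<m. (cos_coeff q (real k - real l))\<^sup>2) =
    (LINT y|lborel. q y * (LINT u|lborel. q (y + u) * fejer m u))"
proof -
  have ic: "integrable lborel (\<lambda>x. q x * cos (t * x))" for t
    by (rule integrable_times_bounded[OF q, of _ 1]) auto
  have "(LINT y|lborel. q y * (LINT u|lborel. q (y + u) * fejer m u)) =
    (LINT y|lborel. (1 / real m) * (\<Sum>k<m. \<Sum>l<m. cos_coeff q (real k - real l) * (q y * cos ((real k - real l) * y))))"
    unfolding fejer_convolution_eq[OF q even]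
    by (intro Bochner_Integration.integral_cong refl) (simp add: sum_distrib_left mult_ac)
  also have "\<dots> = (1 / real m) * (LINT y|lborel. (\<Sum>k<m. \<Sum>l<m. cos_coeff q (real k - real l) * (q y * cos ((real k - real l) * y))))"
    by (rule integral_mult_right_zero)
  also have "(LINT y|lborel. (\<Sum>k<m. \<Sum>l<m. cos_coeff q (real k - real l) * (q y * cos ((real k - real l) * y)))) =
     (\<Sum>k<m. \<Sum>l<m. cos_coeff q (real k - real l) * cos_coeff q (real k - real l))"
    unfolding cos_coeff_def[of q] using ic
    by (subst Bochner_Integration.integral_sum, simp, subst Bochner_Integration.integral_sum) auto
  finally show ?thesis by (simp add: power2_eq_square)
qed

lemma bil_toeplitz:
  assumes q: "integrable lborel q"
  shows "bil n (\<lambda>k l. cos_coeff q (real k - real l)) d d = (LINT x|lborel. q x * trig_square n d x)"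
proof -
  have ic: "integrable lborel (\<lambda>x. q x * cos (t * x))" for t
    by (rule integrable_times_bounded[OF q, of _ 1]) auto
  have "(LINT x|lborel. q x * trig_square n d x) =
    (LINT x|lborel. (\<Sum>k<n. \<Sum>l<n. (d k * d l) * (q x * cos ((real k - real l) * x))))"
    unfolding trig_square_def by (intro Bochner_Integration.integral_cong refl) (simp add: sum_distrib_left mult_ac)
  also have "\<dots> = (\<Sum>k<n. \<Sum>l<n. (d k * d l) * cos_coeff q (real k - real l))"
    unfolding cos_coeff_def using ic
    by (subst Bochner_Integration.integral_sum, simp, subst Bochner_Integration.integral_sum) auto
  finally show ?thesis unfolding bil_def by (simp add: mult_ac)
qed

text \<open>The form is the integral of \<open>q\<close> against a nonnegative function. Replacing
  \<open>q\<close> by \<open>C\<close> times the indicator of \<open>N\<close> periods costs nothing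
  outside the support, and orthogonality of the cosines evaluates the result.\<close>

lemma bil_toeplitz_le:
  assumes [measurable]: "q \<in> borel_measurable borel" and bd: "\<And>x. \<bar>q x\<bar> \<le> C"
    and supp: "\<And>x. B < \<bar>x\<bar> \<Longrightarrow> q x = 0" and N: "N > 0" "B \<le> real N * pi"
  shows "bil n (\<lambda>k l. cos_coeff q (real k - real l)) d d \<le> (C * (2 * real N * pi)) * (\<Sum>k<n. (d k)\<^sup>2)"
proof -
  let ?I = "indicator {- (real N * pi)..real N * pi} :: real \<Rightarrow> real"
  have q: "integrable lborel q" by (rule bounded_support_integrable[OF assms(1-3)])
  have C0: "0 \<le> C" using bd[of 0] by linarith
  have le: "\<bar>q x * trig_square n d x\<bar> \<le> C * (trig_square n d x * ?I x)" for x
  proof (cases "\<bar>x\<bar> \<le> B")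
    case True
    then have I: "?I x = 1" using N(2) by (auto simp: indicator_def)
    have "\<bar>q x\<bar> * trig_square n d x \<le> C * trig_square n d x"
      using bd trig_square_nonneg by (intro mult_right_mono) auto
    then show ?thesis using I trig_square_nonneg[of n d x] by (simp add: abs_mult)
  next
    case False
    then show ?thesis using supp[of x] C0 trig_square_nonneg[of n d x] by (simp add: indicator_def)
  qed
  have i: "integrable lborel (\<lambda>x. C * (trig_square n d x * ?I x))"
    by (intro integrable_mult_right integral_trig_square N)
  have "(LINT x|lborel. q x * trig_square n d x) \<le> (LINT x|lborel. C * (trig_square n d x * ?I x))"
  proof (rule integral_mono)
    show "integrable lborel (\<lambda>x. q x * trig_square n d x)"
      by (rule integrable_dominated[OF i]) (use le in auto)
    show "q x * trig_square n d x \<le> C * (trig_square n d x * ?I x)" for x using le[of x] by linarith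
  qed (rule i)
  also have "\<dots> = C * (2 * real N * pi * (\<Sum>k<n. (d k)\<^sup>2))"
    by (simp only: integral_mult_right_zero integral_trig_square(2)[OF N(1)])
  finally show ?thesis unfolding bil_toeplitz[OF q] by (simp only: mult.assoc)
qed

text \<open>Cutting the inner convolution into periods puts one peak of the kernel into each, so it
  converges to \<open>2 * pi\<close> times the periodisation. A bound uniform in \<open>j\<close> on
  the common support then allows dominated convergence in the outer integral.\<close>

theorem toeplitz_frobenius_limit:
  fixes q :: "nat \<Rightarrow> real \<Rightarrow> real"
  assumes m: "filterlim m at_top sequentially" and m0: "\<And>j. m j > 0"
    and meas[measurable]: "\<And>j. q j \<in> borel_measurable borel"
    and bd: "\<And>j x. \<bar>q j x\<bar> \<le> C" and supp: "\<And>j x. B < \<bar>x\<bar> \<Longrightarrow> q j x = 0" and B: "0 < B"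
    and even: "\<And>j x. q j (- x) = q j x"
    and lim: "\<And>x. ((\<lambda>(j, u). q j (x + u)) \<longlongrightarrow> q0 x) (sequentially \<times>\<^sub>F nhds 0)"
    and meas0[measurable]: "q0 \<in> borel_measurable borel"
  shows "(\<lambda>j. (1 / real (m j)) * (\<Sum>k<m j. \<Sum>l<m j. (cos_coeff (q j) (real k - real l))\<^sup>2)) \<longlonglongrightarrow>
    2 * pi * (LINT y|lborel. (periodization q0 y)\<^sup>2 * indicator {-pi..pi} y)"
proof -
  have qi: "integrable lborel (q j)" for j by (rule bounded_support_integrable[OF meas bd supp])
  have C0: "0 \<le> C" using bd[of 0 0] by linarith
  have pt: "(\<lambda>j. q j x) \<longlonglongrightarrow> q0 x" for x
  proof -
    have "filterlim (\<lambda>j. (j, 0::real)) (sequentially \<times>\<^sub>F nhds 0) sequentially"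
      by (intro filterlim_Pair filterlim_ident tendsto_const)
    from filterlim_compose[OF lim[of x] this] show ?thesis by simp
  qed
  have bd0: "\<bar>q0 x\<bar> \<le> C" for x
    by (rule LIMSEQ_le_const2[OF tendsto_rabs[OF pt[of x]]]) (auto intro: bd)
  have supp0: "q0 x = 0" if "B < \<bar>x\<bar>" for x
    using pt[of x] supp[OF that] by (simp add: LIMSEQ_const_iff)
  define I where "I j y = (LINT u|lborel. q j (y + u) * fejer (m j) u)" for j y
  \<comment> \<open>With \<open>\<bar>y\<bar> \<le> B\<close> the argument \<open>y + u\<close>
    stays in the support only for \<open>\<bar>u\<bar> \<le> 2 * B\<close>, which the
    \<open>2 * L + 1\<close> central periods cover.\<close>
  obtain L :: nat where L: "B / pi + 1 \<le> real L" using real_arch_simple by blast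
  have L': "B + pi \<le> real L * pi" using L by (simp add: field_simps)
  define S where "S = {- int L..int L}"
  have fji: "integrable lborel (\<lambda>u. q j (y + u) * fejer (m j) u)" for j y
  proof -
    have "\<bar>fejer n u\<bar> \<le> (1 / real n) * (\<Sum>k<n. \<Sum>l<n. 1)" for n u
      unfolding fejer_def trig_square_def abs_mult
      by (intro mult_mono order_trans[OF sum_abs] sum_mono order_trans[OF sum_abs]) (auto intro!: sum_nonneg)
    moreover have "integrable lborel (\<lambda>u. q j (y + 1 * u))"
      by (rule lborel_integrable_real_affine[OF qi]) simp
    ultimately show ?thesis by (intro integrable_times_bounded) auto
  qed
  have split: "I j y = (\<Sum>n\<in>S. LINT u|lborel. q j ((y + 2 * pi * real_of_int n) + u) * fejer (m j) u * indicator {-pi..pi} u)"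
    if y: "\<bar>y\<bar> \<le> B" for j y
  proof -
    have "I j y = (\<Sum>n\<in>S. LINT u|lborel. (q j (y + (u + 2 * pi * real_of_int n)) * fejer (m j) (u + 2 * pi * real_of_int n)) * indicator {-pi..pi} u)"
      unfolding I_def S_def
    proof (rule integral_split_periods[OF fji])
      fix u assume u: "(2 * real L + 1) * pi \<le> \<bar>u\<bar>"
      have "(2 * real L + 1) * pi = 2 * (real L * pi) + pi" by (simp add: algebra_simps)
      then have "2 * B < (2 * real L + 1) * pi" using L' pi_gt_zero by linarith
      then have "B < \<bar>y + u\<bar>" using u y by linarith
      then show "q j (y + u) * fejer (m j) u = 0" using supp by simp
    qed
    then show ?thesis unfolding fejer_periodic by (simp add: add_ac)
  qed
  have Ilim: "(\<lambda>j. I j y) \<longlonglongrightarrow> 2 * pi * periodization q0 y" if y: "\<bar>y\<bar> \<le> B" for y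
  proof -
    have "(\<lambda>j. \<Sum>n\<in>S. LINT u|lborel. q j ((y + 2 * pi * real_of_int n) + u) * fejer (m j) u * indicator {-pi..pi} u)
      \<longlonglongrightarrow> (\<Sum>n\<in>S. 2 * pi * q0 (y + 2 * pi * real_of_int n))"
      by (intro tendsto_sum fejer_approximate_identity[OF m _ bd lim]) measurable
    also have "(\<Sum>n\<in>S. 2 * pi * q0 (y + 2 * pi * real_of_int n)) = 2 * pi * periodization q0 y"
    proof -
      have "2 * pi * (real L + 1) = 2 * (real L * pi) + 2 * pi" by (simp add: algebra_simps)
      then have "\<bar>y\<bar> + B < 2 * pi * (real L + 1)" using L' y B pi_gt_zero by linarith
      from periodization_finite[OF supp0 this] show ?thesis by (simp add: S_def sum_distrib_left)
    qed
    finally show ?thesis using split[OF y] by simp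
  qed
  \<comment> \<open>Each of the finitely many periods contributes at most \<open>C\<close> times the
    mass \<open>2 * pi\<close> of the kernel.\<close>
  define K where "K = real (card S) * (C * (2 * pi))"
  have Ibd: "\<bar>I j y\<bar> \<le> K" if y: "\<bar>y\<bar> \<le> B" for j y
  proof -
    have "\<bar>LINT u|lborel. q j (z + u) * fejer (m j) u * indicator {-pi..pi} u\<bar> \<le> C * (2 * pi)" for z
    proof -
      have fj: "integrable lborel (\<lambda>u. fejer (m j) u * indicator {-pi..pi} u)"
        "(LINT u|lborel. fejer (m j) u * indicator {-pi..pi} u) = 2 * pi"
        using integral_fejer[of 1 "m j"] m0[of j] by auto
      have "\<bar>LINT u|lborel. q j (z + u) * fejer (m j) u * indicator {-pi..pi} u\<bar> \<le>
        (LINT u|lborel. C * (fejer (m j) u * indicator {-pi..pi} u))"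
      proof (rule order_trans[OF integral_abs_bound])
        have b: "\<bar>q j (z + u) * fejer (m j) u * indicator {-pi..pi} u\<bar> \<le> C * (fejer (m j) u * indicator {-pi..pi} u)" for u
        proof -
          have "\<bar>q j (z + u)\<bar> * (fejer (m j) u * indicator {-pi..pi} u) \<le> C * (fejer (m j) u * indicator {-pi..pi} u)"
            using bd fejer_nonneg by (intro mult_right_mono) auto
          then show ?thesis using fejer_nonneg[of "m j" u] by (simp add: abs_mult)
        qed
        show "(LINT u|lborel. \<bar>q j (z + u) * fejer (m j) u * indicator {-pi..pi} u\<bar>) \<le>
          (LINT u|lborel. C * (fejer (m j) u * indicator {-pi..pi} u))"
        proof (rule integral_mono[OF _ _ b])
          show i: "integrable lborel (\<lambda>u. C * (fejer (m j) u * indicator {-pi..pi} u))" using fj by simp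
          show "integrable lborel (\<lambda>u. \<bar>q j (z + u) * fejer (m j) u * indicator {-pi..pi} u\<bar>)"
            by (rule integrable_dominated[OF i]) (use b in auto)
        qed
      qed
      then show ?thesis using fj(2) by simp
    qed
    then have "\<bar>I j y\<bar> \<le> (\<Sum>n\<in>S. C * (2 * pi))"
      unfolding split[OF y] by (intro order_trans[OF sum_abs] sum_mono)
    then show ?thesis by (simp add: K_def)
  qed
  have K0: "0 \<le> K" unfolding K_def using C0 by simp
  have Im[measurable]: "I j \<in> borel_measurable borel" for j
    unfolding I_def fejer_convolution_eq[OF qi even] by measurable
  have "(\<lambda>j. LINT y|lborel. q j y * I j y) \<longlonglongrightarrow> (LINT y|lborel. 2 * pi * (q0 y * periodization q0 y))"
  proof (rule integral_dominated_convergence[where w="\<lambda>y. C * K * indicator {-B..B} y"])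
    show "(\<lambda>y. 2 * pi * (q0 y * periodization q0 y)) \<in> borel_measurable lborel"
      using borel_measurable_integrable[OF integral_times_periodization(1)[OF meas0 bd0 supp0 B]] by simp
    show "integrable lborel (\<lambda>y. C * K * indicator {-B..B} y)"
      by (intro integrable_mult_right integrable_real_indicator) (auto simp: emeasure_lborel_Icc_eq)
    show "AE y in lborel. (\<lambda>j. q j y * I j y) \<longlonglongrightarrow> 2 * pi * (q0 y * periodization q0 y)"
    proof (rule AE_I2)
      fix y
      show "(\<lambda>j. q j y * I j y) \<longlonglongrightarrow> 2 * pi * (q0 y * periodization q0 y)"
      proof (cases "\<bar>y\<bar> \<le> B")
        case True
        from tendsto_mult[OF pt[of y] Ilim[OF True]] show ?thesis by (simp add: mult_ac)
      next
        case False then show ?thesis using supp supp0 by simp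
      qed
    qed
    show "AE y in lborel. norm (q j y * I j y) \<le> C * K * indicator {-B..B} y" for j
    proof (rule AE_I2)
      fix y
      show "norm (q j y * I j y) \<le> C * K * indicator {-B..B} y"
      proof (cases "\<bar>y\<bar> \<le> B")
        case True
        have "\<bar>q j y\<bar> * \<bar>I j y\<bar> \<le> C * K" using C0 by (intro mult_mono bd Ibd True) auto
        then show ?thesis using True by (auto simp: abs_mult indicator_def)
      next
        case False then show ?thesis using supp C0 K0 by simp
      qed
    qed
  qed simp
  also have "(LINT y|lborel. 2 * pi * (q0 y * periodization q0 y)) =
      2 * pi * (LINT y|lborel. (periodization q0 y)\<^sup>2 * indicator {-pi..pi} y)"
    by (simp only: integral_mult_right_zero integral_times_periodization(2)[OF meas0 bd0 supp0 B])
  finally show ?thesis unfolding toeplitz_frobenius_eq[OF qi even] I_def .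
qed

section \<open>The spectral density and the Fourier transform\<close>

lemma integrable_abs_powr_unit_ball:
  fixes \<beta> t :: real
  assumes "\<beta> < 1"
  shows "integrable lborel (\<lambda>x. \<bar>x - t\<bar> powr (- \<beta>) * indicator {x. \<bar>x - t\<bar> < 1} x)"
proof -
  define g where "g x = (if x \<in> {0..1} then x powr (- \<beta>) else 0)" for x :: real
  have gm[measurable]: "g \<in> borel_measurable borel" unfolding g_def by measurable
  have "((\<lambda>x. x powr (- \<beta>)) has_integral (1 powr (- \<beta> + 1) / (- \<beta> + 1))) {0..1::real}"
    using assms by (intro has_integral_powr_from_0) auto
  then have gI: "(g has_integral (1 / (1 - \<beta>))) UNIV"
    unfolding g_def[abs_def] has_integral_restrict_UNIV by simp
  have g0: "0 \<le> g x" for x by (simp add: g_def)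
  have "integral\<^sup>N lborel g = ennreal (1 / (1 - \<beta>))"
    by (rule nn_integral_has_integral_lborel[OF gm g0 gI])
  then have g: "integrable lborel g"
    using g0 by (intro integrableI_nonneg) auto
  have g1: "integrable lborel (\<lambda>x. g (- t + 1 * x))" by (rule lborel_integrable_real_affine[OF g]) simp
  have g2: "integrable lborel (\<lambda>x. g (t + (-1) * x))" by (rule lborel_integrable_real_affine[OF g]) simp
  show ?thesis
  proof (rule integrable_dominated[OF Bochner_Integration.integrable_add[OF g1 g2]])
    show "norm (\<bar>x - t\<bar> powr (- \<beta>) * indicator {x. \<bar>x - t\<bar> < 1} x) \<le> g (- t + 1 * x) + g (t + (-1) * x)" for x
      by (auto simp: g_def indicator_def abs_if)
  qed measurable
qed

text \<open>Within distance 1 of a singularity the other linear factor of \<open>l^2 - s0^2\<close>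
  is at least 1 because \<open>s0 > 1\<close>, and \<open>2 * \<alpha> < 1\<close> makes the pole
  integrable. Elsewhere both factors are at least \<open>(1 + |l|) / (2 + s0)\<close>, which
  explains \<open>K\<close> and the exponent \<open>4 * \<alpha>\<close> in the decay
  hypothesis.\<close>

lemma spectral_density_integrable:
  fixes h :: "real \<Rightarrow> real"
  assumes s0: "s0 > 1" and \<alpha>: "0 < \<alpha>" "\<alpha> < 1/2"
    and h0: "\<And>l. h l \<ge> 0" and bd: "\<And>l. h l \<le> H" and [measurable]: "h \<in> borel_measurable borel"
    and int: "integrable lborel (\<lambda>l. h l * (1 + \<bar>l\<bar>) powr (- (4 * \<alpha>)))"
  shows "integrable lborel (\<lambda>l. h l / \<bar>l\<^sup>2 - s0\<^sup>2\<bar> powr (2 * \<alpha>))"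
proof -
  define K where "K = (2 + s0) powr (4 * \<alpha>)"
  define w where "w t x = \<bar>x - t\<bar> powr (- (2 * \<alpha>)) * indicator {x. \<bar>x - t\<bar> < 1} x" for t x :: real
  have w: "integrable lborel (w t)" for t unfolding w_def using \<alpha> by (intro integrable_abs_powr_unit_ball) simp
  have w0: "0 \<le> w t x" for t x by (simp add: w_def)
  have H0: "0 \<le> H" using h0[of 0] bd[of 0] by linarith
  have dom: "integrable lborel (\<lambda>l. H * w s0 l + H * w (- s0) l + K * (h l * (1 + \<bar>l\<bar>) powr (- (4 * \<alpha>))))"
    using w int by (intro Bochner_Integration.integrable_add integrable_mult_right) auto
  have main: "h l / \<bar>l\<^sup>2 - s0\<^sup>2\<bar> powr (2 * \<alpha>) \<le>
      H * w s0 l + H * w (- s0) l + K * (h l * (1 + \<bar>l\<bar>) powr (- (4 * \<alpha>)))" for l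
  proof -
    have fac: "\<bar>l\<^sup>2 - s0\<^sup>2\<bar> = \<bar>l - s0\<bar> * \<bar>l + s0\<bar>"
      by (simp add: abs_mult[symmetric] power2_eq_square algebra_simps)
    have near: "h l / \<bar>l\<^sup>2 - s0\<^sup>2\<bar> powr (2 * \<alpha>) \<le> H * w t l"
      if t: "\<bar>l - t\<bar> < 1" "1 \<le> \<bar>l + t\<bar>" "t\<^sup>2 = s0\<^sup>2" for t
    proof (cases "l = t")
      \<comment> \<open>At the singularity itself the quotient is 0 by the conventions for
        \<open>0 powr _\<close> and division by zero.\<close>
      case True then show ?thesis using t(3) H0 w0 by simp
    next
      case False
      have "\<bar>l\<^sup>2 - s0\<^sup>2\<bar> = \<bar>l - t\<bar> * \<bar>l + t\<bar>"
        unfolding t(3)[symmetric] by (simp add: abs_mult[symmetric] power2_eq_square algebra_simps)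
      then have "\<bar>l - t\<bar> \<le> \<bar>l\<^sup>2 - s0\<^sup>2\<bar>" using t(2) mult_left_mono[of 1 "\<bar>l + t\<bar>" "\<bar>l - t\<bar>"] by simp
      then have "\<bar>l - t\<bar> powr (2 * \<alpha>) \<le> \<bar>l\<^sup>2 - s0\<^sup>2\<bar> powr (2 * \<alpha>)" using \<alpha> by (intro powr_mono2) auto
      then have "h l / \<bar>l\<^sup>2 - s0\<^sup>2\<bar> powr (2 * \<alpha>) \<le> H / \<bar>l - t\<bar> powr (2 * \<alpha>)"
        using h0[of l] bd[of l] False by (intro frac_le) auto
      then show ?thesis using t(1) by (simp add: w_def powr_minus divide_inverse)
    qed
    consider "\<bar>l - s0\<bar> < 1" | "\<bar>l + s0\<bar> < 1" | "1 \<le> \<bar>l - s0\<bar>" "1 \<le> \<bar>l + s0\<bar>" by linarith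
    then show ?thesis
    proof cases
      case 1
      then have "h l / \<bar>l\<^sup>2 - s0\<^sup>2\<bar> powr (2 * \<alpha>) \<le> H * w s0 l" using s0 by (intro near) auto
      moreover have "0 \<le> H * w (- s0) l" "0 \<le> K * (h l * (1 + \<bar>l\<bar>) powr (- (4 * \<alpha>)))"
        using H0 w0 h0 by (auto simp: K_def)
      ultimately show ?thesis by linarith
    next
      case 2
      then have "h l / \<bar>l\<^sup>2 - s0\<^sup>2\<bar> powr (2 * \<alpha>) \<le> H * w (- s0) l" using s0 by (intro near) auto
      moreover have "0 \<le> H * w s0 l" "0 \<le> K * (h l * (1 + \<bar>l\<bar>) powr (- (4 * \<alpha>)))"
        using H0 w0 h0 by (auto simp: K_def)
      ultimately show ?thesis by linarith
    next
      case 3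
      define r where "r = (1 + \<bar>l\<bar>) / (2 + s0)"
      have r0: "r > 0" using s0 by (simp add: r_def)
      have A1: "r \<le> \<bar>l - t\<bar>" if "1 \<le> \<bar>l - t\<bar>" "\<bar>t\<bar> = s0" for t
      proof -
        have "s0 * 1 \<le> s0 * \<bar>l - t\<bar>" using that s0 by (intro mult_left_mono) auto
        moreover have "\<bar>l\<bar> \<le> \<bar>l - t\<bar> + s0" using that by linarith
        moreover have "1 + L \<le> x * (2 + s0)" if "s0 * 1 \<le> s0 * x" "L \<le> x + s0" "1 \<le> x" for L x
        proof -
          have "x * (2 + s0) = 2 * x + s0 * x" by (simp add: algebra_simps)
          then show ?thesis using that by linarith
        qed
        ultimately have "1 + \<bar>l\<bar> \<le> \<bar>l - t\<bar> * (2 + s0)" using that(1) by blast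
        then show ?thesis using s0 by (simp add: r_def pos_divide_le_eq)
      qed
      have "r * r \<le> \<bar>l - s0\<bar> * \<bar>l - (- s0)\<bar>"
        using 3 s0 r0 by (intro mult_mono A1) auto
      then have "(r * r) powr (2 * \<alpha>) \<le> \<bar>l\<^sup>2 - s0\<^sup>2\<bar> powr (2 * \<alpha>)"
        unfolding fac using \<alpha> r0 by (intro powr_mono2) auto
      moreover have "(r * r) powr (2 * \<alpha>) = (1 + \<bar>l\<bar>) powr (4 * \<alpha>) / K"
      proof -
        have "(r * r) powr (2 * \<alpha>) = r powr (4 * \<alpha>)"
          using r0 by (simp add: powr_mult powr_add[symmetric])
        also have "\<dots> = (1 + \<bar>l\<bar>) powr (4 * \<alpha>) / K"
          unfolding r_def K_def by (simp add: powr_divide)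
        finally show ?thesis .
      qed
      ultimately have le: "(1 + \<bar>l\<bar>) powr (4 * \<alpha>) / K \<le> \<bar>l\<^sup>2 - s0\<^sup>2\<bar> powr (2 * \<alpha>)" by simp
      have pos: "(1 + \<bar>l\<bar>) powr (4 * \<alpha>) / K > 0" using s0 by (simp add: K_def)
      have "h l / \<bar>l\<^sup>2 - s0\<^sup>2\<bar> powr (2 * \<alpha>) \<le> h l / ((1 + \<bar>l\<bar>) powr (4 * \<alpha>) / K)"
        using h0[of l] pos le by (intro divide_left_mono mult_pos_pos) auto
      also have "\<dots> = K * (h l * (1 + \<bar>l\<bar>) powr (- (4 * \<alpha>)))"
        by (simp add: powr_minus divide_inverse)
      finally show ?thesis using mult_nonneg_nonneg[OF H0 w0[of s0 l]] mult_nonneg_nonneg[OF H0 w0[of "- s0" l]] by linarith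
    qed
  qed
  show ?thesis
  proof (rule integrable_dominated[OF dom])
    show "norm (h l / \<bar>l\<^sup>2 - s0\<^sup>2\<bar> powr (2 * \<alpha>)) \<le>
      H * w s0 l + H * w (- s0) l + K * (h l * (1 + \<bar>l\<bar>) powr (- (4 * \<alpha>)))" for l
      using main[of l] h0[of l] by simp
  qed measurable
qed

text \<open>The linear Taylor term vanishes, and the second derivative is continuous with value 0 at
  0, so it stays below 1 nearby and the Lagrange remainder is at most
  \<open>x^2 / 2\<close>.\<close>

lemma quadratic_bound_from_derivs:
  fixes h :: "real \<Rightarrow> real"
  assumes diff: "\<forall>i<3. \<forall>x. ((deriv ^^ i) h) differentiable (at x)"
    and d0: "(deriv ^^ 1) h 0 = 0" "(deriv ^^ 2) h 0 = 0"
  shows "eventually (\<lambda>x. \<bar>h x - h 0\<bar> \<le> x\<^sup>2) (nhds 0)"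
proof -
  have D: "DERIV ((deriv ^^ i) h) x :> (deriv ^^ Suc i) h x" if "i < 3" for i x
    using diff that by (simp add: DERIV_deriv_iff_real_differentiable)
  have "isCont ((deriv ^^ 2) h) 0" using D[of 2 0] by (simp add: DERIV_isCont)
  then have "eventually (\<lambda>x. dist ((deriv ^^ 2) h x) ((deriv ^^ 2) h 0) < 1) (nhds 0)"
    unfolding isCont_def tendsto_at_iff_tendsto_nhds by (rule tendstoD) simp
  then obtain d where d: "d > 0" "\<And>x. \<bar>x\<bar> < d \<Longrightarrow> \<bar>(deriv ^^ 2) h x\<bar> < 1"
    unfolding eventually_nhds_metric d0 by (auto simp: dist_real_def)
  have "\<bar>h x - h 0\<bar> \<le> x\<^sup>2" if x: "\<bar>x\<bar> < d" for x
  proof -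
    have "\<exists>t. \<bar>t\<bar> \<le> \<bar>x\<bar> \<and> h x = (\<Sum>m<2. (deriv ^^ m) h 0 / fact m * x ^ m) + (deriv ^^ 2) h t / fact 2 * x ^ 2"
      using D by (intro Maclaurin_bi_le) auto
    then obtain t where t: "\<bar>t\<bar> \<le> \<bar>x\<bar>" "h x = (\<Sum>m<2. (deriv ^^ m) h 0 / fact m * x ^ m) + (deriv ^^ 2) h t / fact 2 * x ^ 2"
      by blast
    have "h x - h 0 = (deriv ^^ 2) h t / 2 * x\<^sup>2" unfolding t(2) using d0 by (simp add: numeral_2_eq_2)
    then have "\<bar>h x - h 0\<bar> = \<bar>(deriv ^^ 2) h t\<bar> / 2 * x\<^sup>2" by (simp only: abs_mult abs_divide) simp
    also have "\<dots> \<le> 1 * x\<^sup>2" using d(2)[of t] t(1) x by (intro mult_right_mono) auto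
    finally show ?thesis by simp
  qed
  then show ?thesis unfolding eventually_nhds_metric using d(1) by (auto simp: dist_real_def)
qed

lemma DERIV_imp_eventually_linear_bound:
  fixes g :: "real \<Rightarrow> real"
  assumes "DERIV g 0 :> D"
  shows "eventually (\<lambda>x. \<bar>g x - g 0\<bar> \<le> (\<bar>D\<bar> + 1) * \<bar>x\<bar>) (nhds 0)"
proof -
  have "((\<lambda>x. (g x - g 0) / (x - 0)) \<longlongrightarrow> D) (at 0)" using assms by (simp add: has_field_derivative_iff)
  then have "eventually (\<lambda>x. dist ((g x - g 0) / (x - 0)) D < 1) (at 0)" by (rule tendstoD) simp
  then have "eventually (\<lambda>x. x \<noteq> 0 \<longrightarrow> dist ((g x - g 0) / (x - 0)) D < 1) (nhds 0)"
    unfolding eventually_at_filter by simp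
  then show ?thesis
  proof eventually_elim
    case (elim x)
    show ?case
    proof (cases "x = 0")
      case False
      then have "\<bar>(g x - g 0) / x\<bar> \<le> \<bar>D\<bar> + 1" using elim by (auto simp: dist_real_def)
      then have "\<bar>g x - g 0\<bar> / \<bar>x\<bar> \<le> \<bar>D\<bar> + 1" by simp
      then show ?thesis using False by (simp add: pos_divide_le_eq)
    qed simp
  qed
qed

text \<open>Near 0 the density is \<open>h l * g (l^2)\<close> with \<open>g\<close> differentiable
  at 0; both factors change by a multiple of \<open>l^2\<close> only.\<close>

lemma spectral_density_near_0:
  fixes h :: "real \<Rightarrow> real" and \<alpha> :: real
  assumes s0: "s0 > 0" and h1: "h 0 = 1"
    and hq: "eventually (\<lambda>x. \<bar>h x - h 0\<bar> \<le> x\<^sup>2) (nhds 0)"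
  defines "f \<equiv> (\<lambda>l. h l / \<bar>l\<^sup>2 - s0\<^sup>2\<bar> powr (2 * \<alpha>))"
  shows "f 0 = s0 powr (- 4 * \<alpha>)"
    and "\<exists>\<rho> K. \<rho> > 0 \<and> K \<ge> 0 \<and> (\<forall>l. \<bar>l\<bar> < \<rho> \<longrightarrow> \<bar>f l - f 0\<bar> \<le> K * l\<^sup>2)"
proof -
  define g where "g w = (s0\<^sup>2 - w) powr (- (2 * \<alpha>))" for w
  have s2: "s0\<^sup>2 > 0" using s0 by simp
  have "(s0\<^sup>2) powr (2 * \<alpha>) = s0 powr (4 * \<alpha>)"
    using s0 by (simp add: power2_eq_square powr_mult powr_add[symmetric])
  then show f0: "f 0 = s0 powr (- 4 * \<alpha>)"
    unfolding f_def using h1 by (simp add: powr_minus divide_inverse)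
  have "DERIV (\<lambda>w. s0\<^sup>2 - w) 0 :> - 1" by (auto intro!: derivative_eq_intros)
  from DERIV_fun_powr[where r="- (2 * \<alpha>)", OF this] s2 obtain D where "DERIV g 0 :> D"
    unfolding g_def[abs_def] by auto
  then have gD: "eventually (\<lambda>w. \<bar>g w - g 0\<bar> \<le> (\<bar>D\<bar> + 1) * \<bar>w\<bar>) (nhds 0)"
    by (rule DERIV_imp_eventually_linear_bound)
  have "((\<lambda>l::real. l\<^sup>2) \<longlongrightarrow> 0\<^sup>2) (nhds 0)" by (intro tendsto_power filterlim_ident)
  then have sq: "filterlim (\<lambda>l::real. l\<^sup>2) (nhds 0) (nhds 0)" by simp
  have 1: "eventually (\<lambda>l. \<bar>g (l\<^sup>2) - g 0\<bar> \<le> (\<bar>D\<bar> + 1) * l\<^sup>2) (nhds 0)"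
    using eventually_compose_filterlim[OF gD sq] by simp
  \<comment> \<open>The bound \<open>s0^2\<close> resolves the absolute value in the denominator;
    the bound 1 turns the linear estimate for \<open>g\<close> into a constant one.\<close>
  have 2: "eventually (\<lambda>l::real. l\<^sup>2 < min 1 (s0\<^sup>2)) (nhds 0)"
    using order_tendstoD(2)[OF sq, of "min 1 (s0\<^sup>2)"] s2 by simp
  define K where "K = (g 0 + \<bar>D\<bar> + 1) + (\<bar>D\<bar> + 1)"
  have g0: "g 0 > 0" using s2 by (simp add: g_def)
  have "eventually (\<lambda>l. \<bar>f l - f 0\<bar> \<le> K * l\<^sup>2) (nhds 0)"
    using 1 2 hq
  proof eventually_elim
    case (elim l)
    have fl: "f l = h l * g (l\<^sup>2)" "f 0 = g 0"
      using elim(2) h1 by (auto simp: f_def g_def powr_minus divide_inverse abs_if)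
    have gb: "\<bar>g (l\<^sup>2)\<bar> \<le> g 0 + \<bar>D\<bar> + 1"
    proof -
      have "(\<bar>D\<bar> + 1) * l\<^sup>2 \<le> (\<bar>D\<bar> + 1) * 1" using elim(2) by (intro mult_left_mono) auto
      from order_trans[OF elim(1) this] have "\<bar>g (l\<^sup>2) - g 0\<bar> \<le> \<bar>D\<bar> + 1" by simp
      then show ?thesis using g0 by linarith
    qed
    have "f l - f 0 = (h l - h 0) * g (l\<^sup>2) + (g (l\<^sup>2) - g 0)" unfolding fl h1 by (simp add: algebra_simps)
    then have "\<bar>f l - f 0\<bar> \<le> \<bar>h l - h 0\<bar> * \<bar>g (l\<^sup>2)\<bar> + \<bar>g (l\<^sup>2) - g 0\<bar>"
      by (metis abs_mult abs_triangle_ineq)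
    also have "\<dots> \<le> l\<^sup>2 * (g 0 + \<bar>D\<bar> + 1) + (\<bar>D\<bar> + 1) * l\<^sup>2"
      using elim(1,3) gb by (intro add_mono mult_mono) auto
    also have "\<dots> = K * l\<^sup>2" by (simp add: K_def algebra_simps)
    finally show ?case .
  qed
  moreover have "K \<ge> 0" unfolding K_def using g0 by simp
  ultimately show "\<exists>\<rho> K. \<rho> > 0 \<and> K \<ge> 0 \<and> (\<forall>l. \<bar>l\<bar> < \<rho> \<longrightarrow> \<bar>f l - f 0\<bar> \<le> K * l\<^sup>2)"
    unfolding eventually_nhds_metric by (auto simp: dist_real_def)
qed

section \<open>The Fourier transform of an integrable function\<close>

lemma fourier_integrand_integrable:
  assumes "integrable lborel \<psi>"
  shows "integrable lborel (\<lambda>t. cis (- (w * t)) * complex_of_real (\<psi> t))"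
proof (rule Bochner_Integration.integrable_bound[OF assms])
  have [measurable]: "\<psi> \<in> borel_measurable borel" using assms by auto
  show "(\<lambda>t. cis (- (w * t)) * complex_of_real (\<psi> t)) \<in> borel_measurable lborel" by measurable
qed (auto simp: norm_mult)

lemma fourier_tr_bound: "cmod (fourier_tr \<psi> w) \<le> (LINT t|lborel. \<bar>\<psi> t\<bar>)"
  unfolding fourier_tr_def by (rule order_trans[OF integral_norm_bound]) (simp add: norm_mult)

lemma fourier_tr_isCont:
  assumes \<psi>: "integrable lborel \<psi>"
  shows "isCont (fourier_tr \<psi>) w"
proof -
  have [measurable]: "\<psi> \<in> borel_measurable borel" using \<psi> by auto
  have "(\<lambda>n. fourier_tr \<psi> (s n)) \<longlonglongrightarrow> fourier_tr \<psi> w" if s: "s \<longlonglongrightarrow> w" for s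
    unfolding fourier_tr_def
  proof (rule integral_dominated_convergence[where w="\<lambda>t. \<bar>\<psi> t\<bar>"])
    show "AE t in lborel. (\<lambda>n. cis (- (s n * t)) * complex_of_real (\<psi> t)) \<longlonglongrightarrow> cis (- (w * t)) * complex_of_real (\<psi> t)"
      unfolding cis_conv_exp by (intro AE_I2 tendsto_intros s)
  qed (use \<psi> in \<open>auto simp: norm_mult\<close>)
  then show ?thesis unfolding continuous_at_sequentially by (simp add: comp_def)
qed

lemma fourier_tr_uminus: "fourier_tr \<psi> (- w) = cnj (fourier_tr \<psi> w)"
proof -
  have "cnj (fourier_tr \<psi> w) = (LINT t|lborel. cnj (cis (- (w * t)) * complex_of_real (\<psi> t)))"
    unfolding fourier_tr_def by (rule Bochner_Integration.integral_cnj[symmetric])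
  then show ?thesis by (simp add: fourier_tr_def cis_cnj)
qed

lemma fourier_tr_measurable[measurable]:
  assumes "integrable lborel \<psi>"
  shows "fourier_tr \<psi> \<in> borel_measurable borel"
  using fourier_tr_isCont[OF assms] by (intro borel_measurable_continuous_onI) (simp add: continuous_on_eq_continuous_at)

lemma fourier_tr_affine:
  assumes "a > 0"
  shows "fourier_tr (\<lambda>t. \<psi> ((t - b) / a)) l = complex_of_real a * cis (- (l * b)) * fourier_tr \<psi> (a * l)"
proof -
  have "fourier_tr (\<lambda>t. \<psi> ((t - b) / a)) l = \<bar>a\<bar> *\<^sub>R (LINT t|lborel. cis (- (l * (b + a * t))) * complex_of_real (\<psi> (((b + a * t) - b) / a)))"
    unfolding fourier_tr_def using assms by (intro lborel_integral_real_affine) simp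
  also have "\<dots> = a *\<^sub>R (LINT t|lborel. cis (- (l * b)) * (cis (- (a * l * t)) * complex_of_real (\<psi> t)))"
  proof -
    have "cis (- (l * (b + a * t))) = cis (- (l * b)) * cis (- (a * l * t))" for t
      unfolding cis_mult by (simp add: algebra_simps)
    then show ?thesis using assms by (simp add: mult.assoc)
  qed
  also have "\<dots> = complex_of_real a * cis (- (l * b)) * fourier_tr \<psi> (a * l)"
    unfolding fourier_tr_def by (simp add: scaleR_conv_of_real)
  finally show ?thesis .
qed

lemma fourier_tr_sum:
  assumes "\<And>k. k \<in> S \<Longrightarrow> integrable lborel (g k)"
  shows "fourier_tr (\<lambda>t. \<Sum>k\<in>S. d k * g k t) l = (\<Sum>k\<in>S. complex_of_real (d k) * fourier_tr (g k) l)"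
proof -
  have "fourier_tr (\<lambda>t. \<Sum>k\<in>S. d k * g k t) l =
    (LINT t|lborel. (\<Sum>k\<in>S. complex_of_real (d k) * (cis (- (l * t)) * complex_of_real (g k t))))"
    unfolding fourier_tr_def by (intro Bochner_Integration.integral_cong refl) (simp add: sum_distrib_left mult_ac)
  also have "\<dots> = (\<Sum>k\<in>S. complex_of_real (d k) * fourier_tr (g k) l)"
    unfolding fourier_tr_def using fourier_integrand_integrable[OF assms]
    by (subst Bochner_Integration.integral_sum) auto
  finally show ?thesis .
qed

section \<open>Wavelet coefficients\<close>

text \<open>The integrand \<open>a * f l * |psi^(a l)|^2\<close> of the variance after the
  substitution \<open>x = \<gamma> * l\<close>: the spectral density of the coefficients of one
  scale as a sequence in \<open>k\<close>, before wrapping modulo \<open>2 * pi\<close>.\<close>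

definition wavelet_density :: "(real \<Rightarrow> real) \<Rightarrow> (real \<Rightarrow> real) \<Rightarrow> real \<Rightarrow> real \<Rightarrow> real \<Rightarrow> real" where
  "wavelet_density f \<psi> a \<gamma> x = a / \<gamma> * f (x / \<gamma>) * (cmod (fourier_tr \<psi> (a / \<gamma> * x)))\<^sup>2"

lemma wavelet_density_integrable:
  assumes f: "integrable lborel f" and \<psi>: "integrable lborel \<psi>" and \<gamma>: "\<gamma> > 0"
  shows "integrable lborel (wavelet_density f \<psi> a \<gamma>)"
proof -
  note fourier_tr_measurable[OF \<psi>, measurable]
  have "integrable lborel (\<lambda>x. a / \<gamma> * f (0 + (1 / \<gamma>) * x))"
    using \<gamma> by (intro integrable_mult_right lborel_integrable_real_affine[OF f]) simp
  then have "integrable lborel (\<lambda>x. a / \<gamma> * f (x / \<gamma>))" by simp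
  then have "integrable lborel (\<lambda>x. a / \<gamma> * f (x / \<gamma>) * (cmod (fourier_tr \<psi> (a / \<gamma> * x)))\<^sup>2)"
  proof (rule integrable_times_bounded)
    show "\<bar>(cmod (fourier_tr \<psi> (a / \<gamma> * x)))\<^sup>2\<bar> \<le> (LINT t|lborel. \<bar>\<psi> t\<bar>)\<^sup>2" for x
      by (simp add: power_mono fourier_tr_bound)
  qed simp
  then show ?thesis by (simp add: wavelet_density_def[abs_def])
qed

lemma trig_square_uminus: "trig_square n d (- x) = trig_square n d x"
  by (simp add: trig_square_def)

lemma (in gaussian_spectral_process) wav_coef_measurable:
  assumes \<psi>: "integrable lborel \<psi>"
  shows "wav_coef \<psi> a b X j k \<in> borel_measurable M"
proof -
  have [measurable]: "\<psi> \<in> borel_measurable borel" using \<psi> by auto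
  have "(\<lambda>\<omega>. LINT t|lborel. \<psi> ((t - b j k) / a j) * X t \<omega>) \<in> borel_measurable M"
    by (rule integral_X_measurable) simp
  then show ?thesis unfolding wav_coef_def[abs_def] by simp
qed

text \<open>A linear combination of coefficients is a single integral of \<open>X\<close>. On the
  lattice the transforms of its summands differ only by the phases
  \<open>cis (- (k * \<gamma> * l))\<close>, so the squared modulus contains a trigonometric square
  in \<open>\<gamma> * l\<close>, that is, a Toeplitz form.\<close>

lemma (in gaussian_spectral_process) wav_coef_lincomb_law:
  assumes \<psi>: "integrable lborel \<psi>" and a: "a j > 0" and \<gamma>: "\<gamma> > 0"
    and b: "\<And>k. b j (int k + 1) = b j 1 + \<gamma> * real k"
  shows "distr M borel (\<lambda>\<omega>. \<Sum>k<n. d k * wav_coef \<psi> a b X j (int k + 1) \<omega>) =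
    gauss_law 0 (bil n (\<lambda>k l. cos_coeff (wavelet_density f \<psi> (a j) \<gamma>) (real k - real l)) d d)"
proof -
  define e where "e k t = \<psi> ((t - b j (int k + 1)) / a j)" for k t
  define c where "c k = d k * a j powr (-1/2)" for k
  have ei: "integrable lborel (e k)" for k
  proof -
    have "integrable lborel (\<lambda>t. \<psi> (- b j (int k + 1) / a j + (1 / a j) * t))"
      using a by (intro lborel_integrable_real_affine[OF \<psi>]) simp
    moreover have "- b j (int k + 1) / a j + (1 / a j) * t = (t - b j (int k + 1)) / a j" for t
      by (simp add: diff_divide_distrib)
    ultimately show ?thesis unfolding e_def[abs_def] by simp
  qed
  define g where "g t = (\<Sum>k<n. c k * e k t)" for t
  have gi: "integrable lborel g" unfolding g_def[abs_def]
    by (intro Bochner_Integration.integrable_sum integrable_mult_right ei)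
  have gm: "g \<in> borel_measurable borel" using gi by auto
  \<comment> \<open>Drawing the finite sum into the path integral requires each summand to be
    integrable along the path, which holds outside a null set.\<close>
  have "AE \<omega> in M. \<forall>k\<in>{..<n}. integrable lborel (\<lambda>t. e k t * X t \<omega>)"
    by (rule AE_finite_allI) (use AE_integrable_weighted_X[OF ei, of "\<lambda>x. x"] in auto)
  then have AE: "AE \<omega> in M. (\<Sum>k<n. d k * wav_coef \<psi> a b X j (int k + 1) \<omega>) = (LINT t|lborel. g t * X t \<omega>)"
  proof eventually_elim
    case (elim \<omega>)
    have "(LINT t|lborel. g t * X t \<omega>) = (LINT t|lborel. (\<Sum>k<n. c k * (e k t * X t \<omega>)))"
      unfolding g_def by (simp add: sum_distrib_right mult.assoc)
    also have "\<dots> = (\<Sum>k<n. c k * (LINT t|lborel. e k t * X t \<omega>))"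
      using elim by (subst Bochner_Integration.integral_sum) auto
    finally show ?case by (simp add: wav_coef_def c_def e_def mult.assoc)
  qed
  have "distr M borel (\<lambda>\<omega>. \<Sum>k<n. d k * wav_coef \<psi> a b X j (int k + 1) \<omega>) =
      distr M borel (\<lambda>\<omega>. LINT t|lborel. g t * X t \<omega>)"
  proof (rule distr_cong_AE[OF refl refl AE])
    show "(\<lambda>\<omega>. \<Sum>k<n. d k * wav_coef \<psi> a b X j (int k + 1) \<omega>) \<in> borel_measurable M"
      by (intro borel_measurable_sum borel_measurable_times borel_measurable_const wav_coef_measurable[OF \<psi>])
    show "(\<lambda>\<omega>. LINT t|lborel. g t * X t \<omega>) \<in> borel_measurable M" by (rule integral_X_measurable[OF gm])
  qed
  also have "\<dots> = gauss_law 0 (LINT l|lborel. f l * (cmod (fourier_tr g l))\<^sup>2)"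
    by (rule integral_X_law[OF gi])
  also have "(LINT l|lborel. f l * (cmod (fourier_tr g l))\<^sup>2) =
      (LINT l|lborel. f l * (a j * (cmod (fourier_tr \<psi> (a j * l)))\<^sup>2 * trig_square n d (\<gamma> * l)))"
  proof (intro Bochner_Integration.integral_cong refl arg_cong2[where f="(*)"])
    fix l
    \<comment> \<open>The part of the transform shared by all \<open>k\<close>. Its scaling factor
      \<open>a^(-1/2) * a = sqrt a\<close> produces the \<open>a\<close> of the density.\<close>
    define z where "z = complex_of_real (a j powr (-1/2) * a j) * cis (- (l * b j 1)) * fourier_tr \<psi> (a j * l)"
    have "fourier_tr g l = (\<Sum>k<n. complex_of_real (c k) * fourier_tr (e k) l)"
      unfolding g_def[abs_def] by (rule fourier_tr_sum[OF ei])
    also have "\<dots> = (\<Sum>k<n. z * (d k *\<^sub>R cis (real k * (- (\<gamma> * l)))))"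
    proof (intro sum.cong refl)
      fix k
      have "cis (- (l * b j (int k + 1))) = cis (- (l * b j 1)) * cis (real k * (- (\<gamma> * l)))"
        unfolding b cis_mult by (simp add: algebra_simps)
      then show "complex_of_real (c k) * fourier_tr (e k) l = z * (d k *\<^sub>R cis (real k * (- (\<gamma> * l))))"
        unfolding e_def[abs_def] fourier_tr_affine[OF a] c_def z_def
        by (simp add: scaleR_conv_of_real mult_ac)
    qed
    also have "\<dots> = z * (\<Sum>k<n. d k *\<^sub>R cis (real k * (- (\<gamma> * l))))"
      by (rule sum_distrib_left[symmetric])
    finally have "(cmod (fourier_tr g l))\<^sup>2 = (cmod z)\<^sup>2 * trig_square n d (- (\<gamma> * l))"
      by (simp add: norm_mult power_mult_distrib trig_square_eq_norm)
    moreover have "(cmod z)\<^sup>2 = a j * (cmod (fourier_tr \<psi> (a j * l)))\<^sup>2"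
    proof -
      have "a j powr (-1/2) * a j = a j powr (1/2)"
        using a powr_add[of "a j" "-1/2" 1] by simp
      then have "a j powr (-1/2) * a j = sqrt (a j)" using a by (simp add: powr_half_sqrt)
      then show ?thesis unfolding z_def using a by (simp add: norm_mult power_mult_distrib)
    qed
    ultimately show "(cmod (fourier_tr g l))\<^sup>2 = a j * (cmod (fourier_tr \<psi> (a j * l)))\<^sup>2 * trig_square n d (\<gamma> * l)"
      by (simp add: trig_square_uminus)
  qed
  also have "\<dots> = (LINT x|lborel. wavelet_density f \<psi> (a j) \<gamma> x * trig_square n d x)"
    using \<gamma> by (subst lborel_integral_real_affine[of "1 / \<gamma>" _ 0])
      (auto simp: wavelet_density_def mult_ac)
  also have "\<dots> = bil n (\<lambda>k l. cos_coeff (wavelet_density f \<psi> (a j) \<gamma>) (real k - real l)) d d"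
    by (rule bil_toeplitz[OF wavelet_density_integrable[OF f_int \<psi> \<gamma>], symmetric])
  finally show ?thesis .
qed

lemma wavelet_density_mass:
  assumes "a > 0" "\<gamma> > 0"
  shows "cos_coeff (wavelet_density f \<psi> a \<gamma>) 0 = (LINT \<eta>|lborel. f (\<eta> / a) * (cmod (fourier_tr \<psi> \<eta>))\<^sup>2)"
  unfolding cos_coeff_def using assms
  by (subst (2) lborel_integral_real_affine[of "a / \<gamma>" _ 0]) (auto simp: wavelet_density_def mult_ac)

lemma fourier_square_integrable:
  assumes \<psi>: "integrable lborel \<psi>" and supp: "\<And>l. A < \<bar>l\<bar> \<Longrightarrow> fourier_tr \<psi> l = 0"
  shows "integrable lborel (\<lambda>\<eta>. (cmod (fourier_tr \<psi> \<eta>))\<^sup>2)"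
proof (rule bounded_support_integrable)
  note fourier_tr_measurable[OF \<psi>, measurable]
  show "(\<lambda>\<eta>. (cmod (fourier_tr \<psi> \<eta>))\<^sup>2) \<in> borel_measurable borel" by measurable
  show "\<bar>(cmod (fourier_tr \<psi> x))\<^sup>2\<bar> \<le> (LINT t|lborel. \<bar>\<psi> t\<bar>)\<^sup>2" for x
    by (simp add: power_mono fourier_tr_bound)
qed (use supp in simp)

text \<open>Where the transform does not vanish, the argument \<open>\<eta> / a\<close> is at most
  \<open>A / a\<close> in modulus, so the quadratic bound for \<open>f\<close> at 0 applies on the
  whole effective range of integration.\<close>

lemma wavelet_variance_bias:
  assumes f: "integrable lborel f" and \<psi>: "integrable lborel \<psi>" and a: "a > 0" and \<gamma>: "\<gamma> > 0"
    and supp: "\<And>l. A < \<bar>l\<bar> \<Longrightarrow> fourier_tr \<psi> l = 0"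
    and K: "K \<ge> 0" "\<And>l. \<bar>l\<bar> < \<rho> \<Longrightarrow> \<bar>f l - f0\<bar> \<le> K * l\<^sup>2" and \<rho>: "A / a < \<rho>"
  shows "\<bar>cos_coeff (wavelet_density f \<psi> a \<gamma>) 0 - f0 * (LINT \<eta>|lborel. (cmod (fourier_tr \<psi> \<eta>))\<^sup>2)\<bar>
    \<le> K * (A / a)\<^sup>2 * (LINT \<eta>|lborel. (cmod (fourier_tr \<psi> \<eta>))\<^sup>2)"
proof -
  note fourier_tr_measurable[OF \<psi>, measurable]
  define P where "P \<eta> = (cmod (fourier_tr \<psi> \<eta>))\<^sup>2" for \<eta>
  have Pi: "integrable lborel P" unfolding P_def[abs_def] by (rule fourier_square_integrable[OF \<psi> supp])
  have "integrable lborel (\<lambda>\<eta>. f (0 + (1 / a) * \<eta>))" using a by (intro lborel_integrable_real_affine[OF f]) simp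
  then have fa: "integrable lborel (\<lambda>\<eta>. f (\<eta> / a))" by simp
  have fPi: "integrable lborel (\<lambda>\<eta>. f (\<eta> / a) * P \<eta>)"
  proof (rule integrable_times_bounded[OF fa])
    show "\<bar>P \<eta>\<bar> \<le> (LINT t|lborel. \<bar>\<psi> t\<bar>)\<^sup>2" for \<eta> unfolding P_def by (simp add: power_mono fourier_tr_bound)
  qed (simp add: P_def[abs_def])
  have le: "\<bar>f (\<eta> / a) * P \<eta> - f0 * P \<eta>\<bar> \<le> K * (A / a)\<^sup>2 * P \<eta>" for \<eta>
  proof (cases "\<bar>\<eta>\<bar> \<le> A")
    case True
    have "\<bar>\<eta> / a\<bar> \<le> A / a" using True a by (simp add: divide_right_mono)
    then have "\<bar>f (\<eta> / a) - f0\<bar> \<le> K * (\<eta> / a)\<^sup>2" using \<rho> by (intro K(2)) simp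
    also have "\<dots> \<le> K * (A / a)\<^sup>2"
      using power_mono[OF \<open>\<bar>\<eta> / a\<bar> \<le> A / a\<close> abs_ge_zero, of 2] K(1)
      unfolding power2_abs by (rule mult_left_mono)
    finally have "\<bar>f (\<eta> / a) - f0\<bar> * P \<eta> \<le> K * (A / a)\<^sup>2 * P \<eta>"
      by (rule mult_right_mono) (simp add: P_def)
    then show ?thesis by (simp add: left_diff_distrib[symmetric] abs_mult P_def)
  next
    case False
    then show ?thesis using supp by (simp add: P_def)
  qed
  have "cos_coeff (wavelet_density f \<psi> a \<gamma>) 0 - f0 * integral\<^sup>L lborel P = (LINT \<eta>|lborel. f (\<eta> / a) * P \<eta> - f0 * P \<eta>)"
    unfolding wavelet_density_mass[OF a \<gamma>] P_def[symmetric] using fPi Pi by simp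
  also have "\<bar>\<dots>\<bar> \<le> (LINT \<eta>|lborel. \<bar>f (\<eta> / a) * P \<eta> - f0 * P \<eta>\<bar>)" by (rule integral_abs_bound)
  also have "\<dots> \<le> (LINT \<eta>|lborel. K * (A / a)\<^sup>2 * P \<eta>)"
    using fPi Pi by (intro integral_mono le) auto
  finally show ?thesis by (simp add: P_def[abs_def])
qed

text \<open>Rescaling by \<open>c\<close> turns the period \<open>2 * pi\<close> into
  \<open>2 * c * pi\<close>; of the factor \<open>(c * s)^2\<close> one \<open>c\<close> is the
  Jacobian of \<eta> = c y.\<close>

lemma limit_periodization_integral:
  fixes c s :: real and \<psi> :: "real \<Rightarrow> real"
  assumes c: "c > 0"
  defines "G \<equiv> (\<lambda>\<eta>. \<Sum>\<^sub>\<infinity>n::int. (cmod (fourier_tr \<psi> (\<eta> + 2 * real_of_int n * c * pi)))\<^sup>2)"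
  shows "(LINT y|lborel. (periodization (\<lambda>x. c * s * (cmod (fourier_tr \<psi> (c * x)))\<^sup>2) y)\<^sup>2 * indicator {-pi..pi} y) =
    c * s\<^sup>2 * (LINT \<eta>:{-c*pi..c*pi}|lborel. \<bar>G \<eta>\<bar>\<^sup>2)"
proof -
  have per: "periodization (\<lambda>x. c * s * (cmod (fourier_tr \<psi> (c * x)))\<^sup>2) y = c * s * G (c * y)" for y
    unfolding periodization_def G_def by (subst infsum_cmult_right') (simp add: algebra_simps)
  have ind: "indicator {-c*pi..c*pi} (c * y) = (indicator {-pi..pi} y :: real)" for y
  proof -
    have "c * y \<le> c * pi \<longleftrightarrow> y \<le> pi" "- c * pi \<le> c * y \<longleftrightarrow> - pi \<le> y"
      using c mult_le_cancel_left_pos[OF c, of "-pi" y] by auto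
    then show ?thesis by (simp add: indicator_def)
  qed
  have "(LINT \<eta>:{-c*pi..c*pi}|lborel. \<bar>G \<eta>\<bar>\<^sup>2) = (LINT \<eta>|lborel. indicator {-c*pi..c*pi} \<eta> * (G \<eta>)\<^sup>2)"
    by (simp add: set_lebesgue_integral_def)
  also have "\<dots> = c * (LINT y|lborel. indicator {-c*pi..c*pi} (c * y) * (G (c * y))\<^sup>2)"
    using c by (subst lborel_integral_real_affine[of c _ 0]) auto
  also have "\<dots> = c * (LINT y|lborel. (G (c * y))\<^sup>2 * indicator {-pi..pi} y)"
    unfolding ind by (simp add: mult.commute)
  finally have "c * s\<^sup>2 * (LINT \<eta>:{-c*pi..c*pi}|lborel. \<bar>G \<eta>\<bar>\<^sup>2) =
    (c * s)\<^sup>2 * (LINT y|lborel. (G (c * y))\<^sup>2 * indicator {-pi..pi} y)"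
    by (simp add: power2_eq_square)
  also have "\<dots> = (LINT y|lborel. (c * s)\<^sup>2 * ((G (c * y))\<^sup>2 * indicator {-pi..pi} y))"
    by (rule integral_mult_right_zero[symmetric])
  finally show ?thesis unfolding per by (simp only: power_mult_distrib mult.assoc)
qed

lemma wavelet_density_tendsto:
  fixes \<gamma> :: "nat \<Rightarrow> real"
  assumes \<psi>: "integrable lborel \<psi>" and f: "isCont f 0"
    and lim: "(\<lambda>j. a j / \<gamma> j) \<longlonglongrightarrow> c" and \<gamma>: "filterlim \<gamma> at_top sequentially"
  shows "((\<lambda>(j, u). wavelet_density f \<psi> (a j) (\<gamma> j) (x + u)) \<longlongrightarrow>
    c * f 0 * (cmod (fourier_tr \<psi> (c * x)))\<^sup>2) (sequentially \<times>\<^sub>F nhds 0)"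
proof -
  let ?F = "sequentially \<times>\<^sub>F nhds (0::real)"
  have r: "((\<lambda>p. a (fst p) / \<gamma> (fst p)) \<longlongrightarrow> c) ?F"
    by (rule filterlim_compose[OF lim filterlim_fst])
  have u: "((\<lambda>p. x + snd p) \<longlongrightarrow> x + 0) ?F"
    by (intro tendsto_add tendsto_const filterlim_snd)
  have "filterlim (\<lambda>p. \<gamma> (fst p)) at_infinity ?F"
    by (intro filterlim_at_top_imp_at_infinity filterlim_compose[OF \<gamma> filterlim_fst])
  then have "((\<lambda>p. (x + snd p) / \<gamma> (fst p)) \<longlongrightarrow> 0) ?F"
    by (rule tendsto_divide_0[OF u])
  then have 1: "((\<lambda>p. f ((x + snd p) / \<gamma> (fst p))) \<longlongrightarrow> f 0) ?F"
    by (rule isCont_tendsto_compose[OF f])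
  have "((\<lambda>p. a (fst p) / \<gamma> (fst p) * (x + snd p)) \<longlongrightarrow> c * (x + 0)) ?F"
    by (intro tendsto_mult r u)
  then have 2: "((\<lambda>p. fourier_tr \<psi> (a (fst p) / \<gamma> (fst p) * (x + snd p))) \<longlongrightarrow> fourier_tr \<psi> (c * (x + 0))) ?F"
    by (rule isCont_tendsto_compose[OF fourier_tr_isCont[OF \<psi>]])
  have "((\<lambda>p. a (fst p) / \<gamma> (fst p) * f ((x + snd p) / \<gamma> (fst p)) *
      (cmod (fourier_tr \<psi> (a (fst p) / \<gamma> (fst p) * (x + snd p))))\<^sup>2) \<longlongrightarrow>
      c * f 0 * (cmod (fourier_tr \<psi> (c * (x + 0))))\<^sup>2) ?F"
    by (intro tendsto_mult r 1 tendsto_power tendsto_norm 2)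
  then show ?thesis by (simp add: wavelet_density_def case_prod_unfold)
qed

text \<open>Keeps away from the singularities of \<open>f\<close>: a nonzero transform forces
  \<open>\<bar>x / \<gamma> j\<bar> \<le> A / a j\<close>, which is eventually below
  \<open>\<rho>\<close>. The constants come from \<open>a j / \<gamma> j\<close> lying eventually
  between \<open>c / 2\<close> and \<open>2 * c\<close>.\<close>

lemma wavelet_density_uniform_bound:
  fixes \<gamma> :: "nat \<Rightarrow> real"
  assumes \<psi>: "integrable lborel \<psi>" and supp: "\<And>l. A < \<bar>l\<bar> \<Longrightarrow> fourier_tr \<psi> l = 0" and A: "A > 0"
    and a: "\<And>j. a j > 0" "filterlim a at_top sequentially" and \<gamma>: "\<And>j. \<gamma> j > 0"
    and c: "c > 0" and lim: "(\<lambda>j. a j / \<gamma> j) \<longlonglongrightarrow> c"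
    and \<rho>: "\<rho> > 0" "\<And>l. \<bar>l\<bar> < \<rho> \<Longrightarrow> \<bar>f l\<bar> \<le> F"
  shows "eventually (\<lambda>j. \<forall>x. \<bar>wavelet_density f \<psi> (a j) (\<gamma> j) x\<bar> \<le> 2 * c * F * (LINT t|lborel. \<bar>\<psi> t\<bar>)\<^sup>2 \<and>
     (2 * A / c < \<bar>x\<bar> \<longrightarrow> wavelet_density f \<psi> (a j) (\<gamma> j) x = 0)) sequentially"
proof -
  have e1: "eventually (\<lambda>j. a j / \<gamma> j < 2 * c) sequentially" using lim c by (intro order_tendstoD) auto
  have e2: "eventually (\<lambda>j. c / 2 < a j / \<gamma> j) sequentially" using lim c by (intro order_tendstoD) auto
  have e3: "eventually (\<lambda>j. A / \<rho> < a j) sequentially"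
    using a(2) unfolding filterlim_at_top_dense by blast
  have F0: "0 \<le> F" using \<rho>(2)[of 0] \<rho>(1) by simp
  show ?thesis using e1 e2 e3
  proof eventually_elim
    case (elim j)
    have r0: "0 < a j / \<gamma> j" using a(1)[of j] \<gamma>[of j] by simp
    show ?case
    proof (intro allI conjI impI)
      fix x
      show "\<bar>wavelet_density f \<psi> (a j) (\<gamma> j) x\<bar> \<le> 2 * c * F * (LINT t|lborel. \<bar>\<psi> t\<bar>)\<^sup>2"
      proof (cases "\<bar>a j / \<gamma> j * x\<bar> \<le> A")
        case True
        have "\<bar>x / \<gamma> j\<bar> = \<bar>a j / \<gamma> j * x\<bar> / a j" using a(1)[of j] by (simp add: abs_mult abs_divide)
        also have "\<dots> \<le> A / a j" using True a(1)[of j] by (intro divide_right_mono) auto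
        also have "\<dots> < \<rho>" using elim(3) a(1)[of j] \<rho>(1) by (simp add: field_simps)
        finally have "\<bar>f (x / \<gamma> j)\<bar> \<le> F" by (rule \<rho>(2))
        moreover have "\<bar>a j / \<gamma> j\<bar> \<le> 2 * c" using r0 elim(1) by simp
        ultimately have "\<bar>a j / \<gamma> j\<bar> * \<bar>f (x / \<gamma> j)\<bar> * (cmod (fourier_tr \<psi> (a j / \<gamma> j * x)))\<^sup>2
            \<le> 2 * c * F * (LINT t|lborel. \<bar>\<psi> t\<bar>)\<^sup>2"
          using F0 c by (intro mult_mono power_mono fourier_tr_bound) auto
        then show ?thesis by (simp only: wavelet_density_def abs_mult abs_power2 power_abs abs_norm_cancel)
      next
        case False
        then have "wavelet_density f \<psi> (a j) (\<gamma> j) x = 0" using supp by (simp add: wavelet_density_def)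
        then show ?thesis using F0 c by simp
      qed
    next
      fix x assume x: "2 * A / c < \<bar>x\<bar>"
      have "A = c / 2 * (2 * A / c)" using c by simp
      also have "\<dots> < a j / \<gamma> j * \<bar>x\<bar>" using elim(2) x c A r0 by (intro mult_strict_mono) auto
      also have "\<dots> = \<bar>a j / \<gamma> j * x\<bar>" using r0 by (simp only: abs_mult abs_of_pos)
      finally show "wavelet_density f \<psi> (a j) (\<gamma> j) x = 0" using supp by (simp add: wavelet_density_def)
    qed
  qed
qed

lemma wavelet_frobenius_limit:
  fixes \<gamma> :: "nat \<Rightarrow> real" and m :: "nat \<Rightarrow> nat"
  assumes f: "integrable lborel f" "isCont f 0" "\<And>l. f (- l) = f l"
    and \<psi>: "integrable lborel \<psi>"
    and m: "filterlim m at_top sequentially" "\<And>j. m j > 0"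
    and \<gamma>: "\<And>j. \<gamma> j > 0" "filterlim \<gamma> at_top sequentially" and lim: "(\<lambda>j. a j / \<gamma> j) \<longlonglongrightarrow> c"
    and B: "B > 0"
    and bnd: "eventually (\<lambda>j. \<forall>x. \<bar>wavelet_density f \<psi> (a j) (\<gamma> j) x\<bar> \<le> C \<and>
       (B < \<bar>x\<bar> \<longrightarrow> wavelet_density f \<psi> (a j) (\<gamma> j) x = 0)) sequentially"
  shows "(\<lambda>j. (1 / real (m j)) * (\<Sum>k<m j. \<Sum>l<m j.
      (cos_coeff (wavelet_density f \<psi> (a j) (\<gamma> j)) (real k - real l))\<^sup>2)) \<longlonglongrightarrow>
    2 * pi * (LINT y|lborel. (periodization (\<lambda>x. c * f 0 * (cmod (fourier_tr \<psi> (c * x)))\<^sup>2) y)\<^sup>2 * indicator {-pi..pi} y)"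
proof -
  note fourier_tr_measurable[OF \<psi>, measurable]
  define q where "q j = wavelet_density f \<psi> (a j) (\<gamma> j)" for j
  from bnd obtain J where J: "\<And>j x. J \<le> j \<Longrightarrow> \<bar>q j x\<bar> \<le> C" "\<And>j x. J \<le> j \<Longrightarrow> B < \<bar>x\<bar> \<Longrightarrow> q j x = 0"
    unfolding q_def eventually_sequentially by blast
  \<comment> \<open>The limit theorem for Toeplitz matrices asks for its bounds at every index,
    whereas here they hold only eventually; hence the shift by \<open>J\<close>.\<close>
  have "(\<lambda>j. (1 / real (m (j + J))) * (\<Sum>k<m (j + J). \<Sum>l<m (j + J). (cos_coeff (q (j + J)) (real k - real l))\<^sup>2)) \<longlonglongrightarrow>
    2 * pi * (LINT y|lborel. (periodization (\<lambda>x. c * f 0 * (cmod (fourier_tr \<psi> (c * x)))\<^sup>2) y)\<^sup>2 * indicator {-pi..pi} y)"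
  proof (rule toeplitz_frobenius_limit)
    show "filterlim (\<lambda>j. m (j + J)) at_top sequentially"
      by (rule filterlim_compose[OF m(1) filterlim_add_const_nat_at_top])
    show "m (j + J) > 0" for j by (rule m(2))
    show "q (j + J) \<in> borel_measurable borel" for j
      using borel_measurable_integrable[OF wavelet_density_integrable[OF f(1) \<psi> \<gamma>(1)]] by (simp add: q_def)
    show "\<bar>q (j + J) x\<bar> \<le> C" for j x by (rule J(1)) simp
    show "q (j + J) x = 0" if "B < \<bar>x\<bar>" for j x using that by (intro J(2)) auto
    show "q (j + J) (- x) = q (j + J) x" for j x
      unfolding q_def wavelet_density_def using f(3) fourier_tr_uminus[of \<psi> "a (j + J) / \<gamma> (j + J) * x"] by simp
    have sh: "filterlim (\<lambda>p. (fst p + J, snd p)) (sequentially \<times>\<^sub>F nhds 0) (sequentially \<times>\<^sub>F nhds (0::real))"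
      by (intro filterlim_Pair filterlim_snd filterlim_compose[OF filterlim_add_const_nat_at_top filterlim_fst])
    show "((\<lambda>(j, u). q (j + J) (x + u)) \<longlongrightarrow> c * f 0 * (cmod (fourier_tr \<psi> (c * x)))\<^sup>2) (sequentially \<times>\<^sub>F nhds 0)" for x
      using filterlim_compose[OF wavelet_density_tendsto[OF \<psi> f(2) lim \<gamma>(2)] sh, of x]
      by (simp add: q_def case_prod_unfold)
  qed (use B in auto)
  then show ?thesis unfolding q_def by (rule LIMSEQ_offset)
qed

section \<open>Normal limit for the empirical second moment of the coefficients\<close>

theorem theorem2:
  fixes M :: "'a measure" and X :: "real \<Rightarrow> 'a \<Rightarrow> real"
    and h \<psi> :: "real \<Rightarrow> real" and s0 \<alpha> A c :: real
    and a \<gamma> :: "nat \<Rightarrow> real" and m :: "nat \<Rightarrow> nat" and b :: "nat \<Rightarrow> int \<Rightarrow> real"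
  defines "f \<equiv> (\<lambda>l. h l / \<bar>l\<^sup>2 - s0\<^sup>2\<bar> powr (2 * \<alpha>))"
    and "Y \<equiv> (\<lambda>j \<omega>. sqrt (real (m j)) *
              ((1 / real (m j)) * (\<Sum>k=1..int (m j). (wav_coef \<psi> a b X j k \<omega>)\<^sup>2) - s0 powr (-4 * \<alpha>) * (LINT \<eta>|lborel. (cmod (fourier_tr \<psi> \<eta>))\<^sup>2)))"
    and "V1 \<equiv> 4 * c * pi * s0 powr (-8 * \<alpha>) *
              (LINT \<eta>:{-c*pi..c*pi}|lborel.
                 \<bar>\<Sum>\<^sub>\<infinity>n::int. (cmod (fourier_tr \<psi> (\<eta> + 2 * real_of_int n * c * pi)))\<^sup>2\<bar>\<^sup>2)"
  assumes M: "prob_space M"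
    and X_meas: "(\<lambda>(t, \<omega>). X t \<omega>) \<in> borel_measurable (lborel \<Otimes>\<^sub>M M)"
    and X_gauss: "gaussian_process M X"
    and X_stat: "strictly_stationary M X"
    and X_mean: "\<forall>t. (\<integral>\<omega>. X t \<omega> \<partial>M) = 0"
    and X_ms_cont: "\<forall>t. ((\<lambda>s. \<integral>\<omega>. (X s \<omega> - X t \<omega>)\<^sup>2 \<partial>M) \<longlongrightarrow> 0) (at t)"
    and X_spec: "\<forall>s t. complex_of_real (\<integral>\<omega>. X s \<omega> * X t \<omega> \<partial>M) =
                   (LINT l|lborel. cis (l * (t - s)) * complex_of_real (f l))"
    and s0: "s0 > 1" and \<alpha>: "0 < \<alpha>" "\<alpha> < 1/2"
    and h_even: "\<forall>l. h (- l) = h l" and h_nonneg: "\<forall>l. h l \<ge> 0" and h_bdd: "bounded (range h)"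
    and h_diff: "\<forall>i<4. \<forall>x. ((deriv ^^ i) h) differentiable (at x)"
    and h_cont: "continuous_on UNIV ((deriv ^^ 4) h)"
    and h_deriv0: "\<forall>i\<in>{1..4::nat}. (deriv ^^ i) h 0 = 0" and h0: "h 0 = 1"
    and h_pos: "\<exists>e>0. \<forall>l. \<bar>l - s0\<bar> < e \<or> \<bar>l + s0\<bar> < e \<longrightarrow> h l > 0"
    and h_int: "\<forall>\<epsilon>>0. integrable lborel (\<lambda>l. h l * (1 + \<bar>l\<bar>) powr (- \<epsilon>))"
    and \<psi>_int: "integrable lborel \<psi>" and A: "A > 0"
    and \<psi>_supp: "\<forall>l. \<bar>l\<bar> > A \<longrightarrow> fourier_tr \<psi> l = 0"
    and \<psi>_bv: "bounded_variation_on (fourier_tr \<psi>) (- A) A"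
    and a_mono: "strict_mono a" and a_pos: "\<forall>j. a j > 0" and a_unbdd: "\<not> bdd_above (range a)"
    and m_mono: "mono m" and m_pos: "\<forall>j. m j > 0" and m_unbdd: "filterlim m at_top sequentially"
    and \<gamma>_pos: "\<forall>j. \<gamma> j > 0"
    and b_lattice: "\<forall>j k l. b j k - b j l = \<gamma> j * real_of_int (k - l)"
    and c: "c > 0" and lim1: "(\<lambda>j. a j / \<gamma> j) \<longlonglongrightarrow> c"
    and lim2: "(\<lambda>j. (real (m j))\<^sup>2 * (\<gamma> j / a j - 1 / c)) \<longlonglongrightarrow> 0"
    and lim3: "(\<lambda>j. real (m j) / (a j)^4) \<longlonglongrightarrow> 0"
  shows "weak_conv_m (\<lambda>j. distr M borel (Y j)) (gauss_law 0 V1)"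
proof -
  interpret prob_space M by (rule M)
  define P where "P \<eta> = (cmod (fourier_tr \<psi> \<eta>))\<^sup>2" for \<eta>
  define E where "E = integral\<^sup>L lborel P"
  have \<psi>_supp': "A < \<bar>l\<bar> \<Longrightarrow> fourier_tr \<psi> l = 0" for l using \<psi>_supp by blast
  have "continuous_on UNIV h"
    using h_diff[rule_format, of 0]
    by (auto intro!: differentiable_imp_continuous_on differentiable_at_imp_differentiable_on)
  then have h_meas: "h \<in> borel_measurable borel" by (rule borel_measurable_continuous_onI)
  obtain H where H: "\<And>l. h l \<le> H"
    using h_bdd unfolding bounded_iff by (auto intro: order_trans[OF abs_ge_self])
  have f_int: "integrable lborel f"
    unfolding f_def using h_nonneg H h_meas h_int \<alpha> s0
    by (intro spectral_density_integrable[where H=H]) auto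
  have f_nonneg: "f l \<ge> 0" for l unfolding f_def using h_nonneg by simp
  have f_even: "f (- l) = f l" for l unfolding f_def using h_even by simp
  interpret gaussian_spectral_process M X f
    using X_meas X_gauss X_mean X_ms_cont X_spec f_int f_nonneg by unfold_locales auto
  have hq: "eventually (\<lambda>x. \<bar>h x - h 0\<bar> \<le> x\<^sup>2) (nhds 0)"
  proof (rule quadratic_bound_from_derivs)
    show "\<forall>i<3. \<forall>x. ((deriv ^^ i) h) differentiable (at x)" using h_diff by auto
    show "(deriv ^^ 1) h 0 = 0" "(deriv ^^ 2) h 0 = 0" by (rule h_deriv0[rule_format]; simp)+
  qed
  have s0': "s0 > 0" using s0 by simp
  have f0: "f 0 = s0 powr (- 4 * \<alpha>)"
    unfolding f_def by (rule spectral_density_near_0(1)[OF s0' h0 hq])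
  obtain \<rho> K where \<rho>: "\<rho> > 0" and K: "K \<ge> 0" "\<And>l. \<bar>l\<bar> < \<rho> \<Longrightarrow> \<bar>f l - f 0\<bar> \<le> K * l\<^sup>2"
    using spectral_density_near_0(2)[OF s0' h0 hq, of \<alpha>] unfolding f_def by blast
  have f_cont: "isCont f 0"
  proof -
    have "((\<lambda>l. K * l\<^sup>2) \<longlongrightarrow> K * 0\<^sup>2) (at 0)" by (intro tendsto_intros)
    then have lim: "((\<lambda>l. K * l\<^sup>2) \<longlongrightarrow> 0) (at 0)" by simp
    have "eventually (\<lambda>l. norm (f l - f 0) \<le> K * l\<^sup>2) (at 0)"
      unfolding eventually_at using \<rho> K(2) by (auto simp: dist_real_def)
    from Lim_null_comparison[OF this lim] show ?thesis unfolding isCont_def by (simp add: LIM_zero_iff)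
  qed
  define F where "F = \<bar>f 0\<bar> + K * \<rho>\<^sup>2"
  have F: "\<bar>f l\<bar> \<le> F" if "\<bar>l\<bar> < \<rho>" for l
  proof -
    have "\<bar>l\<bar>\<^sup>2 \<le> \<rho>\<^sup>2" using that by (intro power_mono) auto
    then have "K * l\<^sup>2 \<le> K * \<rho>\<^sup>2" using K(1) by (intro mult_left_mono) auto
    then show ?thesis using K(2)[OF that] unfolding F_def by linarith
  qed
  have a_top: "filterlim a at_top sequentially"
    unfolding filterlim_at_top
  proof
    fix Z
    from a_unbdd obtain n where "Z < a n" unfolding bdd_above_def by (auto simp: not_le)
    then have "Z \<le> a j" if "n \<le> j" for j
      using that a_mono[THEN strict_mono_mono] by (meson less_imp_le monoD order_trans)
    then show "eventually (\<lambda>j. Z \<le> a j) sequentially" by (auto simp: eventually_sequentially)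
  qed
  have \<gamma>_top: "filterlim \<gamma> at_top sequentially"
  proof -
    \<comment> \<open>The lattice spacing grows with the scale, since their ratio has a positive
      limit.\<close>
    have "(\<lambda>j. inverse (a j / \<gamma> j)) \<longlonglongrightarrow> inverse c" using lim1 c by (intro tendsto_inverse) auto
    from filterlim_tendsto_pos_mult_at_top[OF this _ a_top] have
      "filterlim (\<lambda>j. inverse (a j / \<gamma> j) * a j) at_top sequentially" using c by simp
    moreover have "inverse (a j / \<gamma> j) * a j = \<gamma> j" for j using a_pos \<gamma>_pos by (simp add: less_imp_neq[symmetric])
    ultimately show ?thesis by simp
  qed
  define q where "q j = wavelet_density f \<psi> (a j) (\<gamma> j)" for j
  have q_int: "integrable lborel (q j)" for j
    unfolding q_def using \<gamma>_pos by (intro wavelet_density_integrable f_int \<psi>_int) auto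
  define B where "B = 2 * A / c"
  have B: "B > 0" using A c by (simp add: B_def)
  define C where "C = 2 * c * F * (LINT t|lborel. \<bar>\<psi> t\<bar>)\<^sup>2"
  have bnd: "eventually (\<lambda>j. \<forall>x. \<bar>q j x\<bar> \<le> C \<and> (B < \<bar>x\<bar> \<longrightarrow> q j x = 0)) sequentially"
    unfolding q_def B_def C_def using a_pos \<gamma>_pos
    by (intro wavelet_density_uniform_bound[OF \<psi>_int \<psi>_supp' A _ a_top _ c lim1 \<rho> F]) auto
  define D where "D j k = wav_coef \<psi> a b X j (int k + 1)" for j k
  define R where "R j k l = cos_coeff (q j) (real k - real l)" for j k l
  have lattice: "b j (int k + 1) = b j 1 + \<gamma> j * real k" for j k
    using b_lattice[rule_format, of j "int k + 1" 1] by simp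
  have law: "distr M borel (\<lambda>\<omega>. \<Sum>k<n. d k * D j k \<omega>) = gauss_law 0 (bil n (R j) d d)" for n j d
    unfolding D_def R_def[abs_def] q_def
    using a_pos \<gamma>_pos by (intro wav_coef_lincomb_law \<psi>_int lattice) auto
  have pos: "0 \<le> bil n (R j) d d" for n j d
  proof -
    have "0 \<le> q j x" for x
      unfolding q_def wavelet_density_def using f_nonneg a_pos \<gamma>_pos by (simp add: less_imp_le)
    then show ?thesis
      unfolding R_def[abs_def] bil_toeplitz[OF q_int] using trig_square_nonneg
      by (intro Bochner_Integration.integral_nonneg) auto
  qed
  \<comment> \<open>Enough periods to contain the common support \<open>[-B, B]\<close>, which turns
    the bound on the densities into one bound on all eigenvalues.\<close>
  obtain N :: nat where N: "B / pi + 1 \<le> real N" using real_arch_simple by blast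
  have N0: "N > 0" "B \<le> real N * pi"
  proof -
    have "0 < B / pi" using B by simp
    then show "N > 0" using N by (cases N) auto
    have "B / pi \<le> real N" using N by simp
    then show "B \<le> real N * pi" by (simp add: pos_divide_le_eq)
  qed
  have op: "eventually (\<lambda>j. \<forall>d. bil (m j) (R j) d d \<le> (C * (2 * real N * pi)) * (\<Sum>k<m j. (d k)\<^sup>2)) sequentially"
    using bnd
  proof eventually_elim
    case (elim j)
    show ?case
      unfolding R_def[abs_def] using elim q_int[of j]
      by (intro allI bil_toeplitz_le[OF _ _ _ N0]) auto
  qed
  \<comment> \<open>The Frobenius limit is half the variance; the remaining factor 2 of
    \<open>V1\<close> is the variance of a centred chi-square variable.\<close>
  have V1: "2 * pi * (LINT y|lborel. (periodization (\<lambda>x. c * f 0 * (cmod (fourier_tr \<psi> (c * x)))\<^sup>2) y)\<^sup>2 * indicator {-pi..pi} y)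
      = V1 / 2"
  proof -
    have "(f 0)\<^sup>2 = s0 powr (-8 * \<alpha>)"
      unfolding f0 power2_eq_square by (simp add: powr_add[symmetric])
    then show ?thesis unfolding limit_periodization_integral[OF c] V1_def by simp
  qed
  have frob: "(\<lambda>j. (1 / real (m j)) * (\<Sum>i<m j. \<Sum>k<m j. (R j i k)\<^sup>2)) \<longlonglongrightarrow> V1 / 2"
    unfolding R_def q_def V1[symmetric]
    using m_pos \<gamma>_pos bnd[unfolded q_def]
    by (intro wavelet_frobenius_limit[where B=B and C=C] f_int f_cont f_even \<psi>_int m_unbdd \<gamma>_top lim1 B) auto
  define \<mu> where "\<mu> = s0 powr (-4 * \<alpha>) * E"
  have trace: "(1 / real (m j)) * (\<Sum>k<m j. R j k k) = cos_coeff (q j) 0" for j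
    using m_pos[rule_format, of j] by (simp add: R_def)
  \<comment> \<open>The relative position of \<open>m\<close> and \<open>a\<close> decides here:
    \<open>sqrt m\<close> times the bias \<open>K * (A / a)^2 * E\<close> is a multiple of
    \<open>sqrt (m / a^4)\<close>, so \<open>lim3\<close> is the matching growth condition.\<close>
  have bias: "(\<lambda>j. sqrt (real (m j)) * ((1 / real (m j)) * (\<Sum>k<m j. R j k k) - \<mu>)) \<longlonglongrightarrow> 0"
    unfolding trace
  proof (rule Lim_null_comparison)
    have "(\<lambda>j. K * A\<^sup>2 * E * sqrt (real (m j) / (a j)^4)) \<longlonglongrightarrow> K * A\<^sup>2 * E * sqrt 0"
      by (intro tendsto_intros lim3)
    then show "(\<lambda>j. K * A\<^sup>2 * E * sqrt (real (m j) / (a j)^4)) \<longlonglongrightarrow> 0" by simp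
    have "eventually (\<lambda>j. A / \<rho> < a j) sequentially"
      using a_top unfolding filterlim_at_top_dense by blast
    then show "eventually (\<lambda>j. norm (sqrt (real (m j)) * (cos_coeff (q j) 0 - \<mu>)) \<le>
        K * A\<^sup>2 * E * sqrt (real (m j) / (a j)^4)) sequentially"
    proof eventually_elim
      case (elim j)
      have aj: "a j > 0" and \<gamma>j: "\<gamma> j > 0" using a_pos \<gamma>_pos by auto
      have "A / a j < \<rho>" using elim aj \<rho> by (simp add: field_simps)
      from wavelet_variance_bias[OF f_int \<psi>_int aj \<gamma>j \<psi>_supp' K this]
      have "\<bar>cos_coeff (q j) 0 - \<mu>\<bar> \<le> K * (A / a j)\<^sup>2 * E"
        unfolding q_def \<mu>_def f0[symmetric] E_def P_def[abs_def] by simp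
      then have "sqrt (real (m j)) * \<bar>cos_coeff (q j) 0 - \<mu>\<bar> \<le> sqrt (real (m j)) * (K * (A / a j)\<^sup>2 * E)"
        by (intro mult_left_mono) auto
      also have "\<dots> = K * A\<^sup>2 * E * sqrt (real (m j) / (a j)^4)"
      proof -
        have "sqrt ((a j)^4) = (a j)\<^sup>2"
          by (rule real_sqrt_unique) (simp_all flip: power_mult)
        then show ?thesis by (simp add: real_sqrt_divide power_divide)
      qed
      finally show ?case by (simp add: abs_mult)
    qed
  qed
  have "weak_conv_m (\<lambda>j. distr M borel (\<lambda>\<omega>. sqrt (real (m j)) *
      ((1 / real (m j)) * (\<Sum>k<m j. (D j k \<omega>)\<^sup>2) - \<mu>))) (gauss_law 0 V1)"
  proof (rule gaussian_quadratic_form_clt[OF _ law _ pos op m_unbdd frob bias])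
    show "D j k \<in> borel_measurable M" for j k unfolding D_def by (rule wav_coef_measurable[OF \<psi>_int])
    show "R j i k = R j k i" for j i k
      unfolding R_def cos_coeff_def by (subst cos_minus[symmetric]) (simp add: algebra_simps)
  qed
  \<comment> \<open>The coefficients are numbered from 1 by integers, the matrices from 0 by
    naturals.\<close>
  moreover have "(\<Sum>k=1..int (m j). (wav_coef \<psi> a b X j k \<omega>)\<^sup>2) = (\<Sum>k<m j. (D j k \<omega>)\<^sup>2)" for j \<omega>
    unfolding D_def
    by (rule sum.reindex_bij_witness[of _ "\<lambda>k. int k + 1" "\<lambda>i. nat (i - 1)"]) auto
  ultimately show ?thesis unfolding Y_def \<mu>_def E_def P_def[abs_def] by simp
qed

end
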